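(* Let $p,q,n$ be positive integers with $p+q$ odd, and let $a,b\in\{1,-1\}$, with $p\neq 1$ when $a^nb=1$, and $q\neq 1$ when $a=1$. Then the following two identities hold. (i) $$\begin{aligned}\int_0^1\frac{\ln^{q-1}(x)\operatorname{Li}_{p}(bx^{n})}{1-ax}\,\mathrm{d}x={}&\tfrac12 ab(-1)^{q}(q-1)!\,n^{-q}\,\Phi(b,p+q,1)-\tfrac12a^{n}b(1+(-1)^{q})(q-1)!\,\Phi(a,q,1)\,\Phi(a^nb,p,1)\\ &+a^{n-1}n^{-q}(q-1)!\sum_{j=0}^{\lfloor q/2\rfloor}\binom{p+q-2j-1}{p-1}\Phi(b,2j,1)\,\Phi(a^nb,p+q-2j,1)\\ &+bn^{p}(q-1)!\sum_{k=0}^{\lfloor p/2\rfloor}\binom{p+q-2k-1}{q-1}n^{-2k}\,\Phi(b,2k,1)\,\Phi(a,p+q-2k,1)\\ &+\tfrac12a^{n}b\,n^{-q}(q-1)!\sum_{j=2}^{n}\sum_{k=1}^{q}\binom{p+q-k-1}{p-1}a^{j}(-1)^{k}\,\Theta(b,k,j-1,n)\,\Phi\!\left(a^nb,p+q-k,\tfrac{n-j+1}{n}\right);\end{aligned}$$ (ii) $$\begin{aligned}\int_0^1\frac{\ln^{q-1}(x)\operatorname{Li}_{p}(bx^{-n})}{1-ax}\,\mathrm{d}x={}&\tfrac12 ab(q-1)!\,n^{-q}\,\Phi(b,p+q,1)-\tfrac12a^{n}b(1+(-1)^{q})(q-1)!\,\Phi(a^nb,p,1)\,\Phi(a,q,1)\\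 &+a^{n-1}(-n)^{-q}(q-1)!\sum_{j=0}^{\lfloor q/2\rfloor}\binom{p+q-2j-1}{p-1}\Phi(b,2j,1)\,\Phi(a^nb,p+q-2j,1)\\ &+b(-n)^{p}(q-1)!\sum_{k=0}^{\lfloor p/2\rfloor}\binom{p+q-2k-1}{q-1}n^{-2k}\,\Phi(b,2k,1)\,\Phi(a,p+q-2k,1)\\ &+\tfrac12a^{n}b\,(-n)^{-q}(q-1)!\sum_{j=2}^{n}\sum_{k=1}^{q}\binom{p+q-k-1}{p-1}a^{j}(-1)^{k}\,\Theta(b,k,j-1,n)\,\Phi\!\left(a^nb,p+q-k,\tfrac{n-j+1}{n}\right).\end{aligned}$$ The integral in (ii) is understood as a Cauchy principal value when $b=1$ (that is, $\operatorname{Li}_p$ at arguments $>1$ is given by its principal-value integral).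
   Context: Polylogarithm: for real $x\le 1$, $\operatorname{Li}_p(x)=\frac{(-1)^{p-1}}{(p-1)!}\int_0^1\frac{x\ln^{p-1}(y)}{1-xy}\,\mathrm{d}y$; for $x>1$, $\operatorname{Li}_p(x)$ denotes the Cauchy principal value of the same integral (equivalently, the real part of the analytically continued polylogarithm). Lerch function: for $c=\pm1$, integer $q\ge1$ (with $q\neq1$ if $c=1$) and $\alpha>0$, $\Phi(c,q,\alpha)=\sum_{m=0}^\infty \frac{c^m}{(m+\alpha)^q}$. At $q=0$, $\alpha=1$ the values by analytic continuation are used: $\Phi(1,0,1)=\zeta(0)=-\tfrac12$ and $\Phi(-1,0,1)=\eta(0)=\tfrac12$. For $c=\pm1$, integer $k\ge 1$ and $0<s<r$: $\Theta(c,k,s,r)=\Phi(c,k,\tfrac{s}{r})+c(-1)^{k}\Phi(c,k,\tfrac{r-s}{r})$ if $(c,k)\ne(1,1)$, and $\Theta(1,1,s,r)=\pi\cot(\pi s/r)$. Empty sums are $0$. *)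

theory Defs
  imports "HOL-Analysis.Analysis"
begin

text \<open>Cauchy principal value over \<open>[u, v]\<close> of an integral with a singularity at the interior
  point \<open>c\<close>.\<close>

definition pv_integral :: "real \<Rightarrow> real \<Rightarrow> real \<Rightarrow> (real \<Rightarrow> real) \<Rightarrow> real" where
  "pv_integral u c v f =
     Lim (at_right 0) (\<lambda>\<epsilon>. integral {u..c - \<epsilon>} f + integral {c + \<epsilon>..v} f)"

text \<open>For \<open>x > 1\<close> the integrand has a simple pole at \<open>y = 1 / x\<close>, inside the unit interval.
  The functions below are meant for order \<open>p \<ge> 1\<close>; at the excluded point \<open>p = 1\<close>, \<open>x = 1\<close> the
  integral diverges and the value of \<open>polylog\<close> is meaningless.\<close>

definition polylog_integrand :: "nat \<Rightarrow> real \<Rightarrow> real \<Rightarrow> real" where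
  "polylog_integrand p x y = x * ln y ^ (p - 1) / (1 - x * y)"

definition polylog :: "nat \<Rightarrow> real \<Rightarrow> real" where
  "polylog p x = (-1) ^ (p - 1) / fact (p - 1) *
     (if x \<le> 1 then integral {0..1} (polylog_integrand p x)
      else pv_integral 0 (1 / x) 1 (polylog_integrand p x))"

text \<open>Used only for \<open>c = \<plusminus>1\<close>. At \<open>q = 0\<close>, \<open>\<alpha> = 1\<close> the series diverges and the values are those of the
  analytic continuation in \<open>q\<close>: \<open>\<zeta>(0) = -1/2\<close> for \<open>c = 1\<close> and \<open>\<eta>(0) = 1/2\<close> for \<open>c = -1\<close>. The sum is
  an ordered one, since it converges only conditionally for \<open>c = -1\<close>, \<open>q = 1\<close>.\<close>

definition lerch :: "real \<Rightarrow> nat \<Rightarrow> real \<Rightarrow> real" where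
  "lerch c q \<alpha> =
     (if q = 0 \<and> \<alpha> = 1 then (if c = 1 then - 1 / 2 else 1 / 2)
      else (\<Sum>m. c ^ m / (real m + \<alpha>) ^ q))"

definition lerch_theta :: "real \<Rightarrow> nat \<Rightarrow> real \<Rightarrow> real \<Rightarrow> real" where
  "lerch_theta c k s r =
     (if c = 1 \<and> k = 1 then pi * cot (pi * s / r)
      else lerch c k (s / r) + c * (-1) ^ k * lerch c k ((r - s) / r))"

end

theory Submission
  imports Defs "HOL-Real_Asymp.Real_Asymp"
begin

text \<open>
  Expanding \<open>Li\<^sub>p(b x\<^sup>n)\<close> and \<open>1 / (1 - a x)\<close> turns the integral in (i) into the double series of
  \<open>b\<^sup>m a\<^sup>l / (m\<^sup>p (l + n m)\<^sup>q)\<close> over \<open>l, m \<ge> 1\<close>. Extend it to all \<open>m \<noteq> 0\<close>. The terms with \<open>l < n m\<close>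
  and \<open>l > n m\<close> reproduce the integral up to products of zeta values, with a sign that adds up
  exactly when \<open>p + q\<close> is odd. On the other hand, for fixed \<open>l\<close> the bilateral sum over \<open>m\<close> is evaluated
  by partial fractions, which produces the zeta and \<open>\<Theta>\<close> values, periodic in \<open>l\<close> modulo \<open>n\<close>.
  Since the double series need not converge absolutely, \<open>a\<^sup>l\<close> is weighted by \<open>t\<^sup>l\<close> with \<open>t < 1\<close>, and
  \<open>t \<rightarrow> 1\<close> is taken by dominated convergence on the integral side and by Abel's theorem on the other.
  Identity (ii) follows from (i) by the inversion formula relating \<open>Li\<^sub>p(b / y)\<close> to \<open>Li\<^sub>p(b y)\<close>, obtained by
  folding the principal value integral at its pole.
\<close>

section \<open>Termwise integration against logarithmic kernels\<close>

text \<open>Why the terms with l < n m give the integral back: for fixed m, the sum of z^l / (n m -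
  l)^q over l < n m is the integral of the logarithmic kernel against the finite geometric sum z
  (x^K - z^K) / (x - z) with K = n m - 1. Summed over m this is the difference quotient of F(y) =
  Li_p(b y^n) / y between x and z. At z = a = +-1 it decomposes into multiples of a / (1 - a x) and
  1 / x, and the middle piece is the original integrand with a minus sign. The obstacle is a
  majorant of this quotient that is uniform while z tends to a. F need not be Lipschitz up to 1, and
  Li_1 may even be unbounded. If a = 1, then q >= 2 makes the kernel over 1 - x integrable, which
  absorbs the loss; if a = -1, the nodes x and z stay apart. The terms with index 0 in the final
  sums come from holes: the bilateral sum lacks m = 0 and, when n divides l, also m = l / n. The
  corrections for the two holes are exactly the terms with zeta(0) = -1/2 or eta(0) = 1/2, both
  equal to -b/2.\<close>

definition log_kernel :: "nat \<Rightarrow> real \<Rightarrow> real" where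
  "log_kernel q x = (- ln x) ^ (q - 1) / fact (q - 1)"

text \<open>The power series side of the polylogarithm, kept apart from the integral
  \<open>polylog\<close>. The sum is ordered, so that z = -1 with p = 1 is covered.\<close>

definition Li :: "nat \<Rightarrow> real \<Rightarrow> real" where
  "Li p z = (\<Sum>m. z ^ Suc m / real (Suc m) ^ p)"

lemma log_kernel_nonneg: "0 \<le> x \<Longrightarrow> x \<le> 1 \<Longrightarrow> 0 \<le> log_kernel q x"
  unfolding log_kernel_def by (cases "x = 0") auto

text \<open>Integration by parts: the derivative of x^(s+1) (-ln x)^(k+1) ties exponent k + 1 to
  exponent k, and the boundary terms vanish.\<close>

lemma has_integral_power_ln:
  "((\<lambda>x::real. x ^ s * (- ln x) ^ k) has_integral fact k / real (Suc s) ^ Suc k) {0..1}"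
proof (induction k)
  case 0
  have "((\<lambda>x::real. x ^ s) has_integral (1 ^ Suc s / real (Suc s) - 0 ^ Suc s / real (Suc s))) {0..1}"
    by (intro fundamental_theorem_of_calculus)
       (auto intro!: derivative_eq_intros simp flip: has_real_derivative_iff_has_vector_derivative
             simp del: power_Suc of_nat_Suc)
  then show ?case by simp
next
  case (Suc k)
  let ?F = "\<lambda>x::real. x ^ Suc s * (- ln x) ^ Suc k"
  have cont: "continuous_on {0..1} ?F"
  proof -
    have "isCont ?F x" if "x > 0" for x
      using that by (intro continuous_intros) auto
    moreover have "(?F \<longlongrightarrow> ?F 0) (at 0 within {0..1})"
    proof -
      have "((\<lambda>x::real. x ^ Suc s * (- ln x) ^ Suc k) \<longlongrightarrow> 0) (at_right 0)"
      proof -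
        have "((\<lambda>x::real. x * (ln x) ^ Suc k) \<longlongrightarrow> 0) (at_right 0)"
        proof -
          \<comment> \<open>With u = -ln x the claim is that u^(k+1) / exp u tends to 0 at
            infinity.\<close>
          have "((\<lambda>x. x ^ Suc k / exp x) \<longlongrightarrow> (0::real)) at_top"
            by (rule tendsto_power_div_exp_0)
          moreover have "filterlim (\<lambda>x::real. - ln x) at_top (at_right 0)"
            using ln_at_0 filterlim_uminus_at_bot by blast
          ultimately have "((\<lambda>x. (- ln x) ^ Suc k / exp (- ln x)) \<longlongrightarrow> (0::real)) (at_right 0)"
            by (rule filterlim_compose)
          then have "((\<lambda>x. (-1) ^ Suc k * ((- ln x) ^ Suc k / exp (- ln x))) \<longlongrightarrow> (-1) ^ Suc k * 0) (at_right (0::real))"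
            by (intro tendsto_intros)
          moreover have "eventually (\<lambda>x::real. (-1) ^ Suc k * ((- ln x) ^ Suc k / exp (- ln x)) = x * (ln x) ^ Suc k) (at_right 0)"
            using eventually_at_right_less[of "0::real"]
          proof eventually_elim
            case (elim x)
            have "(-1::real) ^ Suc k * (- ln x) ^ Suc k = ln x ^ Suc k"
              by (simp only: flip: power_mult_distrib) simp
            then show ?case
              using elim by (simp add: exp_minus field_simps)
          qed
          ultimately show ?thesis
            using Lim_transform_eventually by fastforce
        qed
        then have "((\<lambda>x::real. ((-1) ^ Suc k * x ^ s) * (x * (ln x) ^ Suc k)) \<longlongrightarrow> ((-1) ^ Suc k * 0 ^ s) * 0) (at_right 0)"
          by (intro tendsto_intros)
        moreover have "(\<lambda>x::real. ((-1) ^ Suc k * x ^ s) * (x * (ln x) ^ Suc k)) = ?F"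
        proof
          fix x :: real
          have "(- ln x) ^ Suc k = (-1) ^ Suc k * ln x ^ Suc k"
            by (simp only: flip: power_mult_distrib) simp
          then show "((-1) ^ Suc k * x ^ s) * (x * (ln x) ^ Suc k) = ?F x"
            by (metis (no_types) mult.assoc mult.left_commute power_Suc)
        qed
        ultimately show ?thesis by simp
      qed
      then show ?thesis
        by (simp add: at_within_Icc_at_right)
    qed
    ultimately show ?thesis
    proof (subst continuous_on_eq_continuous_within, intro ballI)
      fix x :: real assume "x \<in> {0..1}"
      then consider "x = 0" | "x > 0" by force
      then show "continuous (at x within {0..1}) ?F"
      proof cases
        case 1
        then show ?thesis using \<open>(?F \<longlongrightarrow> ?F 0) (at 0 within {0..1})\<close>
          unfolding continuous_within by simp
      next
        case 2
        then show ?thesis using \<open>\<And>x. x > 0 \<Longrightarrow> isCont ?F x\<close>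
          by (blast intro: continuous_at_imp_continuous_at_within)
      qed
    qed
  qed
  have "((\<lambda>x::real. real (Suc s) * (x ^ s * (- ln x) ^ Suc k)
           - real (Suc k) * (x ^ s * (- ln x) ^ k)) has_integral (?F 1 - ?F 0)) {0..1}"
  proof (rule fundamental_theorem_of_calculus_interior[OF _ cont])
    fix x :: real assume x: "x \<in> {0<..<1}"
    have "(?F has_real_derivative real (Suc s) * (x ^ s * (- ln x) ^ Suc k)
           - real (Suc k) * (x ^ s * (- ln x) ^ k)) (at x)"
    proof -
      have 1: "((\<lambda>x. x ^ Suc s) has_real_derivative real (Suc s) * x ^ s) (at x)"
        using DERIV_pow[of "Suc s" x] by simp
      have "((\<lambda>x. - ln x) has_real_derivative - (1 / x)) (at x)"
        using x by (auto intro!: derivative_eq_intros)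
      from DERIV_mult[OF 1 DERIV_power_Suc[OF this, of k]] show ?thesis
        by (rule DERIV_cong) (use x in \<open>simp add: field_simps\<close>)
    qed
    then show "(?F has_vector_derivative real (Suc s) * (x ^ s * (- ln x) ^ Suc k)
           - real (Suc k) * (x ^ s * (- ln x) ^ k)) (at x)"
      by (simp add: has_real_derivative_iff_has_vector_derivative)
  qed simp
  then have "((\<lambda>x::real. real (Suc s) * (x ^ s * (- ln x) ^ Suc k)
           - real (Suc k) * (x ^ s * (- ln x) ^ k)) has_integral 0) {0..1}"
    by simp
  from has_integral_add[OF this has_integral_mult_right[OF Suc.IH, of "real (Suc k)"]]
  have "((\<lambda>x::real. real (Suc s) * (x ^ s * (- ln x) ^ Suc k)) has_integral
          (real (Suc k) * (fact k / real (Suc s) ^ Suc k))) {0..1}"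
    by simp
  from has_integral_mult_right[OF this, of "1 / real (Suc s)"]
  show ?case
    by (simp add: field_simps del: of_nat_Suc)
qed

text \<open>This is what the factorial in \<open>log_kernel\<close> is for: its moments are pure
  inverse powers. The sign inside makes the kernel nonnegative on [0, 1], so absolute values pass
  through it.\<close>

lemma has_integral_log_kernel_power:
  assumes "q \<ge> 1"
  shows "((\<lambda>x. log_kernel q x * x ^ s) has_integral 1 / real (Suc s) ^ q) {0..1}"
proof -
  have "((\<lambda>x. (1 / fact (q - 1)) * (x ^ s * (- ln x) ^ (q - 1))) has_integral
           (1 / fact (q - 1)) * (fact (q - 1) / real (Suc s) ^ Suc (q - 1))) {0..1}"
    by (intro has_integral_mult_right has_integral_power_ln)
  then show ?thesis
    using assms by (simp add: log_kernel_def mult_ac del: of_nat_Suc)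
qed

section \<open>Interchange of sums with integrals and with sums\<close>

text \<open>Absolute convergence in the Lebesgue sense, with the majorants \<open>g i\<close>
  controlling the integrals of |f i|. Pointwise assumptions are confined to the open interval,
  because the endpoint values are only conventions such as \<open>ln 0 = 0\<close> and
  \<open>1 / 0 = 0\<close>.\<close>

lemma has_integral_series:
  fixes f g :: "nat \<Rightarrow> real \<Rightarrow> real"
  assumes f: "\<And>i. (f i has_integral I i) {0..1}"
    and g: "\<And>i. (g i has_integral J i) {0..1}"
    and J: "summable J"
    and le: "\<And>i x. 0 < x \<Longrightarrow> x < 1 \<Longrightarrow> \<bar>f i x\<bar> \<le> g i x"
    and sg: "\<And>x. 0 < x \<Longrightarrow> x < 1 \<Longrightarrow> summable (\<lambda>i. g i x)"
  shows "((\<lambda>x. \<Sum>i. f i x) has_integral (\<Sum>i. I i)) {0..1}"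
proof -
  let ?S = "{0<..<1::real}"
  have f': "(f i has_integral I i) ?S" for i
    using f[of i] by (simp add: has_integral_Icc_iff_Ioo)
  have g': "(g i has_integral J i) ?S" for i
    using g[of i] by (simp add: has_integral_Icc_iff_Ioo)
  have absf: "f i absolutely_integrable_on ?S" for i
    by (rule absolutely_integrable_integrable_bound[where g = "g i"])
       (use f' g' le in \<open>auto simp: integrable_on_def\<close>)
  have int: "integrable lebesgue (\<lambda>x. indicator ?S x *\<^sub>R f i x)" for i
    using absf[of i] by (simp add: set_integrable_def)
  have smf: "summable (\<lambda>i. \<bar>f i x\<bar>)" if "0 < x" "x < 1" for x
    by (rule summable_comparison_test_ev[OF _ sg[OF that]]) (use le that in auto)
  have nrm: "(\<integral>x. norm (indicator ?S x *\<^sub>R f i x) \<partial>lebesgue) \<le> J i" for i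
  proof -
    have "(\<lambda>x. \<bar>f i x\<bar>) absolutely_integrable_on ?S"
      using absolutely_integrable_norm[OF absf[of i]] by (simp add: o_def)
    note * = set_lebesgue_integral_eq_integral[OF this]
    have "(\<integral>x. norm (indicator ?S x *\<^sub>R f i x) \<partial>lebesgue) = (LINT x:?S|lebesgue. \<bar>f i x\<bar>)"
      unfolding set_lebesgue_integral_def
      by (intro Bochner_Integration.integral_cong) (auto simp: indicator_def)
    also have "\<dots> = integral ?S (\<lambda>x. \<bar>f i x\<bar>)" using * by simp
    also have "\<dots> \<le> integral ?S (g i)"
      using * g'[of i] le by (intro integral_le) (auto simp: integrable_on_def)
    also have "\<dots> = J i" using g' by (rule integral_unique)
    finally show ?thesis .
  qed
  have sumnorm: "summable (\<lambda>i. \<integral>x. norm (indicator ?S x *\<^sub>R f i x) \<partial>lebesgue)"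
    by (rule summable_comparison_test_ev[OF _ J]) (use nrm in auto)
  have ae: "AE x in lebesgue. summable (\<lambda>i. norm (indicator ?S x *\<^sub>R f i x))"
    using smf by (intro AE_I2) (auto simp: indicator_def)
  note 1 = integrable_suminf[OF int ae sumnorm] and 2 = integral_suminf[OF int ae sumnorm]
  have eq: "(\<Sum>i. indicator ?S x *\<^sub>R f i x) = indicator ?S x *\<^sub>R (\<Sum>i. f i x)" for x
    by (auto simp: indicator_def)
  have "set_integrable lebesgue ?S (\<lambda>x. \<Sum>i. f i x)"
    using 1 unfolding set_integrable_def eq .
  from has_integral_set_lebesgue[OF this]
  have "((\<lambda>x. \<Sum>i. f i x) has_integral (LINT x:?S|lebesgue. \<Sum>i. f i x)) ?S" .
  also have "(LINT x:?S|lebesgue. \<Sum>i. f i x) = (\<Sum>i. integral\<^sup>L lebesgue (\<lambda>x. indicator ?S x *\<^sub>R f i x))"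
    using 2 unfolding set_lebesgue_integral_def eq .
  also have "(\<lambda>i. integral\<^sup>L lebesgue (\<lambda>x. indicator ?S x *\<^sub>R f i x)) = I"
  proof
    fix i
    have "integral\<^sup>L lebesgue (\<lambda>x. indicator ?S x *\<^sub>R f i x) = integral ?S (f i)"
      using set_lebesgue_integral_eq_integral(2)[OF absf[of i]] by (simp add: set_lebesgue_integral_def)
    also have "\<dots> = I i" using f' by (rule integral_unique)
    finally show "integral\<^sup>L lebesgue (\<lambda>x. indicator ?S x *\<^sub>R f i x) = I i" .
  qed
  finally show ?thesis by (simp add: has_integral_Icc_iff_Ioo)
qed

text \<open>The product majorant makes the family unconditionally summable over pairs, where Fubini
  for infinite sums applies; absolute convergence of each series then translates back to ordered
  sums.\<close>

lemma suminf_swap: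
  fixes w :: "nat \<Rightarrow> nat \<Rightarrow> real"
  assumes le: "\<And>l m. \<bar>w l m\<bar> \<le> u l * v m" and u: "summable u" and v: "summable v"
    and u0: "\<And>l. 0 \<le> u l" and v0: "\<And>m. 0 \<le> v m"
  shows "(\<Sum>l. \<Sum>m. w l m) = (\<Sum>m. \<Sum>l. w l m)"
    and "summable (\<lambda>m. \<Sum>l. w l m)" and "summable (\<lambda>l. \<Sum>m. w l m)"
    and "\<And>l. summable (w l)" and "\<And>m. summable (\<lambda>l. w l m)"
proof -
  show sl: "summable (w l)" for l
    by (rule summable_comparison_test_ev[OF _ summable_mult[OF v, of "u l"]]) (use le in auto)
  show sm: "summable (\<lambda>l. w l m)" for m
    by (rule summable_comparison_test_ev[OF _ summable_mult2[OF u, of "v m"]]) (use le in auto)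
  have asl: "summable (\<lambda>m. \<bar>w l m\<bar>)" for l
    by (rule summable_comparison_test_ev[OF _ summable_mult[OF v, of "u l"]]) (use le in auto)
  have asm: "summable (\<lambda>l. \<bar>w l m\<bar>)" for m
    by (rule summable_comparison_test_ev[OF _ summable_mult2[OF u, of "v m"]]) (use le in auto)
  have "\<bar>\<Sum>m. w l m\<bar> \<le> u l * suminf v" for l
  proof -
    have "\<bar>\<Sum>m. w l m\<bar> \<le> (\<Sum>m. \<bar>w l m\<bar>)" using asl by (rule summable_rabs)
    also have "\<dots> \<le> (\<Sum>m. u l * v m)" using le asl summable_mult[OF v] by (intro suminf_le) auto
    also have "\<dots> = u l * suminf v" using v by (rule suminf_mult)
    finally show ?thesis .
  qed
  then show s1: "summable (\<lambda>l. \<Sum>m. w l m)"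
    by (intro summable_comparison_test_ev[OF _ summable_mult2[OF u]] always_eventually) auto
  have "\<bar>\<Sum>l. w l m\<bar> \<le> v m * suminf u" for m
  proof -
    have "\<bar>\<Sum>l. w l m\<bar> \<le> (\<Sum>l. \<bar>w l m\<bar>)" using asm by (rule summable_rabs)
    also have "\<dots> \<le> (\<Sum>l. v m * u l)"
      using le asm summable_mult[OF u, of "v m"] by (intro suminf_le) (auto simp: mult.commute)
    also have "\<dots> = v m * suminf u" using u by (rule suminf_mult)
    finally show ?thesis .
  qed
  then show s2: "summable (\<lambda>m. \<Sum>l. w l m)"
    by (intro summable_comparison_test_ev[OF _ summable_mult2[OF v]] always_eventually) auto
  have su: "u summable_on UNIV" and sv: "v summable_on UNIV"
    using u v u0 v0 by (simp_all add: summable_on_UNIV_nonneg_real_iff)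
  have uv: "(\<lambda>(l, m). u l * v m) summable_on UNIV \<times> UNIV"
    by (rule summable_on_SigmaI[where g = "\<lambda>l. u l * suminf v"])
       (use u v u0 v0 in \<open>auto intro!: has_sum_cmult_right norm_summable_imp_has_sum summable_on_cmult_left su\<close>)
  have "(\<lambda>(l, m). w l m) summable_on UNIV \<times> UNIV"
    by (rule abs_summable_summable, rule Infinite_Sum.abs_summable_on_comparison_test'[OF uv])
       (use le in auto)
  then have "infsum (\<lambda>l. infsum (\<lambda>m. w l m) UNIV) UNIV = infsum (\<lambda>m. infsum (\<lambda>l. w l m) UNIV) UNIV"
    by (rule infsum_swap_banach)
  moreover have i: "infsum h UNIV = suminf h" if "summable (\<lambda>i. \<bar>h i\<bar>)" for h :: "nat \<Rightarrow> real"
    using norm_summable_imp_has_sum[of h "suminf h"] that summable_rabs_cancel[OF that]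
    by (auto intro!: infsumI)
  moreover have "summable (\<lambda>l. \<bar>\<Sum>m. w l m\<bar>)"
    by (rule summable_comparison_test_ev[OF _ summable_mult2[OF u, of "suminf v"]])
       (use \<open>\<And>l. \<bar>\<Sum>m. w l m\<bar> \<le> u l * suminf v\<close> in auto)
  moreover have "summable (\<lambda>m. \<bar>\<Sum>l. w l m\<bar>)"
    by (rule summable_comparison_test_ev[OF _ summable_mult2[OF v, of "suminf u"]])
       (use \<open>\<And>m. \<bar>\<Sum>l. w l m\<bar> \<le> v m * suminf u\<close> in auto)
  ultimately show "(\<Sum>l. \<Sum>m. w l m) = (\<Sum>m. \<Sum>l. w l m)"
    using asl asm by simp
qed

lemma summable_lerch:
  assumes c: "c \<in> {1, -1::real}" and \<alpha>: "\<alpha> > 0" and s: "s \<ge> 1" and "c = 1 \<Longrightarrow> s \<ge> 2"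
  shows "summable (\<lambda>m. c ^ m / (real m + \<alpha>) ^ s)"
proof (cases "s \<ge> 2")
  case True
  have "summable (\<lambda>m. inverse ((\<alpha> + real m) ^ s))"
    using Polygamma_converges'[of \<alpha> s] True \<alpha> by simp
  then show ?thesis
    by (rule summable_comparison_test_ev[rotated])
       (use c \<alpha> in \<open>auto simp: field_simps power_abs\<close>)
next
  case False
  then have [simp]: "s = 1" "c = -1" using s c assms(4) by auto
  have "summable (\<lambda>m. (-1) ^ m * (1 / (real m + \<alpha>)))"
  proof (rule summable_Leibniz'(1))
    show "(\<lambda>m. 1 / (real m + \<alpha>)) \<longlonglongrightarrow> 0" by real_asymp
  qed (use \<alpha> in \<open>auto simp: field_simps\<close>)
  then show ?thesis by simp
qed

lemma summable_Li:
  assumes z: "\<bar>z\<bar> \<le> 1" and p: "p \<ge> 1" and "z = 1 \<Longrightarrow> p \<ge> 2"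
  shows "summable (\<lambda>m. z ^ Suc m / real (Suc m) ^ p)"
proof (cases "\<bar>z\<bar> = 1")
  case True
  then have "z \<in> {1, -1}" by auto
  from summable_mult[OF summable_lerch[OF this, of 1 p], of z] assms show ?thesis
    by (simp add: add_ac)
next
  case False
  have "summable (\<lambda>m. \<bar>z\<bar> ^ Suc m)"
    using False z by (simp add: summable_geometric summable_mult)
  then show ?thesis
  proof (rule summable_comparison_test_ev[rotated], intro always_eventually allI)
    fix m
    have "1 \<le> real (Suc m) ^ p" by (rule one_le_power) simp
    then have "\<bar>z\<bar> ^ Suc m / real (Suc m) ^ p \<le> \<bar>z\<bar> ^ Suc m / 1"
      by (intro divide_left_mono) auto
    then show "norm (z ^ Suc m / real (Suc m) ^ p) \<le> \<bar>z\<bar> ^ Suc m"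
      by (simp add: power_abs abs_mult)
  qed
qed

lemma Li_eq_lerch:
  assumes "c \<in> {1, -1}" and "s \<ge> 1" and "c = 1 \<Longrightarrow> s \<ge> 2"
  shows "Li s c = c * lerch c s 1"
proof -
  have "c * (\<Sum>m. c ^ m / (real m + 1) ^ s) = (\<Sum>m. c * (c ^ m / (real m + 1) ^ s))"
    using summable_lerch[OF assms(1), of 1 s] assms by (intro suminf_mult [symmetric]) auto
  then show ?thesis
    using assms by (simp add: Li_def lerch_def add_ac)
qed

text \<open>Expand the geometric series and integrate termwise. At z = -1 with q = 1 no summable
  majorant exists, so z = -1 is done by dominated convergence of the partial sums, which alternation
  keeps below twice the kernel.\<close>

lemma has_integral_log_kernel_geometric:
  assumes z: "\<bar>z\<bar> \<le> 1" and q: "q \<ge> 1" and z1: "z = 1 \<Longrightarrow> q \<ge> 2"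
  shows "((\<lambda>x. log_kernel q x * (z / (1 - z * x))) has_integral Li q z) {0..1}"
proof (cases "z = -1")
  case True
  let ?f = "\<lambda>N x. \<Sum>i<N. log_kernel q x * x ^ i * (-1) ^ Suc i"
  have kern: "(log_kernel q has_integral 1) {0..1}"
    using has_integral_log_kernel_power[OF q, of 0] by simp
  have geo: "(\<Sum>i<N. x ^ i * (-1) ^ Suc i) = ((-x) ^ N - 1) / (1 + x)" if "0 \<le> x" for N and x :: real
    using that by (induction N) (auto simp: field_simps power_minus')
  have f_eq: "?f N x = log_kernel q x * (((-x) ^ N - 1) / (1 + x))" if "0 \<le> x" for N and x :: real
    by (simp only: mult.assoc flip: sum_distrib_left geo[OF that])
  \<comment> \<open>At x = 1 and q = 1 the partial sums oscillate. There both the sequence and its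
    limit are replaced by the constant \<open>?f 0 x\<close>, an empty sum; one point does not
    affect the integral.\<close>
  have "((\<lambda>x. if x < 1 then log_kernel q x * (z / (1 - z * x)) else ?f 0 x) has_integral Li q z) {0..1}"
  proof (rule has_integral_dominated_convergence)
    show "((\<lambda>x. if x < 1 then ?f N x else ?f 0 x) has_integral (\<Sum>i<N. 1 / real (Suc i) ^ q * (-1) ^ Suc i)) {0..1}" for N
    proof (rule has_integral_spike_finite[of "{1}" _ _ "?f N"])
      show "(?f N has_integral (\<Sum>i<N. 1 / real (Suc i) ^ q * (-1) ^ Suc i)) {0..1}"
        by (intro has_integral_sum has_integral_mult_left has_integral_log_kernel_power q) auto
    qed auto
    show "(\<lambda>x. 2 * log_kernel q x) integrable_on {0..1}"
      using kern by (auto intro!: integrable_on_mult_right simp: integrable_on_def)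
    show "\<forall>x\<in>{0..1}. norm (if x < 1 then ?f N x else ?f 0 x) \<le> 2 * log_kernel q x" for N
    proof
      fix x :: real assume x: "x \<in> {0..1}"
      then have "0 \<le> x" by simp
      have "\<bar>(-x) ^ N - 1\<bar> \<le> 2"
        using x power_le_one[of x N] by (intro order.trans[OF abs_triangle_ineq4]) (auto simp: power_abs)
      then have "\<bar>(-x) ^ N - 1\<bar> / (1 + x) \<le> 2 / 1"
        using x by (intro frac_le) auto
      then have "log_kernel q x * (\<bar>(-x) ^ N - 1\<bar> / (1 + x)) \<le> log_kernel q x * 2"
        using x by (intro mult_left_mono log_kernel_nonneg) auto
      then show "norm (if x < 1 then ?f N x else ?f 0 x) \<le> 2 * log_kernel q x"
        unfolding f_eq[OF \<open>0 \<le> x\<close>] using x log_kernel_nonneg[of x q] by (simp add: abs_mult)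
    qed
    show "\<forall>x\<in>{0..1}. (\<lambda>N. if x < 1 then ?f N x else ?f 0 x)
             \<longlonglongrightarrow> (if x < 1 then log_kernel q x * (z / (1 - z * x)) else ?f 0 x)"
    proof
      fix x :: real assume x: "x \<in> {0..1}"
      show "(\<lambda>N. if x < 1 then ?f N x else ?f 0 x)
             \<longlonglongrightarrow> (if x < 1 then log_kernel q x * (z / (1 - z * x)) else ?f 0 x)"
      proof (cases "x < 1")
        case True
        have "(\<lambda>N. log_kernel q x * (((-x) ^ N - 1) / (1 + x))) \<longlonglongrightarrow> log_kernel q x * ((0 - 1) / (1 + x))"
          using x True by (intro tendsto_intros LIMSEQ_power_zero) auto
        moreover have "0 \<le> x" using x by simp
        ultimately show ?thesis
          unfolding f_eq[OF \<open>0 \<le> x\<close>] using True \<open>z = -1\<close> by simp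
      qed simp
    qed
    show "(\<lambda>N. \<Sum>i<N. 1 / real (Suc i) ^ q * (-1) ^ Suc i) \<longlonglongrightarrow> Li q z"
      using summable_LIMSEQ[OF summable_Li[OF z q z1]] True
      by (simp add: Li_def)
  qed
  then show ?thesis
    by (rule has_integral_spike_finite[of "{1}", rotated -1]) auto
next
  case False
  have A: "((\<lambda>x. \<Sum>i. z ^ Suc i * (log_kernel q x * x ^ i)) has_integral
          (\<Sum>i. z ^ Suc i * (1 / real (Suc i) ^ q))) {0..1}"
  proof (rule has_integral_series)
    show "((\<lambda>x. z ^ Suc i * (log_kernel q x * x ^ i)) has_integral z ^ Suc i * (1 / real (Suc i) ^ q)) {0..1}"
      "((\<lambda>x. \<bar>z\<bar> ^ Suc i * (log_kernel q x * x ^ i)) has_integral \<bar>z\<bar> ^ Suc i * (1 / real (Suc i) ^ q)) {0..1}" for i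
      by (intro has_integral_mult_right has_integral_log_kernel_power q)+
    show "summable (\<lambda>i. \<bar>z\<bar> ^ Suc i * (1 / real (Suc i) ^ q))"
      using summable_Li[of "\<bar>z\<bar>" q] q z z1 False by (auto simp: abs_if split: if_splits)
    show "\<bar>z ^ Suc i * (log_kernel q x * x ^ i)\<bar> \<le> \<bar>z\<bar> ^ Suc i * (log_kernel q x * x ^ i)"
      if "0 < x" "x < 1" for i x
      using that log_kernel_nonneg[of x q] by (simp add: abs_mult power_abs)
    show "summable (\<lambda>i. \<bar>z\<bar> ^ Suc i * (log_kernel q x * x ^ i))" if "0 < x" "x < 1" for x
    proof -
      have "\<bar>z * x\<bar> < 1" using that z by (simp add: abs_mult) (smt (verit) mult_left_le_one_le)
      then have "summable (\<lambda>i. (\<bar>z\<bar> * log_kernel q x) * \<bar>z * x\<bar> ^ i)"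
        by (intro summable_mult summable_geometric) simp
      then show ?thesis using that by (simp add: power_mult_distrib abs_mult mult_ac)
    qed
  qed
  have B: "(\<Sum>i. z ^ Suc i * (log_kernel q x * x ^ i)) = log_kernel q x * (z / (1 - z * x))"
    if "x \<in> {0..1} - {0, 1}" for x
  proof -
    have "\<bar>z * x\<bar> < 1" using that z by (simp add: abs_mult) (smt (verit) mult_left_le_one_le)
    then have "(\<lambda>i. (z * log_kernel q x) * (z * x) ^ i) sums ((z * log_kernel q x) * (1 / (1 - z * x)))"
      by (intro sums_mult geometric_sums) simp
    then show ?thesis by (simp add: power_mult_distrib mult_ac sums_iff)
  qed
  have "((\<lambda>x. log_kernel q x * (z / (1 - z * x))) has_integral
          (\<Sum>i. z ^ Suc i * (1 / real (Suc i) ^ q))) {0..1}"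
    by (rule has_integral_spike_finite[OF _ B[symmetric] A]) (rule finite.intros | assumption)+
  then show ?thesis
    by (simp only: Li_def times_divide_eq_right mult_1_right)
qed

text \<open>Interior points suffice: inside the integrals the argument b x^n has modulus below 1
  except at an endpoint.\<close>

lemma polylog_eq_series:
  assumes "\<bar>z\<bar> < 1" and "p \<ge> 1"
  shows "polylog p z = Li p z"
proof -
  have "(-1) ^ (p - 1) / fact (p - 1) * integral {0..1} (polylog_integrand p z)
      = integral {0..1} (\<lambda>y. (-1) ^ (p - 1) / fact (p - 1) * polylog_integrand p z y)"
    by simp
  also have "(\<lambda>y. (-1) ^ (p - 1) / fact (p - 1) * polylog_integrand p z y) =
               (\<lambda>x. log_kernel p x * (z / (1 - z * x)))"
  proof
    fix y :: real
    have "(-1) ^ (p - 1) * ln y ^ (p - 1) = (- ln y) ^ (p - 1)"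
      using power_mult_distrib[of "-1" "ln y" "p - 1"] by simp
    then show "(-1) ^ (p - 1) / fact (p - 1) * polylog_integrand p z y = log_kernel p y * (z / (1 - z * y))"
      by (simp add: polylog_integrand_def log_kernel_def mult_ac)
  qed
  also have "integral {0..1} \<dots> = Li p z"
    using assms by (intro integral_unique has_integral_log_kernel_geometric) auto
  finally show ?thesis
    using assms by (auto simp: polylog_def)
qed

section \<open>Abel summation, with a uniform bound and a limit\<close>

text \<open>Summation by parts against the tails \<open>r n\<close>, using f n = r n - r (n + 1) and
  r 0 = \<open>suminf f\<close>. The factor 1 - t in front is what makes both consequences below
  work.\<close>

lemma Abel_summation:
  fixes f :: "nat \<Rightarrow> real"
  assumes f: "summable f"
  defines "r \<equiv> \<lambda>n. suminf f - sum f {..<n}"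
  assumes t: "\<bar>t\<bar> < 1"
  shows "summable (\<lambda>n. r (Suc n) * t ^ n)"
    and "(\<lambda>n. f n * t ^ n) sums (suminf f - (1 - t) * (\<Sum>n. r (Suc n) * t ^ n))"
proof -
  have "r \<longlonglongrightarrow> suminf f - suminf f"
    unfolding r_def [abs_def] by (intro tendsto_intros summable_LIMSEQ f)
  then obtain B where B: "\<And>n. norm (r n) \<le> B"
    using convergent_imp_Bseq[of r] by (auto simp: convergent_def Bseq_def)
  have sr: "summable (\<lambda>n. r n * t ^ n)" if "\<And>n. norm (r n) \<le> B" for r :: "nat \<Rightarrow> real"
  proof (rule summable_comparison_test_ev)
    show "summable (\<lambda>n. B * \<bar>t\<bar> ^ n)"
      using t by (intro summable_mult summable_geometric) simp
    show "\<forall>\<^sub>F n in sequentially. norm (r n * t ^ n) \<le> B * \<bar>t\<bar> ^ n"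
      using that by (intro always_eventually allI) (auto simp: abs_mult power_abs intro!: mult_right_mono)
  qed
  from sr[of "\<lambda>n. r (Suc n)"] B show s: "summable (\<lambda>n. r (Suc n) * t ^ n)" by simp
  from sr[of r] B have s0: "summable (\<lambda>n. r n * t ^ n)" by simp
  have "(\<Sum>n. r n * t ^ n) = r 0 + (\<Sum>n. r (Suc n) * t ^ Suc n)"
    using suminf_split_head[OF s0] by simp
  also have "(\<Sum>n. r (Suc n) * t ^ Suc n) = t * (\<Sum>n. r (Suc n) * t ^ n)"
    using suminf_mult[OF s, of t] by (simp add: mult_ac)
  finally have "(\<Sum>n. r n * t ^ n) - (\<Sum>n. r (Suc n) * t ^ n)
     = suminf f - (1 - t) * (\<Sum>n. r (Suc n) * t ^ n)"
    by (simp add: r_def algebra_simps)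
  moreover have "(\<lambda>n. r n * t ^ n - r (Suc n) * t ^ n) sums ((\<Sum>n. r n * t ^ n) - (\<Sum>n. r (Suc n) * t ^ n))"
    by (intro sums_diff summable_sums s s0)
  moreover have "r n * t ^ n - r (Suc n) * t ^ n = f n * t ^ n" for n
    by (simp add: r_def algebra_simps)
  ultimately show "(\<lambda>n. f n * t ^ n) sums (suminf f - (1 - t) * (\<Sum>n. r (Suc n) * t ^ n))"
    by simp
qed

text \<open>The tails are bounded by some B and (1 - t) times the geometric series is 1, so B +
  |sum| bounds all t < 1 at once, even for conditionally convergent series. This supplies constants
  for dominated convergence.\<close>

lemma Abel_bounded:
  fixes f :: "nat \<Rightarrow> real"
  assumes f: "summable f"
  obtains C where "C \<ge> 0" and "\<And>t. 0 \<le> t \<Longrightarrow> t < 1 \<Longrightarrow> \<bar>\<Sum>n. f n * t ^ n\<bar> \<le> C"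
proof -
  define r where "r n = suminf f - sum f {..<n}" for n
  have "r \<longlonglongrightarrow> suminf f - suminf f"
    unfolding r_def [abs_def] by (intro tendsto_intros summable_LIMSEQ f)
  then obtain B where B: "B > 0" "\<And>n. norm (r n) \<le> B"
    using convergent_imp_Bseq[of r] by (auto simp: convergent_def Bseq_def)
  show ?thesis
  proof (rule that)
    show "\<bar>suminf f\<bar> + B \<ge> 0" using B by simp
    fix t :: real assume t: "0 \<le> t" "t < 1"
    then have t': "\<bar>t\<bar> < 1" by simp
    note A = Abel_summation[OF f t', folded r_def]
    have geo: "(\<lambda>n. B * t ^ n) sums (B * (1 / (1 - t)))"
      using t by (intro sums_mult geometric_sums) simp
    have sa: "summable (\<lambda>n. \<bar>r (Suc n) * t ^ n\<bar>)"
      using B t by (intro summable_comparison_test_ev[OF _ sums_summable[OF geo]] always_eventually)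
        (auto simp: abs_mult intro!: mult_right_mono)
    have "\<bar>\<Sum>n. r (Suc n) * t ^ n\<bar> \<le> (\<Sum>n. \<bar>r (Suc n) * t ^ n\<bar>)"
      by (rule summable_rabs[OF sa])
    also have "\<dots> \<le> (\<Sum>n. B * t ^ n)"
      using B t by (intro suminf_le sa sums_summable[OF geo]) (auto simp: abs_mult intro!: mult_right_mono)
    also have "\<dots> = B * (1 / (1 - t))" using geo by (simp add: sums_iff)
    finally have "(1 - t) * \<bar>\<Sum>n. r (Suc n) * t ^ n\<bar> \<le> (1 - t) * (B * (1 / (1 - t)))"
      using t by (intro mult_left_mono) auto
    then have "\<bar>(1 - t) * (\<Sum>n. r (Suc n) * t ^ n)\<bar> \<le> B"
      using t by (simp add: abs_mult)
    then show "\<bar>\<Sum>n. f n * t ^ n\<bar> \<le> \<bar>suminf f\<bar> + B"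
      using sums_unique[OF A(2)] by linarith
  qed
qed

lemma Abel_limit:
  fixes f :: "nat \<Rightarrow> real"
  assumes f: "summable f"
  shows "((\<lambda>t. \<Sum>n. f n * t ^ n) \<longlongrightarrow> suminf f) (at_left 1)"
proof -
  define r where "r n = suminf f - sum f {..<n}" for n
  have r0: "r \<longlonglongrightarrow> 0"
    using tendsto_diff[OF tendsto_const summable_LIMSEQ[OF f], of "suminf f"] by (simp add: r_def [abs_def])
  have ev: "eventually (\<lambda>t. t \<in> {0<..<1}) (at_left (1::real))"
    by (rule eventually_at_left_real) simp
  have "((\<lambda>t. (1 - t) * (\<Sum>n. r (Suc n) * t ^ n)) \<longlongrightarrow> 0) (at_left 1)"
  proof (rule tendstoI)
    fix e :: real assume e: "e > 0"
    then have "eventually (\<lambda>n. \<bar>r n\<bar> < e / 2) sequentially"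
      using r0 by (auto simp: tendsto_iff dest!: spec[of _ "e / 2"])
    \<comment> \<open>Tails beyond N contribute at most e / 2 uniformly in t; the first N contribute
      at most (1 - t) A, which vanishes as t tends to 1.\<close>
    then obtain N where N: "\<And>n. n \<ge> N \<Longrightarrow> \<bar>r n\<bar> < e / 2"
      by (auto simp: eventually_sequentially)
    define A where "A = (\<Sum>n<N. \<bar>r (Suc n)\<bar>)"
    have "((\<lambda>t. (1 - t) * A) \<longlongrightarrow> (1 - 1) * A) (at_left (1::real))"
      by (intro tendsto_intros)
    then have "eventually (\<lambda>t. (1 - t) * A < e / 2) (at_left (1::real))"
      using e by (intro order_tendstoD(2)) auto
    with ev show "eventually (\<lambda>t. dist ((1 - t) * (\<Sum>n. r (Suc n) * t ^ n)) 0 < e) (at_left 1)"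
    proof eventually_elim
      case (elim t)
      then have t: "0 < t" "t < 1" and t': "\<bar>t\<bar> < 1" by auto
      have geo: "(\<lambda>n. e / 2 * t ^ n) sums (e / 2 * (1 / (1 - t)))"
        using t by (intro sums_mult geometric_sums) simp
      have fin: "(\<lambda>n. if n \<in> {..<N} then \<bar>r (Suc n)\<bar> else 0) sums A"
        unfolding A_def by (rule sums_If_finite_set) simp
      note both = sums_add[OF fin geo]
      have le: "norm (r (Suc n) * t ^ n) \<le> (if n \<in> {..<N} then \<bar>r (Suc n)\<bar> else 0) + e / 2 * t ^ n" for n
      proof (cases "n < N")
        case True
        have "\<bar>r (Suc n)\<bar> * t ^ n \<le> \<bar>r (Suc n)\<bar> * 1"
          using t by (intro mult_left_mono power_le_one) auto
        then show ?thesis using True t e by (simp add: abs_mult add_increasing2)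
      next
        case False
        then show ?thesis using N[of "Suc n"] t by (auto simp: abs_mult intro!: mult_right_mono)
      qed
      have "norm (\<Sum>n. r (Suc n) * t ^ n) \<le> (\<Sum>n. (if n \<in> {..<N} then \<bar>r (Suc n)\<bar> else 0) + e / 2 * t ^ n)"
        by (rule norm_suminf_le[OF le sums_summable[OF both]])
      also have "\<dots> = A + e / 2 * (1 / (1 - t))" using both by (simp add: sums_iff)
      finally have "(1 - t) * norm (\<Sum>n. r (Suc n) * t ^ n) \<le> (1 - t) * (A + e / 2 * (1 / (1 - t)))"
        using t by (intro mult_left_mono) auto
      also have "\<dots> = (1 - t) * A + e / 2"
        using t by (simp add: field_simps)
      also have "\<dots> < e" using elim by simp
      finally show ?case using t by (simp add: abs_mult)
    qed
  qed
  then have "((\<lambda>t. suminf f - (1 - t) * (\<Sum>n. r (Suc n) * t ^ n)) \<longlongrightarrow> suminf f - 0) (at_left 1)"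
    by (intro tendsto_intros)
  moreover have "eventually (\<lambda>t. suminf f - (1 - t) * (\<Sum>n. r (Suc n) * t ^ n) = (\<Sum>n. f n * t ^ n)) (at_left 1)"
    using ev by eventually_elim (use Abel_summation(2)[OF f, folded r_def, THEN sums_unique] in simp)
  ultimately show ?thesis
    using Lim_transform_eventually by fastforce
qed

section \<open>The double series as an integral\<close>

lemma Li_scale:
  assumes c: "c \<in> {1, -1}" and p: "p \<ge> 1" and c1: "c = 1 \<Longrightarrow> p \<ge> 2"
    and t: "\<bar>t\<bar> < 1"
  shows "Li p (c * t) = t * (\<Sum>m. c ^ Suc m / real (Suc m) ^ p * t ^ m)"
proof -
  have "summable (\<lambda>m. c ^ Suc m / real (Suc m) ^ p * t ^ m)"
    using c summable_Li[of c p] p c1 t by (intro sums_summable[OF Abel_summation(2)]) auto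
  from suminf_mult[OF this, of t] show ?thesis
    by (simp add: Li_def power_mult_distrib mult_ac)
qed

text \<open>Abel boundedness after a factor t has been taken out of the series. The factor t is kept
  in the bound because the later integrands divide Li_p(b y^n) by y.\<close>

lemma Li_bounded:
  assumes c: "c \<in> {1, -1}" and p: "p \<ge> 1" and c1: "c = 1 \<Longrightarrow> p \<ge> 2"
  obtains C where "C \<ge> 0" and "\<And>t. 0 \<le> t \<Longrightarrow> t < 1 \<Longrightarrow> \<bar>Li p (c * t)\<bar> \<le> C * t"
proof -
  have "summable (\<lambda>m. c ^ Suc m / real (Suc m) ^ p)"
    using c p c1 by (intro summable_Li) auto
  from Abel_bounded[OF this] obtain C where C: "C \<ge> 0"
    "\<And>t. 0 \<le> t \<Longrightarrow> t < 1 \<Longrightarrow> \<bar>\<Sum>m. c ^ Suc m / real (Suc m) ^ p * t ^ m\<bar> \<le> C" by blast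
  show ?thesis
  proof (rule that[OF C(1)])
    fix t :: real assume t: "0 \<le> t" "t < 1"
    then have "\<bar>Li p (c * t)\<bar> = \<bar>\<Sum>m. c ^ Suc m / real (Suc m) ^ p * t ^ m\<bar> * t"
      by (subst Li_scale[OF c p c1]) (simp_all add: abs_mult)
    also have "\<dots> \<le> C * t" using C(2)[OF t] t by (intro mult_right_mono)
    finally show "\<bar>Li p (c * t)\<bar> \<le> C * t" .
  qed
qed

lemma Li_tendsto:
  assumes c: "c \<in> {1, -1}" and p: "p \<ge> 1" and c1: "c = 1 \<Longrightarrow> p \<ge> 2"
  shows "((\<lambda>t. Li p (c * t)) \<longlongrightarrow> Li p c) (at_left 1)"
proof -
  have "summable (\<lambda>m. c ^ Suc m / real (Suc m) ^ p)"
    using c p c1 by (intro summable_Li) auto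
  from Abel_limit[OF this]
  have "((\<lambda>t. t * (\<Sum>m. c ^ Suc m / real (Suc m) ^ p * t ^ m)) \<longlongrightarrow> 1 * Li p c) (at_left 1)"
    unfolding Li_def by (intro tendsto_intros)
  moreover have "eventually (\<lambda>t. t * (\<Sum>m. c ^ Suc m / real (Suc m) ^ p * t ^ m) = Li p (c * t)) (at_left 1)"
    using eventually_at_left_real[OF zero_less_one]
    by eventually_elim (use Li_scale[OF c p c1] in auto)
  ultimately show ?thesis
    using Lim_transform_eventually by fastforce
qed

lemma filterlim_power_at_left_1:
  assumes "n \<ge> 1" shows "filterlim (\<lambda>t::real. t ^ n) (at_left 1) (at_left 1)"
proof -
  have "((\<lambda>t::real. t ^ n) \<longlongrightarrow> 1 ^ n) (at_left 1)"
    by (intro tendsto_intros)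
  moreover have "eventually (\<lambda>t::real. t ^ n \<in> {..<1} - {1}) (at_left 1)"
    using eventually_at_left_real[OF zero_less_one]
    by eventually_elim (use assms power_Suc_less_one[of _ "n - 1"] in force)
  ultimately show ?thesis
    by (auto simp: filterlim_at elim: eventually_mono)
qed

text \<open>The fallback where no uniform bound exists: for p = 1 the right side grows
  logarithmically as |z| tends to 1, but it is still integrable against the kernel.\<close>

lemma Li_abs_le:
  assumes "\<bar>z\<bar> < 1" "p \<ge> 1"
  shows "\<bar>Li p z\<bar> \<le> Li p \<bar>z\<bar>"
  unfolding Li_def real_norm_def [symmetric]
  using summable_Li[of "\<bar>z\<bar>" p] assms
  by (intro norm_suminf_le) (auto simp: power_abs abs_mult)

text \<open>The division by y lowers each exponent to l + n (m + 1) - 1, whose moment against the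
  kernel is 1 / (l + n (m + 1))^q.\<close>

lemma Li_div_sums:
  assumes "n \<ge> 1" "p \<ge> 1" and "b \<in> {1, -1}" and y: "y \<noteq> 0" "\<bar>y\<bar> < 1"
  shows "(\<lambda>m. b ^ Suc m / real (Suc m) ^ p * y ^ (l + n * Suc m - 1)) sums
           (Li p (b * y ^ n) * y ^ l / y)"
proof -
  have "\<bar>y ^ n\<bar> < 1"
    using y assms(1) power_Suc_less_one[of "\<bar>y\<bar>" "n - 1"] by (simp add: power_abs)
  then have "\<bar>b * y ^ n\<bar> < 1" using assms(3) by (auto simp: abs_mult)
  then have "summable (\<lambda>m. (b * y ^ n) ^ Suc m / real (Suc m) ^ p)"
    using assms(2) by (intro summable_Li) auto
  from sums_mult2[OF summable_sums[OF this], of "y ^ l / y"]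
  have "(\<lambda>m. (b * y ^ n) ^ Suc m / real (Suc m) ^ p * (y ^ l / y)) sums
          (Li p (b * y ^ n) * (y ^ l / y))"
    by (simp add: Li_def)
  moreover have "(b * y ^ n) ^ Suc m / real (Suc m) ^ p * (y ^ l / y)
      = b ^ Suc m / real (Suc m) ^ p * y ^ (l + n * Suc m - 1)" for m
  proof -
    have "l + n * Suc m \<ge> 1" using assms(1) by simp
    then have "y ^ (l + n * Suc m - 1) = y ^ (l + n * Suc m) / y"
      using y by (simp add: power_diff del: mult_Suc_right)
    also have "\<dots> = (y ^ n) ^ Suc m * y ^ l / y"
      by (simp only: power_add power_mult mult.commute)
    finally have eq: "y ^ (l + n * Suc m - 1) = (y ^ n) ^ Suc m * y ^ l / y" .
    show ?thesis unfolding eq power_mult_distrib by simp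
  qed
  ultimately show ?thesis by simp
qed

lemma summable_inverse_squares: "summable (\<lambda>m. 1 / real (Suc m) ^ 2)"
  using inverse_power_summable[of 2, where 'a = real] summable_Suc_iff[of "\<lambda>m. 1 / real m ^ 2"]
  by (simp add: field_simps)

text \<open>One factor x and one factor d are enough: x <= e d trades d for x and gives a summable 1
  / x^2 even when p = q = 1.\<close>

lemma inverse_mult_power_le:
  fixes x d e :: real
  assumes "x \<ge> 1" "p \<ge> 1" "q \<ge> 1" "d \<ge> 1" "e > 0" "x \<le> e * d"
  shows "1 / (x ^ p * d ^ q) \<le> e / x ^ 2"
proof -
  have "x * d \<le> x ^ p * d ^ q"
    using assms power_increasing[of 1 p x] power_increasing[of 1 q d] by (intro mult_mono) auto
  then have "1 / (x ^ p * d ^ q) \<le> 1 / (x * d)"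
    using assms by (intro divide_left_mono mult_pos_pos) auto
  also have "\<dots> \<le> e / x ^ 2"
    using assms by (simp add: field_simps power2_eq_square)
  finally show ?thesis .
qed

lemma upper_term_bound:
  assumes "p \<ge> 1" "q \<ge> 1" and n: "n \<ge> 1"
  shows "1 / (real (Suc m) ^ p * real (l + n * Suc m) ^ q) \<le> 1 / real (Suc m) ^ 2"
proof (rule inverse_mult_power_le)
  have "Suc m \<le> l + n * Suc m" using n by (metis le_add2 mult_le_mono1 nat_mult_1 order_trans)
  then have *: "real (Suc m) \<le> real (l + n * Suc m)" by (simp only: of_nat_le_iff)
  then show "real (Suc m) \<le> 1 * real (l + n * Suc m)" by (simp only: mult_1)
  show "1 \<le> real (l + n * Suc m)" by (rule order.trans[OF _ *]) simp
qed (use assms in auto)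

lemma has_integral_log_kernel_polylog:
  assumes n: "n \<ge> 1" and p: "p \<ge> 1" and q: "q \<ge> 1" and b: "b \<in> {1, -1}"
  shows "((\<lambda>x. log_kernel q x * (Li p (b * x ^ n) * x ^ l / x)) has_integral
           (\<Sum>m. b ^ Suc m / (real (Suc m) ^ p * real (l + n * Suc m) ^ q))) {0..1}"
    and "summable (\<lambda>m. 1 / (real (Suc m) ^ p * real (l + n * Suc m) ^ q))"
proof -
  show sm: "summable (\<lambda>m. 1 / (real (Suc m) ^ p * real (l + n * Suc m) ^ q))"
    by (rule summable_comparison_test_ev[OF _ summable_inverse_squares]) (use upper_term_bound[OF p q n] in auto)
  have int: "((\<lambda>x. c / real (Suc m) ^ p * (log_kernel q x * x ^ (l + n * Suc m - 1))) has_integral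
           c / (real (Suc m) ^ p * real (l + n * Suc m) ^ q)) {0..1}" for c m
  proof -
    have *: "Suc (l + n * Suc m - 1) = l + n * Suc m" using n by simp
    from has_integral_mult_right[OF has_integral_log_kernel_power[OF q, of "l + n * Suc m - 1", unfolded *],
      of "c / real (Suc m) ^ p"]
    show ?thesis by simp
  qed
  have A: "((\<lambda>x. \<Sum>m. b ^ Suc m / real (Suc m) ^ p * (log_kernel q x * x ^ (l + n * Suc m - 1))) has_integral
           (\<Sum>m. b ^ Suc m / (real (Suc m) ^ p * real (l + n * Suc m) ^ q))) {0..1}"
  proof (rule has_integral_series[OF int int[of 1] sm])
    fix x :: real assume x: "0 < x" "x < 1"
    show "\<bar>b ^ Suc m / real (Suc m) ^ p * (log_kernel q x * x ^ (l + n * Suc m - 1))\<bar>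
       \<le> 1 / real (Suc m) ^ p * (log_kernel q x * x ^ (l + n * Suc m - 1))" for m
      using x b log_kernel_nonneg[of x q] by (auto simp: abs_mult power_abs)
    from sums_summable[OF sums_mult[OF Li_div_sums[OF n p, of 1 x l], of "log_kernel q x"]] x
    show "summable (\<lambda>m. 1 / real (Suc m) ^ p * (log_kernel q x * x ^ (l + n * Suc m - 1)))"
      by (simp add: mult_ac)
  qed
  have B: "log_kernel q x * (Li p (b * x ^ n) * x ^ l / x) =
      (\<Sum>m. b ^ Suc m / real (Suc m) ^ p * (log_kernel q x * x ^ (l + n * Suc m - 1)))"
    if "x \<in> {0..1} - {0, 1}" for x
    using sums_unique[OF sums_mult[OF Li_div_sums[OF n p b, of x l], of "log_kernel q x"]] that
    by (simp add: mult_ac)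
  show "((\<lambda>x. log_kernel q x * (Li p (b * x ^ n) * x ^ l / x)) has_integral
           (\<Sum>m. b ^ Suc m / (real (Suc m) ^ p * real (l + n * Suc m) ^ q))) {0..1}"
    by (rule has_integral_spike_finite[OF _ B A]) (rule finite.intros | assumption)+
qed

text \<open>The inner sums over m are bounded uniformly in l by the sum of inverse squares, so |z| <
  1 makes the outer series absolutely convergent. At |z| = 1 this can fail, hence the
  regularisation.\<close>

lemma has_integral_polylog_geometric:
  assumes n: "n \<ge> 1" and p: "p \<ge> 1" and q: "q \<ge> 1" and b: "b \<in> {1, -1}" and z: "\<bar>z\<bar> < 1"
  shows "((\<lambda>x. log_kernel q x * (Li p (b * x ^ n) * (z / (1 - z * x)))) has_integral
           (\<Sum>l. z ^ Suc l * (\<Sum>m. b ^ Suc m / (real (Suc m) ^ p * real (Suc l + n * Suc m) ^ q)))) {0..1}"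
proof -
  define S where "S c l = (\<Sum>m. c ^ Suc m / (real (Suc m) ^ p * real (Suc l + n * Suc m) ^ q))" for c :: real and l
  define C where "C = (\<Sum>m. 1 / real (Suc m) ^ 2)"
  note int = has_integral_log_kernel_polylog[OF n p q]
  have S1: "\<bar>S 1 l\<bar> \<le> C" for l
  proof -
    show ?thesis unfolding S_def C_def real_norm_def [symmetric]
      by (rule norm_suminf_le[OF _ summable_inverse_squares])
         (use upper_term_bound[OF p q n, of _ "Suc l"] in auto)
  qed
  have A: "((\<lambda>x. \<Sum>l. z ^ Suc l * (log_kernel q x * (Li p (b * x ^ n) * x ^ Suc l / x)))
          has_integral (\<Sum>l. z ^ Suc l * S b l)) {0..1}"
  proof (rule has_integral_series)
    show "((\<lambda>x. z ^ Suc l * (log_kernel q x * (Li p (b * x ^ n) * x ^ Suc l / x)))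
          has_integral z ^ Suc l * S b l) {0..1}" for l
      unfolding S_def by (intro has_integral_mult_right int b)
    show "((\<lambda>x. \<bar>z\<bar> ^ Suc l * (log_kernel q x * (Li p (1 * x ^ n) * x ^ Suc l / x)))
          has_integral \<bar>z\<bar> ^ Suc l * S 1 l) {0..1}" for l
      unfolding S_def by (intro has_integral_mult_right int) auto
    show "summable (\<lambda>l. \<bar>z\<bar> ^ Suc l * S 1 l)"
    proof (rule summable_comparison_test_ev)
      show "summable (\<lambda>l. \<bar>z\<bar> * C * \<bar>z\<bar> ^ l)"
        using z by (intro summable_mult summable_geometric) auto
      show "\<forall>\<^sub>F l in sequentially. norm (\<bar>z\<bar> ^ Suc l * S 1 l) \<le> \<bar>z\<bar> * C * \<bar>z\<bar> ^ l"
      proof (intro always_eventually allI)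
        fix l
        have "\<bar>z\<bar> ^ Suc l * \<bar>S 1 l\<bar> \<le> \<bar>z\<bar> ^ Suc l * C" by (intro mult_left_mono S1) simp
        then show "norm (\<bar>z\<bar> ^ Suc l * S 1 l) \<le> \<bar>z\<bar> * C * \<bar>z\<bar> ^ l" by (simp add: abs_mult mult_ac)
      qed
    qed
    fix x :: real assume x: "0 < x" "x < 1"
    have xn: "\<bar>b * x ^ n\<bar> = x ^ n" "x ^ n < 1"
      using b x n power_Suc_less_one[of x "n - 1"] by (auto simp: abs_mult)
    have "\<bar>Li p (b * x ^ n)\<bar> \<le> Li p (x ^ n)"
      using Li_abs_le[of "b * x ^ n" p] xn p by simp
    then show "\<bar>z ^ Suc l * (log_kernel q x * (Li p (b * x ^ n) * x ^ Suc l / x))\<bar>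
       \<le> \<bar>z\<bar> ^ Suc l * (log_kernel q x * (Li p (1 * x ^ n) * x ^ Suc l / x))" for l
      using x log_kernel_nonneg[of x q]
      by (auto simp: abs_mult power_abs intro!: mult_left_mono mult_right_mono divide_right_mono)
    have "\<bar>z * x\<bar> < 1" using z x by (simp add: abs_mult) (smt (verit) mult_left_le)
    then have "summable (\<lambda>l. (\<bar>z\<bar> * log_kernel q x * Li p (x ^ n)) * \<bar>z * x\<bar> ^ l)"
      by (intro summable_mult summable_geometric) simp
    then show "summable (\<lambda>l. \<bar>z\<bar> ^ Suc l * (log_kernel q x * (Li p (1 * x ^ n) * x ^ Suc l / x)))"
      using x by (simp add: power_mult_distrib abs_mult mult_ac)
  qed
  have B: "log_kernel q x * (Li p (b * x ^ n) * (z / (1 - z * x))) =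
      (\<Sum>l. z ^ Suc l * (log_kernel q x * (Li p (b * x ^ n) * x ^ Suc l / x)))"
    if x: "x \<in> {0..1} - {0, 1}" for x
  proof -
    have "\<bar>z * x\<bar> < 1" using z x by (simp add: abs_mult) (smt (verit) mult_left_le)
    then have "(\<lambda>l. (z * log_kernel q x * Li p (b * x ^ n)) * (z * x) ^ l) sums
       ((z * log_kernel q x * Li p (b * x ^ n)) * (1 / (1 - z * x)))"
      by (intro sums_mult geometric_sums) simp
    from sums_unique[OF this] show ?thesis
      using x by (simp add: power_mult_distrib mult_ac)
  qed
  show ?thesis
    unfolding S_def [symmetric] by (rule has_integral_spike_finite[OF _ B A]) (rule finite.intros | assumption)+
qed

lemma integrable_log_kernel_div:
  assumes "q \<ge> 2"
  shows "(\<lambda>x. log_kernel q x / (1 - x)) integrable_on {0..1}"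
  using has_integral_log_kernel_geometric[of 1 q] assms by (auto simp: integrable_on_def)

lemma dominated_convergence_unit_interval:
  fixes f :: "nat \<Rightarrow> real \<Rightarrow> real"
  assumes f: "\<And>k. (f k has_integral S k) {0..1}" and h: "h integrable_on {0..1}"
    and le: "\<And>x k. 0 < x \<Longrightarrow> x < 1 \<Longrightarrow> \<bar>f k x\<bar> \<le> h x"
    and conv: "\<And>x. 0 < x \<Longrightarrow> x < 1 \<Longrightarrow> (\<lambda>k. f k x) \<longlonglongrightarrow> g x"
  shows "g integrable_on {0..1}" and "S \<longlonglongrightarrow> integral {0..1} g"
proof -
  have f': "(f k has_integral S k) {0<..<1}" for k using f[of k] by (simp add: has_integral_Icc_iff_Ioo)
  have h': "h integrable_on {0<..<1}" using h by (simp add: integrable_on_Icc_iff_Ioo)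
  have D: "g integrable_on {0<..<1}" "(\<lambda>k. integral {0<..<1} (f k)) \<longlonglongrightarrow> integral {0<..<1} g"
    by (rule dominated_convergence[OF _ h', of f g]; use f' le conv in \<open>auto simp: integrable_on_def\<close>)+
  have gI: "(g has_integral integral {0<..<1} g) {0..1}"
    unfolding has_integral_Icc_iff_Ioo using D(1) by (rule integrable_integral)
  then show "g integrable_on {0..1}" by (rule has_integral_integrable)
  from gI have "integral {0..1} g = integral {0<..<1} g" by (rule integral_unique)
  with D(2) integral_unique[OF f'] show "S \<longlonglongrightarrow> integral {0..1} g" by simp
qed

text \<open>Dominated convergence. Sequences \<open>t k\<close> are used since the convergence
  theorem is sequential; all the work is a majorant independent of k, with different reasons for a =
  1 and a = -1.\<close>

lemma polylog_geometric_limit: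
  fixes t :: "nat \<Rightarrow> real"
  assumes n: "n \<ge> 1" and p: "p \<ge> 1" and q: "q \<ge> 1" and a: "a \<in> {1, -1}" and b: "b \<in> {1, -1}"
    and a1: "a = 1 \<Longrightarrow> q \<ge> 2" and ab: "a ^ n * b = 1 \<Longrightarrow> p \<ge> 2"
    and t: "\<And>k. 0 < t k" "\<And>k. t k < 1" "t \<longlonglongrightarrow> 1"
  shows "(\<lambda>x. log_kernel q x * (Li p (b * x ^ n) * (a / (1 - a * x)))) integrable_on {0..1}"
    and "(\<lambda>k. \<Sum>l. (a * t k) ^ Suc l * (\<Sum>m. b ^ Suc m / (real (Suc m) ^ p * real (Suc l + n * Suc m) ^ q)))
           \<longlonglongrightarrow> integral {0..1} (\<lambda>x. log_kernel q x * (Li p (b * x ^ n) * (a / (1 - a * x))))"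
proof -
  define f where "f k x = log_kernel q x * (Li p (b * x ^ n) * (a * t k / (1 - a * t k * x)))" for k x
  define g where "g x = log_kernel q x * (Li p (b * x ^ n) * (a / (1 - a * x)))" for x
  have az: "\<bar>a * t k\<bar> < 1" for k using a t(1,2)[of k] by (auto simp: abs_mult)
  obtain h where h: "h integrable_on {0..1}" and fh: "\<And>x k. 0 < x \<Longrightarrow> x < 1 \<Longrightarrow> \<bar>f k x\<bar> \<le> h x"
  \<comment> \<open>For a = 1 the hypothesis on \<open>a ^ n * b\<close> speaks of b alone, so
    Li_p(b x^n) is bounded, and q >= 2 makes the kernel over 1 - x integrable.\<close>
  proof (cases "a = 1")
    case True
    then have "b = 1 \<Longrightarrow> p \<ge> 2" using ab by simp
    from Li_bounded[OF b p this] obtain C where C: "C \<ge> 0"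
      "\<And>t. 0 \<le> t \<Longrightarrow> t < 1 \<Longrightarrow> \<bar>Li p (b * t)\<bar> \<le> C * t" by blast
    show ?thesis
    proof (rule that)
      show "(\<lambda>x. C * (log_kernel q x / (1 - x))) integrable_on {0..1}"
        using a1 True by (intro integrable_on_mult_right integrable_log_kernel_div) auto
      fix x k assume x: "0 < (x::real)" "x < 1"
      have xn: "0 \<le> x ^ n" "x ^ n < 1" using x n power_Suc_less_one[of x "n - 1"] by auto
      have "\<bar>Li p (b * x ^ n)\<bar> \<le> C * 1"
        using C(2)[OF xn] C(1) xn by (meson less_imp_le mult_left_mono order_trans)
      moreover have "\<bar>a * t k / (1 - a * t k * x)\<bar> \<le> 1 / (1 - x)"
        using True x t(1,2)[of k] mult_left_le_one_le[of x "t k"] unfolding abs_divide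
        by (intro frac_le) (auto intro: order.trans[OF _ abs_ge_self])
      ultimately have "\<bar>Li p (b * x ^ n)\<bar> * \<bar>a * t k / (1 - a * t k * x)\<bar> \<le> (C * 1) * (1 / (1 - x))"
        using C by (intro mult_mono) auto
      then have "log_kernel q x * (\<bar>Li p (b * x ^ n)\<bar> * \<bar>a * t k / (1 - a * t k * x)\<bar>)
          \<le> log_kernel q x * ((C * 1) * (1 / (1 - x)))"
        using x by (intro mult_left_mono log_kernel_nonneg) auto
      then show "\<bar>f k x\<bar> \<le> C * (log_kernel q x / (1 - x))"
        using x log_kernel_nonneg[of x q] by (simp add: f_def abs_mult mult_ac)
    qed
  next
    case False
    then have a': "a = -1" using a by auto
    \<comment> \<open>For a = -1 the denominator is at least 1, but b = p = 1 is possible for odd n.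
      The majorant is therefore the unsigned polylogarithm; writing it with x^1 / x matches the
      moment lemma at l = 1.\<close>
    show ?thesis
    proof (rule that)
      show "(\<lambda>x. log_kernel q x * (Li p (1 * x ^ n) * x ^ 1 / x)) integrable_on {0..1}"
        using has_integral_log_kernel_polylog(1)[OF n p q, of 1 1] by (auto simp: integrable_on_def)
      fix x k assume x: "0 < (x::real)" "x < 1"
      have xn: "\<bar>b * x ^ n\<bar> = x ^ n" "x ^ n < 1"
        using b x n power_Suc_less_one[of x "n - 1"] by (auto simp: abs_mult)
      have L: "\<bar>Li p (b * x ^ n)\<bar> \<le> Li p (x ^ n)"
        using Li_abs_le[of "b * x ^ n" p] xn p by simp
      have "\<bar>a * t k / (1 - a * t k * x)\<bar> \<le> 1 / 1"
        using a' x t(1,2)[of k] mult_nonneg_nonneg[of "t k" x] unfolding abs_divide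
        by (intro frac_le) (auto simp: less_imp_le)
      then have "\<bar>Li p (b * x ^ n)\<bar> * \<bar>a * t k / (1 - a * t k * x)\<bar> \<le> Li p (x ^ n) * 1"
        using L by (intro mult_mono) auto
      then have "log_kernel q x * (\<bar>Li p (b * x ^ n)\<bar> * \<bar>a * t k / (1 - a * t k * x)\<bar>)
          \<le> log_kernel q x * (Li p (x ^ n) * 1)"
        using x by (intro mult_left_mono log_kernel_nonneg) auto
      then show "\<bar>f k x\<bar> \<le> log_kernel q x * (Li p (1 * x ^ n) * x ^ 1 / x)"
        using x log_kernel_nonneg[of x q] by (simp add: f_def abs_mult)
    qed
  qed
  have conv: "(\<lambda>k. f k x) \<longlonglongrightarrow> g x" if "0 < x" "x < 1" for x
    unfolding f_def g_def using that a by (auto intro!: tendsto_eq_intros t(3))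
  have F: "(f k has_integral (\<Sum>l. (a * t k) ^ Suc l * (\<Sum>m. b ^ Suc m / (real (Suc m) ^ p * real (Suc l + n * Suc m) ^ q)))) {0..1}" for k
    using has_integral_polylog_geometric[OF n p q b az] unfolding f_def .
  show "g integrable_on {0..1}"
    by (rule dominated_convergence_unit_interval(1)[OF F h fh conv])
  show "(\<lambda>k. \<Sum>l. (a * t k) ^ Suc l * (\<Sum>m. b ^ Suc m / (real (Suc m) ^ p * real (Suc l + n * Suc m) ^ q)))
           \<longlonglongrightarrow> integral {0..1} g"
    by (rule dominated_convergence_unit_interval(2)[OF F h fh conv])
qed

section \<open>The terms below the diagonal as a difference quotient\<close>

lemma sum_power_mult_diff:
  fixes x z :: real
  shows "(x - z) * (\<Sum>l<K. z ^ Suc l * x ^ (K - Suc l)) = z * (x ^ K - z ^ K)"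
proof -
  have "z ^ K - x ^ K = (z - x) * (\<Sum>l<K. x ^ (K - Suc l) * z ^ l)"
    by (rule power_diff_sumr2)
  moreover have "(\<Sum>l<K. z ^ Suc l * x ^ (K - Suc l)) = z * (\<Sum>l<K. x ^ (K - Suc l) * z ^ l)"
    by (simp add: sum_distrib_left mult_ac)
  ultimately have "(x - z) * (\<Sum>l<K. z ^ Suc l * x ^ (K - Suc l)) = - (z * (z ^ K - x ^ K))"
    by (simp only:) (simp only: minus_diff_eq [of z x, symmetric] mult_minus_left mult.left_commute)
  then show ?thesis by (simp add: algebra_simps)
qed

lemma power_mult_abs_diff_le:
  fixes x y r :: real
  assumes "0 \<le> x" "x \<le> r" "0 \<le> y" "y \<le> r"
  shows "\<bar>x ^ K - y ^ K\<bar> \<le> \<bar>x - y\<bar> * (real K * r ^ (K - 1))"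
proof -
  have "x ^ K - y ^ K = (x - y) * (\<Sum>l<K. y ^ (K - Suc l) * x ^ l)"
    by (rule power_diff_sumr2)
  moreover have "\<bar>\<Sum>l<K. y ^ (K - Suc l) * x ^ l\<bar> \<le> (\<Sum>l<K. r ^ (K - 1))"
  proof (rule order.trans[OF sum_abs], rule sum_mono)
    fix l assume l: "l \<in> {..<K}"
    have "y ^ (K - Suc l) * x ^ l \<le> r ^ (K - Suc l) * r ^ l"
      using assms by (intro mult_mono power_mono) auto
    also have "\<dots> = r ^ (K - 1)" using l by (simp flip: power_add)
    finally show "\<bar>y ^ (K - Suc l) * x ^ l\<bar> \<le> r ^ (K - 1)" using assms by (simp add: abs_mult power_abs)
  qed
  ultimately show ?thesis by (simp add: abs_mult mult_left_mono)
qed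

text \<open>Termwise: y^K with K = n (m + 1) - 1 has Lipschitz constant at most n (m + 1) r^(m-1) on
  (0, r], and its factor m + 1 cancels against the coefficient, which is at most 1 / (m + 1). A
  geometric series in r remains.\<close>

lemma polylog_quotient_Lipschitz:
  assumes n: "n \<ge> 1" and p: "p \<ge> 1" and b: "b \<in> {1, -1}"
    and x: "0 < x" "x \<le> r" and y: "0 < y" "y \<le> r" and r: "r < 1"
  shows "\<bar>Li p (b * x ^ n) / x - Li p (b * y ^ n) / y\<bar>
           \<le> \<bar>x - y\<bar> * (2 * real n / (1 - r))"
proof -
  have r0: "0 < r" using x by simp
  let ?c = "\<lambda>m. b ^ Suc m / real (Suc m) ^ p" and ?K = "\<lambda>m. n * Suc m - 1"
  have s: "(\<lambda>m. ?c m * w ^ ?K m) sums (Li p (b * w ^ n) / w)" if "0 < w" "w \<le> r" for w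
    using Li_div_sums[OF n p b, of w 0] that r by simp
  have d: "(\<lambda>m. ?c m * x ^ ?K m - ?c m * y ^ ?K m) sums
      (Li p (b * x ^ n) / x - Li p (b * y ^ n) / y)"
    by (intro sums_diff s x y)
  \<comment> \<open>The exponent m - 1 is truncated, so r^0 occurs for both m = 0 and m = 1. The
    extra summand is absorbed by the factor 2, since 1 <= 1 / (1 - r).\<close>
  have geo: "(\<lambda>m. \<bar>x - y\<bar> * real n * r ^ (m - 1)) sums
      (\<bar>x - y\<bar> * real n * (1 / (1 - r)) + \<bar>x - y\<bar> * real n * r ^ (0 - 1))"
  proof (rule sums_Suc)
    have "(\<lambda>m. \<bar>x - y\<bar> * real n * r ^ m) sums (\<bar>x - y\<bar> * real n * (1 / (1 - r)))"
      using r r0 by (intro sums_mult geometric_sums) auto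
    then show "(\<lambda>m. \<bar>x - y\<bar> * real n * r ^ (Suc m - 1)) sums (\<bar>x - y\<bar> * real n * (1 / (1 - r)))"
      by simp
  qed
  have le: "norm (?c m * x ^ ?K m - ?c m * y ^ ?K m) \<le> \<bar>x - y\<bar> * real n * r ^ (m - 1)" for m
  proof -
    have "\<bar>?c m\<bar> \<le> 1 / real (Suc m)"
      using b p power_increasing[of 1 p "real (Suc m)"]
      by (auto simp: abs_mult power_abs intro!: divide_left_mono simp del: of_nat_Suc)
    moreover have "\<bar>x ^ ?K m - y ^ ?K m\<bar> \<le> \<bar>x - y\<bar> * (real (n * Suc m) * r ^ (m - 1))"
    proof -
      have "Suc m \<le> n * Suc m" using n by (metis mult_le_mono1 nat_mult_1)
      then have "r ^ (?K m - 1) \<le> r ^ (m - 1)"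
        using r r0 by (intro power_decreasing) auto
      moreover have "real (?K m) \<le> real (n * Suc m)" by (intro of_nat_mono diff_le_self)
      ultimately have "real (?K m) * r ^ (?K m - 1) \<le> real (n * Suc m) * r ^ (m - 1)"
        using r0 by (intro mult_mono) auto
      with power_mult_abs_diff_le[of x r y "?K m"] x y show ?thesis
        by (meson abs_ge_zero less_imp_le mult_left_mono order_trans)
    qed
    ultimately have "\<bar>?c m\<bar> * \<bar>x ^ ?K m - y ^ ?K m\<bar>
        \<le> 1 / real (Suc m) * (\<bar>x - y\<bar> * (real (n * Suc m) * r ^ (m - 1)))"
      by (intro mult_mono) auto
    also have "\<dots> = \<bar>x - y\<bar> * real n * r ^ (m - 1)"
      by (simp add: of_nat_mult del: of_nat_Suc mult_Suc_right)
    finally show ?thesis by (simp only: real_norm_def abs_mult flip: right_diff_distrib)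
  qed
  have "norm (\<Sum>m. ?c m * x ^ ?K m - ?c m * y ^ ?K m) \<le> (\<Sum>m. \<bar>x - y\<bar> * real n * r ^ (m - 1))"
    by (rule norm_suminf_le[OF le sums_summable[OF geo]])
  also have "\<dots> = \<bar>x - y\<bar> * real n * (1 / (1 - r)) + \<bar>x - y\<bar> * real n"
    using sums_unique[OF geo] by simp
  also have "\<dots> \<le> \<bar>x - y\<bar> * (2 * real n / (1 - r))"
  proof -
    have "1 \<le> 1 / (1 - r)" using r r0 by simp
    then have "\<bar>x - y\<bar> * real n * 1 \<le> \<bar>x - y\<bar> * real n * (1 / (1 - r))"
      by (intro mult_left_mono) auto
    moreover have "\<bar>x - y\<bar> * (2 * real n / (1 - r)) =
        \<bar>x - y\<bar> * real n * (1 / (1 - r)) + \<bar>x - y\<bar> * real n * (1 / (1 - r))"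
      by (simp flip: distrib_left)
    ultimately show ?thesis by linarith
  qed
  finally show ?thesis using sums_unique[OF d] by simp
qed

text \<open>A bound free of y, by the distance of y from x. If it is less than (1 - x) / 2, the
  Lipschitz estimate applies with 1 - r >= (1 - x) / 2 and gives 2 L; otherwise the numerator is at
  most 2 C over that distance, giving 4 C.\<close>

lemma difference_quotient_le:
  fixes F :: "real \<Rightarrow> real"
  assumes C: "C \<ge> 0" "\<And>y. 0 < y \<Longrightarrow> y < 1 \<Longrightarrow> \<bar>F y\<bar> \<le> C"
    and L: "L \<ge> 0" "\<And>x y r. 0 < x \<Longrightarrow> x \<le> r \<Longrightarrow> 0 < y \<Longrightarrow> y \<le> r \<Longrightarrow> r < 1 \<Longrightarrow> \<bar>F x - F y\<bar> \<le> \<bar>x - y\<bar> * (L / (1 - r))"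
    and x: "0 < x" "x < 1" and y: "0 < y" "y < 1"
  shows "\<bar>(F x - F y) / (x - y)\<bar> \<le> (4 * C + 2 * L) / (1 - x)"
proof (cases "\<bar>x - y\<bar> < (1 - x) / 2")
  case True
  define r where "r = max x y"
  have r: "1 - r \<ge> (1 - x) / 2" "r < 1" using True x y by (auto simp: r_def max_def)
  have "\<bar>F x - F y\<bar> \<le> \<bar>x - y\<bar> * (L / (1 - r))"
    using x y r by (intro L) (auto simp: r_def)
  then have "\<bar>(F x - F y) / (x - y)\<bar> \<le> L / (1 - r)"
    using L r by (cases "x = y") (auto simp: field_simps)
  also have "\<dots> \<le> L / ((1 - x) / 2)" using L r x by (intro divide_left_mono) auto
  also have "\<dots> \<le> (4 * C + 2 * L) / (1 - x)" using C(1) x by (simp add: field_simps mult_left_le)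
  finally show ?thesis .
next
  case False
  have "\<bar>F x - F y\<bar> \<le> 2 * C" using C(2)[of x] C(2)[of y] x y by linarith
  then have "\<bar>(F x - F y) / (x - y)\<bar> \<le> 2 * C / ((1 - x) / 2)"
    using False x unfolding abs_divide by (intro frac_le) auto
  also have "\<dots> \<le> (4 * C + 2 * L) / (1 - x)" using L(1) x by (simp add: field_simps mult_left_le)
  finally show ?thesis .
qed

text \<open>Off the diagonal d = |l - n m| is a positive integer, hence m <= n m <= l + d <= 2 l d
  (indices shifted by one in the code). The growth in l is harmless under the weight |z|^l. On the
  diagonal the left side is 0 by \<open>1 / 0 = 0\<close>.\<close>

lemma lower_term_bound:
  assumes "p \<ge> 1" "q \<ge> 1" and n: "n \<ge> 1"
  shows "1 / (real (Suc m) ^ p * \<bar>real (Suc l) - real (n * Suc m)\<bar> ^ q) \<le> 2 * real (Suc l) / real (Suc m) ^ 2"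
proof (cases "Suc l = n * Suc m")
  case True
  then show ?thesis using assms by (simp add: power_0_left del: of_nat_Suc mult_Suc_right)
next
  case False
  define d where "d = \<bar>real (Suc l) - real (n * Suc m)\<bar>"
  have "int (Suc l) - int (n * Suc m) \<noteq> 0" using False by linarith
  then have "1 \<le> \<bar>int (Suc l) - int (n * Suc m)\<bar>" by linarith
  then have d1: "1 \<le> d" unfolding d_def by linarith
  have "Suc m \<le> n * Suc m" using n by (metis mult_le_mono1 nat_mult_1)
  then have "real (Suc m) \<le> real (n * Suc m)" by (simp only: of_nat_le_iff)
  also have "\<dots> \<le> real (Suc l) + d" unfolding d_def by linarith
  also have "\<dots> \<le> real (Suc l) * d + real (Suc l) * d"
    using d1 by (intro add_mono) (auto simp: mult_le_cancel_left1 intro: mult_le_cancel_right1[THEN iffD2])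
  also have "\<dots> = 2 * real (Suc l) * d" by simp
  finally show ?thesis
    using assms d1 unfolding d_def [symmetric] by (intro inverse_mult_power_le) auto
qed

lemma summable_Suc_power:
  assumes "\<bar>z\<bar> < (1::real)" shows "summable (\<lambda>l. 2 * real (Suc l) * \<bar>z\<bar> ^ Suc l)"
proof -
  have "summable (\<lambda>l. real (Suc l) * 1 * \<bar>z\<bar> ^ l)"
    using geometric_deriv_sums[of "\<bar>z\<bar>"] assms by (auto simp: sums_iff)
  moreover have "(\<lambda>l. 2 * real (Suc l) * \<bar>z\<bar> ^ Suc l) = (\<lambda>l. 2 * \<bar>z\<bar> * (real (Suc l) * 1 * \<bar>z\<bar> ^ l))"
    by (auto simp: fun_eq_iff)
  ultimately show ?thesis by (simp only: summable_mult)
qed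

text \<open>Each power x^(K - l - 1) has moment 1 / (n m - l - 1)^q in shifted indices; the
  geometric sum over l closes to z (x^K - z^K) / (x - z), and summing over m turns x^K and z^K into
  F x and F z.\<close>

lemma has_integral_polylog_quotient:
  assumes n: "n \<ge> 1" and p: "p \<ge> 1" and q: "q \<ge> 1" and b: "b \<in> {1, -1}" and z: "z \<noteq> 0" "\<bar>z\<bar> < 1"
  defines "F \<equiv> \<lambda>y. Li p (b * y ^ n) / y"
  shows "((\<lambda>x. log_kernel q x * (z * ((F x - F z) / (x - z)))) has_integral
           (\<Sum>m. b ^ Suc m / real (Suc m) ^ p *
              (\<Sum>l<n * Suc m - 1. z ^ Suc l / (real (n * Suc m) - real (Suc l)) ^ q))) {0..1}"
proof -
  let ?K = "\<lambda>m. n * Suc m - 1"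
  have int: "((\<lambda>x. c / real (Suc m) ^ p * (\<Sum>l<?K m. w ^ Suc l * (log_kernel q x * x ^ (?K m - Suc l)))) has_integral
      c / real (Suc m) ^ p * (\<Sum>l<?K m. w ^ Suc l / (real (n * Suc m) - real (Suc l)) ^ q)) {0..1}" for c w :: real and m
  proof (intro has_integral_mult_right has_integral_sum)
    fix l assume l: "l \<in> {..<?K m}"
    then have "Suc (?K m - Suc l) = n * Suc m - Suc l" by auto
    moreover have "real (n * Suc m - Suc l) = real (n * Suc m) - real (Suc l)"
      using l by (intro of_nat_diff) auto
    ultimately have eq: "real (Suc (?K m - Suc l)) = real (n * Suc m) - real (Suc l)"
      by (simp only:)
    from has_integral_mult_right[OF has_integral_log_kernel_power[OF q, of "?K m - Suc l", unfolded eq], of "w ^ Suc l"]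
    show "((\<lambda>x. w ^ Suc l * (log_kernel q x * x ^ (?K m - Suc l))) has_integral
           w ^ Suc l / (real (n * Suc m) - real (Suc l)) ^ q) {0..1}"
      by (simp only: times_divide_eq_right mult_1_right)
  qed simp
  have sJ: "summable (\<lambda>m. 1 / real (Suc m) ^ p * (\<Sum>l<?K m. \<bar>z\<bar> ^ Suc l / (real (n * Suc m) - real (Suc l)) ^ q))"
  proof (rule summable_comparison_test_ev)
    show "summable (\<lambda>m. (\<Sum>l. 2 * real (Suc l) * \<bar>z\<bar> ^ Suc l) * (1 / real (Suc m) ^ 2))"
      by (intro summable_mult summable_inverse_squares)
    show "\<forall>\<^sub>F m in sequentially. norm (1 / real (Suc m) ^ p * (\<Sum>l<?K m. \<bar>z\<bar> ^ Suc l / (real (n * Suc m) - real (Suc l)) ^ q))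
       \<le> (\<Sum>l. 2 * real (Suc l) * \<bar>z\<bar> ^ Suc l) * (1 / real (Suc m) ^ 2)"
    proof (intro always_eventually allI)
      fix m
      have pos: "real (n * Suc m) - real (Suc l) > 0" if "l < ?K m" for l
      proof -
        have "Suc l < n * Suc m" using that by linarith
        then have "real (Suc l) < real (n * Suc m)" by (simp only: of_nat_less_iff)
        then show ?thesis by simp
      qed
      have "norm (1 / real (Suc m) ^ p * (\<Sum>l<?K m. \<bar>z\<bar> ^ Suc l / (real (n * Suc m) - real (Suc l)) ^ q))
        = (\<Sum>l<?K m. \<bar>z\<bar> ^ Suc l * (1 / (real (Suc m) ^ p * \<bar>real (Suc l) - real (n * Suc m)\<bar> ^ q)))"
      proof -
        have "(\<Sum>l<?K m. \<bar>z\<bar> ^ Suc l / (real (n * Suc m) - real (Suc l)) ^ q) \<ge> 0"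
          using pos by (intro sum_nonneg divide_nonneg_pos) (auto simp del: mult_Suc_right of_nat_Suc power_Suc)
        then have "norm (1 / real (Suc m) ^ p * (\<Sum>l<?K m. \<bar>z\<bar> ^ Suc l / (real (n * Suc m) - real (Suc l)) ^ q)) =
          1 / real (Suc m) ^ p * (\<Sum>l<?K m. \<bar>z\<bar> ^ Suc l / (real (n * Suc m) - real (Suc l)) ^ q)"
          by (simp only: real_norm_def abs_of_nonneg mult_nonneg_nonneg zero_le_divide_1_iff zero_le_power of_nat_0_le_iff)
        also have "\<dots> = (\<Sum>l<?K m. \<bar>z\<bar> ^ Suc l * (1 / (real (Suc m) ^ p * \<bar>real (Suc l) - real (n * Suc m)\<bar> ^ q)))"
          unfolding sum_distrib_left
        proof (rule sum.cong[OF refl])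
          fix l assume "l \<in> {..<?K m}"
          then have eq: "\<bar>real (Suc l) - real (n * Suc m)\<bar> = real (n * Suc m) - real (Suc l)" using pos[of l] by simp
          show "1 / real (Suc m) ^ p * (\<bar>z\<bar> ^ Suc l / (real (n * Suc m) - real (Suc l)) ^ q) =
             \<bar>z\<bar> ^ Suc l * (1 / (real (Suc m) ^ p * \<bar>real (Suc l) - real (n * Suc m)\<bar> ^ q))"
            unfolding eq by (simp del: of_nat_Suc mult_Suc_right power_Suc of_nat_mult)
        qed
        finally show ?thesis .
      qed
      also have "\<dots> \<le> (\<Sum>l<?K m. \<bar>z\<bar> ^ Suc l * (2 * real (Suc l) / real (Suc m) ^ 2))"
        by (intro sum_mono mult_left_mono lower_term_bound p q n) auto
      also have "\<dots> = (\<Sum>l<?K m. 2 * real (Suc l) * \<bar>z\<bar> ^ Suc l) * (1 / real (Suc m) ^ 2)"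
        unfolding sum_distrib_right by (intro sum.cong) (auto simp del: of_nat_Suc)
      also have "\<dots> \<le> (\<Sum>l. 2 * real (Suc l) * \<bar>z\<bar> ^ Suc l) * (1 / real (Suc m) ^ 2)"
        by (intro mult_right_mono sum_le_suminf summable_Suc_power z) auto
      finally show "norm (1 / real (Suc m) ^ p * (\<Sum>l<?K m. \<bar>z\<bar> ^ Suc l / (real (n * Suc m) - real (Suc l)) ^ q))
       \<le> (\<Sum>l. 2 * real (Suc l) * \<bar>z\<bar> ^ Suc l) * (1 / real (Suc m) ^ 2)" .
    qed
  qed
  have A: "((\<lambda>x. \<Sum>m. b ^ Suc m / real (Suc m) ^ p * (\<Sum>l<?K m. z ^ Suc l * (log_kernel q x * x ^ (?K m - Suc l)))) has_integral
     (\<Sum>m. b ^ Suc m / real (Suc m) ^ p * (\<Sum>l<?K m. z ^ Suc l / (real (n * Suc m) - real (Suc l)) ^ q))) {0..1}"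
  proof (rule has_integral_series[OF int int[of 1 _ "\<bar>z\<bar>"] sJ])
    fix x :: real assume x: "0 < x" "x < 1"
    show "\<bar>b ^ Suc m / real (Suc m) ^ p * (\<Sum>l<?K m. z ^ Suc l * (log_kernel q x * x ^ (?K m - Suc l)))\<bar>
      \<le> 1 / real (Suc m) ^ p * (\<Sum>l<?K m. \<bar>z\<bar> ^ Suc l * (log_kernel q x * x ^ (?K m - Suc l)))" for m
    proof -
      have "\<bar>b ^ Suc m / real (Suc m) ^ p\<bar> \<le> 1 / real (Suc m) ^ p"
        using b by (auto simp: power_abs)
      moreover have "\<bar>\<Sum>l<?K m. z ^ Suc l * (log_kernel q x * x ^ (?K m - Suc l))\<bar>
         \<le> (\<Sum>l<?K m. \<bar>z\<bar> ^ Suc l * (log_kernel q x * x ^ (?K m - Suc l)))"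
        using x log_kernel_nonneg[of x q]
        by (intro order.trans[OF sum_abs] sum_mono) (auto simp: abs_mult power_abs)
      ultimately show ?thesis unfolding abs_mult by (intro mult_mono) auto
    qed
    \<comment> \<open>With K = n (m + 1) - 1 >= m, each of the K summands is at most r^m times the
      kernel; the factor 1 / (m + 1) cancels their number up to n.\<close>
    define r where "r = max \<bar>z\<bar> x"
    have r: "0 < r" "r < 1" "\<bar>z\<bar> \<le> r" "x \<le> r" using x z by (auto simp: r_def)
    show "summable (\<lambda>m. 1 / real (Suc m) ^ p * (\<Sum>l<?K m. \<bar>z\<bar> ^ Suc l * (log_kernel q x * x ^ (?K m - Suc l))))"
    proof (rule summable_comparison_test_ev)
      show "summable (\<lambda>m. (log_kernel q x * real n) * r ^ m)"
        using r by (intro summable_mult summable_geometric) auto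
      show "\<forall>\<^sub>F m in sequentially. norm (1 / real (Suc m) ^ p * (\<Sum>l<?K m. \<bar>z\<bar> ^ Suc l * (log_kernel q x * x ^ (?K m - Suc l))))
         \<le> (log_kernel q x * real n) * r ^ m"
      proof (intro always_eventually allI)
        fix m
        have mn: "Suc m \<le> n * Suc m" using n by (metis mult_le_mono1 nat_mult_1)
        have K0: "0 \<le> log_kernel q x" using x by (intro log_kernel_nonneg) auto
        have "(\<Sum>l<?K m. \<bar>z\<bar> ^ Suc l * (log_kernel q x * x ^ (?K m - Suc l))) \<le> (\<Sum>l<?K m. log_kernel q x * r ^ m)"
        proof (rule sum_mono)
          fix l assume l: "l \<in> {..<?K m}"
          have "\<bar>z\<bar> ^ Suc l * x ^ (?K m - Suc l) \<le> r ^ Suc l * r ^ (?K m - Suc l)"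
            using r x by (intro mult_mono power_mono) auto
          also have "\<dots> = r ^ (Suc l + (?K m - Suc l))" by (simp only: power_add)
          also have "Suc l + (?K m - Suc l) = ?K m" using l by auto
          also have "r ^ ?K m \<le> r ^ m" using r mn by (intro power_decreasing) auto
          finally have "log_kernel q x * (\<bar>z\<bar> ^ Suc l * x ^ (?K m - Suc l)) \<le> log_kernel q x * r ^ m"
            using K0 by (rule mult_left_mono)
          then show "\<bar>z\<bar> ^ Suc l * (log_kernel q x * x ^ (?K m - Suc l)) \<le> log_kernel q x * r ^ m"
            by (simp only: mult.left_commute)
        qed
        also have "\<dots> = real (?K m) * (log_kernel q x * r ^ m)" by simp
        also have "\<dots> \<le> real (n * Suc m) * (log_kernel q x * r ^ m)"
          using K0 r by (intro mult_right_mono of_nat_mono diff_le_self) auto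
        finally have "1 / real (Suc m) ^ p * (\<Sum>l<?K m. \<bar>z\<bar> ^ Suc l * (log_kernel q x * x ^ (?K m - Suc l)))
           \<le> 1 / real (Suc m) * (real (n * Suc m) * (log_kernel q x * r ^ m))"
          using p power_increasing[of 1 p "real (Suc m)"] K0 x
          by (intro mult_mono divide_left_mono) (auto intro!: sum_nonneg)
        also have "\<dots> = (log_kernel q x * real n) * r ^ m"
          by (simp add: of_nat_mult del: of_nat_Suc mult_Suc_right)
        finally show "norm (1 / real (Suc m) ^ p * (\<Sum>l<?K m. \<bar>z\<bar> ^ Suc l * (log_kernel q x * x ^ (?K m - Suc l))))
         \<le> (log_kernel q x * real n) * r ^ m"
          using K0 x by (subst real_norm_def, subst abs_of_nonneg) (auto intro!: sum_nonneg divide_nonneg_nonneg)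
      qed
    qed
  qed
  \<comment> \<open>The point z is exempted along with the endpoints, because it may lie in (0, 1),
    where the quotient reads 0 / 0.\<close>
  have B: "(\<Sum>m. b ^ Suc m / real (Suc m) ^ p * (\<Sum>l<?K m. z ^ Suc l * (log_kernel q x * x ^ (?K m - Suc l))))
      = log_kernel q x * (z * ((F x - F z) / (x - z)))" if x: "x \<in> {0..1} - {0, 1, z}" for x
  proof -
    have s: "(\<lambda>m. b ^ Suc m / real (Suc m) ^ p * w ^ ?K m) sums F w" if "w \<noteq> 0" "\<bar>w\<bar> < 1" for w
      using Li_div_sums[OF n p b that, of 0] by (simp add: F_def)
    have "(\<lambda>m. log_kernel q x * z / (x - z) * (b ^ Suc m / real (Suc m) ^ p * x ^ ?K m - b ^ Suc m / real (Suc m) ^ p * z ^ ?K m)) sums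
        (log_kernel q x * z / (x - z) * (F x - F z))"
      using x z by (intro sums_mult sums_diff s) auto
    moreover have "log_kernel q x * z / (x - z) * (b ^ Suc m / real (Suc m) ^ p * x ^ ?K m - b ^ Suc m / real (Suc m) ^ p * z ^ ?K m)
        = b ^ Suc m / real (Suc m) ^ p * (\<Sum>l<?K m. z ^ Suc l * (log_kernel q x * x ^ (?K m - Suc l)))" for m
    proof -
      have "(\<Sum>l<?K m. z ^ Suc l * (log_kernel q x * x ^ (?K m - Suc l))) = log_kernel q x * (\<Sum>l<?K m. z ^ Suc l * x ^ (?K m - Suc l))"
        by (simp only: sum_distrib_left mult.left_commute)
      also have "(\<Sum>l<?K m. z ^ Suc l * x ^ (?K m - Suc l)) = z * (x ^ ?K m - z ^ ?K m) / (x - z)"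
        using sum_power_mult_diff[of x z "?K m"] x by (simp add: eq_divide_eq mult.commute del: mult_Suc_right power_Suc)
      finally show ?thesis
        by (simp only: right_diff_distrib [symmetric]) (simp add: mult_ac del: mult_Suc_right power_Suc of_nat_Suc)
    qed
    ultimately show ?thesis by (simp add: sums_iff del: mult_Suc_right power_Suc of_nat_Suc)
  qed
  show ?thesis
    by (rule has_integral_spike_finite[OF _ B[symmetric] A]) (rule finite.intros | assumption)+
qed

text \<open>Here the node \<open>a * t k\<close> moves with k, so F at the node must be controlled
  too: it converges by Abel's theorem for the sign a^n b.\<close>

lemma polylog_quotient_limit:
  fixes t :: "nat \<Rightarrow> real"
  assumes n: "n \<ge> 1" and p: "p \<ge> 1" and q: "q \<ge> 1" and a: "a \<in> {1, -1}" and b: "b \<in> {1, -1}"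
    and a1: "a = 1 \<Longrightarrow> q \<ge> 2" and ab: "a ^ n * b = 1 \<Longrightarrow> p \<ge> 2"
    and t: "\<And>k. 1 / 2 \<le> t k" "\<And>k. t k < 1" "t \<longlonglongrightarrow> 1"
  defines "F \<equiv> \<lambda>y. Li p (b * y ^ n) / y"
  shows "(\<lambda>x. log_kernel q x * (a * ((F x - F a) / (x - a)))) integrable_on {0..1}"
    and "(\<lambda>k. \<Sum>m. b ^ Suc m / real (Suc m) ^ p *
              (\<Sum>l<n * Suc m - 1. (a * t k) ^ Suc l / (real (n * Suc m) - real (Suc l)) ^ q))
           \<longlonglongrightarrow> integral {0..1} (\<lambda>x. log_kernel q x * (a * ((F x - F a) / (x - a))))"
proof -
  define f where "f k x = log_kernel q x * (a * t k * ((F x - F (a * t k)) / (x - a * t k)))" for k x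
  define g where "g x = log_kernel q x * (a * ((F x - F a) / (x - a)))" for x
  define c where "c = a ^ n * b"
  have c: "c \<in> {1, -1}" "c = 1 \<Longrightarrow> p \<ge> 2"
    using a b ab by (auto simp: c_def minus_one_power_iff split: if_splits)
  have t0: "0 < t k" for k using t(1)[of k] by linarith
  have Fz: "F (a * t k) = Li p (c * t k ^ n) / (a * t k)" for k
    by (simp add: F_def c_def power_mult_distrib mult_ac)
  have az: "a * t k \<noteq> 0" "\<bar>a * t k\<bar> < 1" for k using a t0[of k] t(2)[of k] by (auto simp: abs_mult)
  have t_left: "filterlim t (at_left 1) sequentially"
    using t(2,3) by (auto simp: filterlim_at less_imp_neq)
  have "((\<lambda>k. Li p (c * t k ^ n)) \<longlongrightarrow> Li p c) sequentially"
    by (rule filterlim_compose[OF Li_tendsto[OF c(1) p c(2)]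
          filterlim_compose[OF filterlim_power_at_left_1[OF n] t_left]])
  then have "(\<lambda>k. F (a * t k)) \<longlonglongrightarrow> Li p c / (a * 1)"
    unfolding Fz using a by (intro tendsto_intros t(3)) auto
  then have F_lim: "(\<lambda>k. F (a * t k)) \<longlonglongrightarrow> F a"
    by (simp add: F_def c_def mult_ac)
  have power_div_le: "y ^ n / y \<le> 1" "y ^ n < 1" if "0 < y" "y < 1" for y :: real
    using that n power_le_one[of y "n - 1"] power_Suc_less_one[of y "n - 1"] by (auto simp: power_eq_if)
  obtain h where h: "h integrable_on {0..1}" and fh: "\<And>x k. 0 < x \<Longrightarrow> x < 1 \<Longrightarrow> \<bar>f k x\<bar> \<le> h x"
  proof (cases "a = 1")
    case True
    have bp: "b = 1 \<Longrightarrow> p \<ge> 2" using True ab by simp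
    from Li_bounded[OF b p this] obtain C where C: "C \<ge> 0"
      "\<And>t. 0 \<le> t \<Longrightarrow> t < 1 \<Longrightarrow> \<bar>Li p (b * t)\<bar> \<le> C * t" by blast
    have FC: "\<bar>F y\<bar> \<le> C" if y: "0 < y" "y < 1" for y
    proof -
      have "\<bar>F y\<bar> = \<bar>Li p (b * y ^ n)\<bar> / y" using y by (simp add: F_def)
      also have "\<dots> \<le> C * y ^ n / y"
        using power_div_le(2)[OF y] y by (intro divide_right_mono C(2)) simp_all
      also have "\<dots> = C * (y ^ n / y)" by simp
      also have "\<dots> \<le> C" using C(1) power_div_le(1)[OF y] by (rule mult_left_le[rotated])
      finally show ?thesis .
    qed
    define D where "D = 4 * C + 2 * (2 * real n)"
    show ?thesis
    proof (rule that)
      show "(\<lambda>x. D * (log_kernel q x / (1 - x))) integrable_on {0..1}"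
        using a1 True by (intro integrable_on_mult_right integrable_log_kernel_div) auto
      fix x k assume x: "0 < (x::real)" "x < 1"
      have "\<bar>(F x - F (t k)) / (x - t k)\<bar> \<le> D / (1 - x)"
        unfolding D_def
      proof (rule difference_quotient_le[OF C(1) FC _ _ x t0 t(2)])
        show "\<bar>F x - F y\<bar> \<le> \<bar>x - y\<bar> * (2 * real n / (1 - r))"
          if "0 < x" "x \<le> r" "0 < y" "y \<le> r" "r < 1" for x y r
          unfolding F_def by (rule polylog_quotient_Lipschitz[OF n p b that])
      qed auto
      then have "t k * \<bar>(F x - F (t k)) / (x - t k)\<bar> \<le> 1 * (D / (1 - x))"
        using t0[of k] t(2)[of k] by (intro mult_mono) auto
      then have "log_kernel q x * (t k * \<bar>(F x - F (t k)) / (x - t k)\<bar>) \<le> log_kernel q x * (1 * (D / (1 - x)))"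
        using x by (intro mult_left_mono log_kernel_nonneg) auto
      then show "\<bar>f k x\<bar> \<le> D * (log_kernel q x / (1 - x))"
        using True x log_kernel_nonneg[of x q] t0[of k] by (simp add: f_def abs_mult mult_ac)
    qed
  next
    case False
    then have a': "a = -1" using a by auto
    from Li_bounded[OF c(1) p c(2)] obtain C where C: "C \<ge> 0"
      "\<And>t. 0 \<le> t \<Longrightarrow> t < 1 \<Longrightarrow> \<bar>Li p (c * t)\<bar> \<le> C * t" by blast
    have FC: "\<bar>F (a * t k)\<bar> \<le> C" for k
    proof -
      note y = t0[of k] t(2)[of k]
      have "\<bar>Li p (c * t k ^ n)\<bar> / t k \<le> C * t k ^ n / t k"
        using power_div_le(2)[OF y] y by (intro divide_right_mono C(2)) simp_all
      then have "\<bar>F (a * t k)\<bar> \<le> C * t k ^ n / t k"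
        using y unfolding Fz by (simp add: a')
      also have "\<dots> = C * (t k ^ n / t k)" by simp
      also have "\<dots> \<le> C" using C(1) power_div_le(1)[OF y] by (rule mult_left_le[rotated])
      finally show ?thesis .
    qed
    \<comment> \<open>For a = -1 and \<open>t k\<close> at least 1/2 the nodes differ by at least
      1/2, whence the factor 2. F x may be unbounded and is kept as an integrable function; only F
      at the moving node is bounded by C.\<close>
    show ?thesis
    proof (rule that)
      show "(\<lambda>x. 2 * (log_kernel q x * (Li p (1 * x ^ n) * x ^ 0 / x) + C * log_kernel q x)) integrable_on {0..1}"
        using has_integral_log_kernel_polylog(1)[OF n p q, of 1 0] has_integral_log_kernel_power[OF q, of 0]
        by (intro integrable_on_mult_right integrable_add) (auto simp: integrable_on_def)
      fix x k assume x: "0 < (x::real)" "x < 1"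
      have xn: "\<bar>b * x ^ n\<bar> = x ^ n" "x ^ n < 1"
        using b x power_div_le(2)[OF x] by (auto simp: abs_mult)
      have "\<bar>Li p (b * x ^ n)\<bar> \<le> Li p (x ^ n)"
        using Li_abs_le[of "b * x ^ n" p] xn p by simp
      then have Fx: "\<bar>F x\<bar> \<le> Li p (x ^ n) / x"
        using x by (simp add: F_def divide_right_mono)
      have "\<bar>a * t k\<bar> * (\<bar>F x - F (a * t k)\<bar> / \<bar>x - a * t k\<bar>) \<le> 1 * ((Li p (x ^ n) / x + C) / (1 / 2))"
        using az(2)[of k] a' t(1)[of k] x Fx FC[of k]
        by (intro mult_mono frac_le) auto
      then have "log_kernel q x * (\<bar>a * t k\<bar> * (\<bar>F x - F (a * t k)\<bar> / \<bar>x - a * t k\<bar>)) \<le>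
          log_kernel q x * (1 * ((Li p (x ^ n) / x + C) / (1 / 2)))"
        using x by (intro mult_left_mono log_kernel_nonneg) auto
      then show "\<bar>f k x\<bar> \<le> 2 * (log_kernel q x * (Li p (1 * x ^ n) * x ^ 0 / x) + C * log_kernel q x)"
        using x log_kernel_nonneg[of x q] unfolding f_def abs_mult abs_divide by (simp add: algebra_simps)
    qed
  qed
  have conv: "(\<lambda>k. f k x) \<longlonglongrightarrow> g x" if "0 < x" "x < 1" for x
  proof -
    have "(\<lambda>k. log_kernel q x * (a * t k * ((F x - F (a * t k)) / (x - a * t k)))) \<longlonglongrightarrow>
        log_kernel q x * (a * 1 * ((F x - F a) / (x - a * 1)))"
      using that a by (intro tendsto_intros t(3) F_lim) auto
    then show ?thesis by (simp add: f_def g_def)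
  qed
  let ?S = "\<lambda>k. \<Sum>m. b ^ Suc m / real (Suc m) ^ p *
              (\<Sum>l<n * Suc m - 1. (a * t k) ^ Suc l / (real (n * Suc m) - real (Suc l)) ^ q)"
  have I: "(f k has_integral ?S k) {0..1}" for k
    using has_integral_polylog_quotient[OF n p q b az] unfolding f_def F_def .
  show "g integrable_on {0..1}"
    by (rule dominated_convergence_unit_interval(1)[OF I h fh conv])
  show "?S \<longlonglongrightarrow> integral {0..1} g"
    by (rule dominated_convergence_unit_interval(2)[OF I h fh conv])
qed

text \<open>With a^2 = 1 the quotient equals Li_p(a^n b) a / (1 - a x) - Li_p(b x^n) a / (1 - a x) -
  Li_p(b x^n) / x. The three integrals are a product of polylogarithm values, I itself, and the
  moment lemma at l = 0.\<close>

lemma polylog_quotient_integral: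
  assumes n: "n \<ge> 1" and p: "p \<ge> 1" and q: "q \<ge> 1" and a: "a \<in> {1, -1}" and b: "b \<in> {1, -1}"
    and a1: "a = 1 \<Longrightarrow> q \<ge> 2"
    and I: "((\<lambda>x. log_kernel q x * (Li p (b * x ^ n) * (a / (1 - a * x)))) has_integral I) {0..1}"
  defines "F \<equiv> \<lambda>y. Li p (b * y ^ n) / y"
  shows "integral {0..1} (\<lambda>x. log_kernel q x * (a * ((F x - F a) / (x - a)))) =
     Li p (a ^ n * b) * Li q a - I - Li (p + q) b / real n ^ q"
proof (rule integral_unique)
  have "((\<lambda>x. log_kernel q x * (Li p (b * x ^ n) * x ^ 0 / x)) has_integral
           (\<Sum>m. b ^ Suc m / (real (Suc m) ^ p * real (0 + n * Suc m) ^ q))) {0..1}"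
    by (rule has_integral_log_kernel_polylog(1)[OF n p q b])
  also have "(\<Sum>m. b ^ Suc m / (real (Suc m) ^ p * real (0 + n * Suc m) ^ q)) = (\<Sum>m. b ^ Suc m / real (Suc m) ^ (p + q) / real n ^ q)"
    by (simp add: power_add power_mult_distrib mult_ac of_nat_mult del: of_nat_Suc mult_Suc_right)
  also have "\<dots> = Li (p + q) b / real n ^ q"
    using summable_Li[of b "p + q"] b p q
    by (simp only: Li_def) (rule suminf_divide, auto)
  finally have 1: "((\<lambda>x. log_kernel q x * (Li p (b * x ^ n) * x ^ 0 / x)) has_integral
     Li (p + q) b / real n ^ q) {0..1}" .
  have 2: "((\<lambda>x. log_kernel q x * (a / (1 - a * x))) has_integral Li q a) {0..1}"
    using a q a1 by (intro has_integral_log_kernel_geometric) auto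
  have A: "((\<lambda>x. Li p (a ^ n * b) * (log_kernel q x * (a / (1 - a * x)))
      - log_kernel q x * (Li p (b * x ^ n) * (a / (1 - a * x)))
      - log_kernel q x * (Li p (b * x ^ n) * x ^ 0 / x)) has_integral
     Li p (a ^ n * b) * Li q a - I - Li (p + q) b / real n ^ q) {0..1}"
    by (intro has_integral_diff has_integral_mult_right 1 2 I)
  have B: "log_kernel q x * (a * ((F x - F a) / (x - a))) =
      Li p (a ^ n * b) * (log_kernel q x * (a / (1 - a * x)))
      - log_kernel q x * (Li p (b * x ^ n) * (a / (1 - a * x)))
      - log_kernel q x * (Li p (b * x ^ n) * x ^ 0 / x)" if x: "x \<in> {0..1} - {0, 1}" for x
  proof -
    have "F a = a * Li p (a ^ n * b)" using a by (auto simp: F_def mult_ac)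
    moreover have "F x = Li p (b * x ^ n) / x" by (simp add: F_def)
    moreover have "a * ((u / x - a * v) / (x - a)) = v * (a / (1 - a * x)) - u * (a / (1 - a * x)) - u / x" for u v
    proof -
      have "x - 1 \<noteq> 0" "x + 1 \<noteq> 0" "1 - x \<noteq> 0" "1 + x \<noteq> 0" "x \<noteq> 0" using x by auto
      then show ?thesis using a by (elim insertE) (auto simp: divide_simps, auto simp: algebra_simps)
    qed
    ultimately have eq: "a * ((F x - F a) / (x - a)) = Li p (a ^ n * b) * (a / (1 - a * x))
        - Li p (b * x ^ n) * (a / (1 - a * x)) - Li p (b * x ^ n) / x"
      by (simp only:)
    show ?thesis
      by (simp only: eq power_0 mult_1_right) (simp only: right_diff_distrib mult.left_commute)
  qed
  show "((\<lambda>x. log_kernel q x * (a * ((F x - F a) / (x - a)))) has_integral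
     Li p (a ^ n * b) * Li q a - I - Li (p + q) b / real n ^ q) {0..1}"
    by (rule has_integral_spike_finite[OF _ B A]) (rule finite.intros | assumption)+
qed

text \<open>The diagonal terms \<open>l = n m\<close> drop out of the series because \<open>1 / 0 = 0\<close>.\<close>

lemma double_series_split:
  assumes n: "n \<ge> 1" and p: "p \<ge> 1" and q: "q \<ge> 1" and b: "b \<in> {1, -1}" and z: "\<bar>z\<bar> < 1"
  shows "(\<lambda>l. z ^ Suc l * (\<Sum>m. b ^ Suc m * ((-1) ^ p / (real (Suc m) ^ p * real (Suc l + n * Suc m) ^ q)
              + 1 / (real (Suc m) ^ p * (real (Suc l) - real (n * Suc m)) ^ q)))) sums
     ((-1) ^ p * (\<Sum>l. z ^ Suc l * (\<Sum>m. b ^ Suc m / (real (Suc m) ^ p * real (Suc l + n * Suc m) ^ q)))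
      + (Li p (b * z ^ n) * Li q z
      + (-1) ^ q * (\<Sum>m. b ^ Suc m / real (Suc m) ^ p *
              (\<Sum>l<n * Suc m - 1. z ^ Suc l / (real (n * Suc m) - real (Suc l)) ^ q))))"
proof -
  \<comment> \<open>\<open>u\<close> belongs to the negative indices -(m + 1), with the sign (-1)^p
    taken out, and \<open>w\<close> to the positive ones.\<close>
  define u where "u l m = z ^ Suc l * (b ^ Suc m / (real (Suc m) ^ p * real (Suc l + n * Suc m) ^ q))" for l m
  define w where "w l m = z ^ Suc l * (b ^ Suc m / (real (Suc m) ^ p * (real (Suc l) - real (n * Suc m)) ^ q))" for l m
  have b1: "\<bar>b ^ Suc m\<bar> = 1" for m using b by (auto simp: power_abs)
  have b2: "\<bar>b\<bar> ^ j = 1" for j using b by auto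
  have ule: "\<bar>u l m\<bar> \<le> \<bar>z\<bar> ^ Suc l * (1 / real (Suc m) ^ 2)" for l m
  proof -
    have "\<bar>z\<bar> ^ Suc l * (1 / (real (Suc m) ^ p * real (Suc l + n * Suc m) ^ q)) \<le> \<bar>z\<bar> ^ Suc l * (1 / real (Suc m) ^ 2)"
      by (intro mult_left_mono upper_term_bound p q n) auto
    moreover have "\<bar>u l m\<bar> = \<bar>z\<bar> ^ Suc l * (1 / (real (Suc m) ^ p * real (Suc l + n * Suc m) ^ q))"
      unfolding u_def abs_mult abs_divide b1 by (simp add: power_abs abs_mult)
    ultimately show ?thesis by simp
  qed
  have wle: "\<bar>w l m\<bar> \<le> (2 * real (Suc l) * \<bar>z\<bar> ^ Suc l) * (1 / real (Suc m) ^ 2)" for l m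
  proof -
    have "\<bar>z\<bar> ^ Suc l * (1 / (real (Suc m) ^ p * \<bar>real (Suc l) - real (n * Suc m)\<bar> ^ q)) \<le>
        \<bar>z\<bar> ^ Suc l * (2 * real (Suc l) / real (Suc m) ^ 2)"
      by (intro mult_left_mono lower_term_bound n p q) auto
    moreover have "\<bar>w l m\<bar> = \<bar>z\<bar> ^ Suc l * (1 / (real (Suc m) ^ p * \<bar>real (Suc l) - real (n * Suc m)\<bar> ^ q))"
      unfolding w_def abs_mult abs_divide b1 by (simp add: power_abs abs_mult)
    ultimately show ?thesis by (simp del: of_nat_Suc power_Suc mult_Suc_right add: mult_ac)
  qed
  have sz: "summable (\<lambda>l. \<bar>z\<bar> ^ Suc l)"
    using z by (simp add: summable_mult summable_geometric)
  note U = suminf_swap[OF ule sz summable_inverse_squares]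
  note W = suminf_swap[OF wle summable_Suc_power[OF z] summable_inverse_squares]
  have smu: "summable (\<lambda>m. b ^ Suc m / (real (Suc m) ^ p * real (Suc l + n * Suc m) ^ q))" for l
    by (rule summable_rabs_cancel, rule summable_comparison_test_ev[OF _ has_integral_log_kernel_polylog(2)[OF n p q b, of "Suc l"]])
       (use b1 in \<open>auto simp: abs_divide simp del: of_nat_Suc power_Suc mult_Suc_right\<close>)
  have smw: "summable (\<lambda>m. b ^ Suc m / (real (Suc m) ^ p * (real (Suc l) - real (n * Suc m)) ^ q))" for l
  proof (rule summable_comparison_test_ev)
    show "summable (\<lambda>m. 2 * real (Suc l) * (1 / real (Suc m) ^ 2))"
      by (intro summable_mult summable_inverse_squares)
    show "\<forall>\<^sub>F m in sequentially. norm (b ^ Suc m / (real (Suc m) ^ p * (real (Suc l) - real (n * Suc m)) ^ q))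
        \<le> 2 * real (Suc l) * (1 / real (Suc m) ^ 2)"
      using lower_term_bound[OF p q n, of _ l]
      by (intro always_eventually allI)
         (simp add: abs_divide abs_mult b2 power_abs del: of_nat_Suc power_Suc mult_Suc_right of_nat_mult)
  qed
  have E: "z ^ Suc l * (\<Sum>m. b ^ Suc m * ((-1) ^ p / (real (Suc m) ^ p * real (Suc l + n * Suc m) ^ q)
              + 1 / (real (Suc m) ^ p * (real (Suc l) - real (n * Suc m)) ^ q)))
       = (-1) ^ p * (\<Sum>m. u l m) + (\<Sum>m. w l m)" for l
  proof -
    let ?x = "\<lambda>m. b ^ Suc m / (real (Suc m) ^ p * real (Suc l + n * Suc m) ^ q)"
    let ?y = "\<lambda>m. b ^ Suc m / (real (Suc m) ^ p * (real (Suc l) - real (n * Suc m)) ^ q)"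
    have x: "(\<lambda>m. b ^ Suc m * ((-1) ^ p / (real (Suc m) ^ p * real (Suc l + n * Suc m) ^ q)
              + 1 / (real (Suc m) ^ p * (real (Suc l) - real (n * Suc m)) ^ q))) = (\<lambda>m. (-1) ^ p * ?x m + ?y m)"
      by (simp only: fun_eq_iff distrib_left times_divide_eq_right mult.commute mult_1_right) simp
    have y: "(\<Sum>m. (-1) ^ p * ?x m + ?y m) = (-1) ^ p * suminf ?x + suminf ?y"
      using suminf_add[OF summable_mult[OF smu] smw, of "(-1) ^ p" l l] suminf_mult[OF smu, of "(-1) ^ p" l]
      by (simp only:)
    show ?thesis
      unfolding x y u_def w_def suminf_mult[OF smu] suminf_mult[OF smw]
      by (simp only: distrib_left mult.left_commute)
  qed
  have F: "(\<Sum>m. u l m) = z ^ Suc l * (\<Sum>m. b ^ Suc m / (real (Suc m) ^ p * real (Suc l + n * Suc m) ^ q))" for l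
    unfolding u_def by (rule suminf_mult[OF smu])
  define N where "N m = n * Suc m" for m
  have N1: "N m \<ge> 1" for m using n by (simp add: N_def)
  \<comment> \<open>For fixed m the sum is cut at l + 1 = \<open>N m\<close>. Beyond the cut,
    shifting l separates the variables and leaves Li_q(z); at the cut the term is 0; below it,
    turning the difference around costs (-1)^q.\<close>
  have row: "(\<Sum>l. w l m) = (b * z ^ n) ^ Suc m / real (Suc m) ^ p * Li q z
      + (-1) ^ q * (b ^ Suc m / real (Suc m) ^ p * (\<Sum>l<N m - 1. z ^ Suc l / (real (N m) - real (Suc l)) ^ q))" for m
  proof -
    let ?c = "b ^ Suc m / real (Suc m) ^ p"
    have w_eq: "w l m = ?c * (z ^ Suc l / (real (Suc l) - real (N m)) ^ q)" for l
      by (simp add: w_def N_def del: of_nat_Suc power_Suc mult_Suc_right of_nat_mult)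
    have sw: "summable (\<lambda>l. w l m)" using W(5) by simp
    have "(\<Sum>l. w l m) = (\<Sum>l. w (l + N m) m) + (\<Sum>l<N m. w l m)"
      by (rule suminf_split_initial_segment[OF sw])
    also have "(\<lambda>l. w (l + N m) m) = (\<lambda>l. (?c * z ^ N m) * (z ^ Suc l / real (Suc l) ^ q))"
      unfolding w_eq by (simp add: fun_eq_iff power_add)
    also have "suminf \<dots> = (?c * z ^ N m) * Li q z"
      unfolding Li_def using z q by (intro suminf_mult summable_Li) auto
    also have "?c * z ^ N m = (b * z ^ n) ^ Suc m / real (Suc m) ^ p"
      by (simp only: N_def power_mult power_mult_distrib times_divide_eq_left)
    also have "(\<Sum>l<N m. w l m) = (\<Sum>l<Suc (N m - 1). w l m)"
      using N1[of m] by simp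
    also have "\<dots> = (\<Sum>l<N m - 1. w l m)"
    proof -
      have "w (N m - 1) m = 0"
        using N1[of m] q by (cases "N m") (simp_all add: w_eq power_0_left)
      then show ?thesis by simp
    qed
    also have "\<dots> = (-1) ^ q * (?c * (\<Sum>l<N m - 1. z ^ Suc l / (real (N m) - real (Suc l)) ^ q))"
    proof -
      have "w l m = (-1) ^ q * (?c * (z ^ Suc l / (real (N m) - real (Suc l)) ^ q))" for l
      proof -
        have "(real (Suc l) - real (N m)) ^ q = (-1) ^ q * (real (N m) - real (Suc l)) ^ q"
          using power_mult_distrib[of "-1" "real (N m) - real (Suc l)" q] by simp
        then show ?thesis unfolding w_eq by (cases "even q") (simp_all del: of_nat_Suc power_Suc)
      qed
      then show ?thesis by (simp only: sum_distrib_left)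
    qed
    finally show ?thesis .
  qed
  have sumN: "(\<Sum>m. \<Sum>l. w l m) = Li p (b * z ^ n) * Li q z
      + (-1) ^ q * (\<Sum>m. b ^ Suc m / real (Suc m) ^ p * (\<Sum>l<N m - 1. z ^ Suc l / (real (N m) - real (Suc l)) ^ q))"
  proof -
    let ?g = "\<lambda>m. (b * z ^ n) ^ Suc m / real (Suc m) ^ p * Li q z"
    let ?h = "\<lambda>m. b ^ Suc m / real (Suc m) ^ p * (\<Sum>l<N m - 1. z ^ Suc l / (real (N m) - real (Suc l)) ^ q)"
    have "\<bar>z ^ n\<bar> < 1"
      using z n power_Suc_less_one[of "\<bar>z\<bar>" "n - 1"] by (cases "z = 0") (auto simp: power_abs power_0_left)
    then have "\<bar>b * z ^ n\<bar> < 1" using b by (auto simp: abs_mult)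
    then have s: "summable (\<lambda>m. (b * z ^ n) ^ Suc m / real (Suc m) ^ p)"
      using p by (intro summable_Li) auto
    have g: "summable ?g" using s by (rule summable_mult2)
    \<comment> \<open>The lower part needs no estimate of its own: it is what remains of a summable
      series after a summable one is removed.\<close>
    have "summable (\<lambda>m. (\<Sum>l. w l m) - ?g m)"
      using W(2) g by (intro summable_diff) auto
    then have "summable (\<lambda>m. (-1) ^ q * ?h m)" unfolding row by simp
    then have h: "summable ?h" by (subst (asm) summable_cmult_iff) auto
    have "(\<Sum>m. \<Sum>l. w l m) = suminf ?g + (\<Sum>m. (-1) ^ q * ?h m)"
      unfolding row using g \<open>summable (\<lambda>m. (-1) ^ q * ?h m)\<close> by (rule suminf_add [symmetric])
    also have "suminf ?g = Li p (b * z ^ n) * Li q z"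
      unfolding Li_def [of p] by (rule suminf_mult2 [symmetric, OF s])
    also have "(\<Sum>m. (-1) ^ q * ?h m) = (-1) ^ q * suminf ?h" by (rule suminf_mult[OF h])
    finally show ?thesis .
  qed
  have "(\<lambda>l. (-1) ^ p * (\<Sum>m. u l m) + (\<Sum>m. w l m)) sums ((-1) ^ p * (\<Sum>l. \<Sum>m. u l m) + (\<Sum>l. \<Sum>m. w l m))"
    using U(3) W(3) by (intro sums_add sums_mult summable_sums) auto
  also have "(\<Sum>l. \<Sum>m. w l m) = (\<Sum>m. \<Sum>l. w l m)" using W(1) by simp
  finally show ?thesis unfolding E [symmetric] sumN unfolding F N_def .
qed

text \<open>The integral side of the parity argument: I enters once from the negative indices with
  sign (-1)^p and once from below the diagonal with sign -(-1)^q.\<close>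

lemma double_series_limit:
  fixes t :: "nat \<Rightarrow> real"
  assumes n: "n \<ge> 1" and p: "p \<ge> 1" and q: "q \<ge> 1" and a: "a \<in> {1, -1}" and b: "b \<in> {1, -1}"
    and a1: "a = 1 \<Longrightarrow> q \<ge> 2" and ab: "a ^ n * b = 1 \<Longrightarrow> p \<ge> 2"
    and t: "\<And>k. 1 / 2 \<le> t k" "\<And>k. t k < 1" "t \<longlonglongrightarrow> 1"
  defines "I \<equiv> integral {0..1} (\<lambda>x. log_kernel q x * (Li p (b * x ^ n) * (a / (1 - a * x))))"
  shows "(\<lambda>k. \<Sum>l. (a * t k) ^ Suc l * (\<Sum>m. b ^ Suc m * ((-1) ^ p / (real (Suc m) ^ p * real (Suc l + n * Suc m) ^ q)
              + 1 / (real (Suc m) ^ p * (real (Suc l) - real (n * Suc m)) ^ q))))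
     \<longlonglongrightarrow> (-1) ^ p * I + (Li p (a ^ n * b) * Li q a
          + (-1) ^ q * (Li p (a ^ n * b) * Li q a - I - Li (p + q) b / real n ^ q))"
    and "((\<lambda>x. log_kernel q x * (Li p (b * x ^ n) * (a / (1 - a * x)))) has_integral I) {0..1}"
proof -
  have t0: "0 < t k" for k using t(1)[of k] by linarith
  have az: "\<bar>a * t k\<bar> < 1" for k using a t0[of k] t(2)[of k] by (auto simp: abs_mult)
  note S = sums_unique[OF double_series_split[OF n p q b az], symmetric]
  note G = polylog_geometric_limit[OF n p q a b a1 ab t0 t(2,3)]
  show hI: "((\<lambda>x. log_kernel q x * (Li p (b * x ^ n) * (a / (1 - a * x)))) has_integral I) {0..1}"
    unfolding I_def by (rule integrable_integral[OF G(1)])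
  define c where "c = a ^ n * b"
  have c: "c \<in> {1, -1}" "c = 1 \<Longrightarrow> p \<ge> 2"
    using a b ab by (auto simp: c_def minus_one_power_iff split: if_splits)
  have t_left: "filterlim t (at_left 1) sequentially"
    using t(2,3) by (auto simp: filterlim_at less_imp_neq)
  have P: "((\<lambda>k. Li p (c * t k ^ n)) \<longlongrightarrow> Li p c) sequentially"
    by (rule filterlim_compose[OF Li_tendsto[OF c(1) p c(2)]
          filterlim_compose[OF filterlim_power_at_left_1[OF n] t_left]])
  have Q: "((\<lambda>k. Li q (a * t k)) \<longlongrightarrow> Li q a) sequentially"
    by (rule filterlim_compose[OF Li_tendsto[OF a q a1] t_left])
  have G2: "(\<lambda>k. \<Sum>l. (a * t k) ^ Suc l * (\<Sum>m. b ^ Suc m / (real (Suc m) ^ p * real (Suc l + n * Suc m) ^ q)))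
      \<longlonglongrightarrow> I"
    unfolding I_def using G(2) by blast
  have eq: "integral {0..1} (\<lambda>x. log_kernel q x * (a * ((Li p (b * x ^ n) / x - Li p (b * a ^ n) / a) / (x - a))))
      = Li p (a ^ n * b) * Li q a - I - Li (p + q) b / real n ^ q"
    using polylog_quotient_integral[OF n p q a b a1 hI] by blast
  have H: "(\<lambda>k. \<Sum>m. b ^ Suc m / real (Suc m) ^ p *
              (\<Sum>l<n * Suc m - 1. (a * t k) ^ Suc l / (real (n * Suc m) - real (Suc l)) ^ q))
      \<longlonglongrightarrow> Li p c * Li q a - I - Li (p + q) b / real n ^ q"
    using polylog_quotient_limit(2)[OF n p q a b a1 ab t]
    unfolding eq c_def by blast
  have cz: "b * (a * t k) ^ n = c * t k ^ n" for k by (simp add: c_def power_mult_distrib mult_ac)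
  show "(\<lambda>k. \<Sum>l. (a * t k) ^ Suc l * (\<Sum>m. b ^ Suc m * ((-1) ^ p / (real (Suc m) ^ p * real (Suc l + n * Suc m) ^ q)
              + 1 / (real (Suc m) ^ p * (real (Suc l) - real (n * Suc m)) ^ q))))
     \<longlonglongrightarrow> (-1) ^ p * I + (Li p (a ^ n * b) * Li q a
          + (-1) ^ q * (Li p (a ^ n * b) * Li q a - I - Li (p + q) b / real n ^ q))"
    unfolding S cz c_def [symmetric] by (intro tendsto_intros P Q G2 H)
qed

section \<open>Partial fractions and bilateral sums\<close>

text \<open>To be read with u = 1 / m, v = 1 / (m - \<alpha>), c = 1 / \<alpha>. Only the relation
  between them matters, so no division is involved; each further factor v is absorbed by applying
  that relation once.\<close>

lemma partial_fractions_simple: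
  fixes u v c :: "'a :: comm_ring_1"
  assumes uv: "u * v = c * (v - u)"
  shows "u * v ^ Suc Q = (-1) ^ Suc Q * c ^ Suc Q * u + (\<Sum>k\<le>Q. (-1) ^ (Q - k) * c ^ (Suc Q - k) * v ^ Suc k)"
proof (induction Q)
  case 0
  then show ?case using uv by (simp add: algebra_simps)
next
  case (Suc Q)
  have "u * v ^ Suc (Suc Q) = (u * v ^ Suc Q) * v" by (simp add: mult_ac)
  also have "\<dots> = (-1) ^ Suc Q * c ^ Suc Q * (u * v)
      + (\<Sum>k\<le>Q. (-1) ^ (Q - k) * c ^ (Suc Q - k) * v ^ Suc (Suc k))"
    unfolding Suc.IH distrib_right sum_distrib_right
    by (simp only: mult.assoc power_Suc2[of v])
  also have "(-1) ^ Suc Q * c ^ Suc Q * (u * v) = (-1) ^ Suc (Suc Q) * c ^ Suc (Suc Q) * u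
      + (-1) ^ Suc Q * c ^ Suc (Suc Q) * v"
    unfolding uv by (simp add: algebra_simps)
  also have "\<dots> + (\<Sum>k\<le>Q. (-1) ^ (Q - k) * c ^ (Suc Q - k) * v ^ Suc (Suc k)) =
      (-1) ^ Suc (Suc Q) * c ^ Suc (Suc Q) * u + (\<Sum>k\<le>Suc Q. (-1) ^ (Suc Q - k) * c ^ (Suc (Suc Q) - k) * v ^ Suc k)"
    unfolding sum.atMost_Suc_shift by simp
  finally show ?case .
qed

text \<open>Induction on the total degree: replacing one u v by c (v - u) lowers it by one, and the
  coefficients combine by Pascal's rule.\<close>

lemma partial_fractions:
  fixes u v c :: "'a :: comm_ring_1"
  assumes uv: "u * v = c * (v - u)"
  shows "u ^ Suc P * v ^ Suc Q =
     (-1) ^ Suc Q * (\<Sum>i\<le>P. of_nat ((P + Q - i) choose Q) * c ^ (Suc (P + Q) - i) * u ^ Suc i)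
     + (\<Sum>k\<le>Q. (-1) ^ (Q - k) * of_nat ((P + Q - k) choose P) * c ^ (Suc (P + Q) - k) * v ^ Suc k)"
proof (induction "P + Q" arbitrary: P Q)
  case 0
  then show ?case using partial_fractions_simple[OF uv, of 0] by simp
next
  case (Suc N)
  consider "P = 0" | "Q = 0" | P' Q' where "P = Suc P'" "Q = Suc Q'" by (metis not0_implies_Suc)
  then show ?case
  proof cases
    case 1
    then show ?thesis using partial_fractions_simple[OF uv, of Q] by (simp add: mult_ac)
  next
    case 2
    \<comment> \<open>Exchanging u and v keeps the relation with c negated, which reduces this case
      to the simple lemma.\<close>
    have vu: "v * u = (-c) * (u - v)" using uv by (simp add: algebra_simps)
    have "v * u ^ Suc P = c ^ Suc P * v - (\<Sum>k\<le>P. c ^ (Suc P - k) * u ^ Suc k)"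
    proof -
      have "(-1) ^ Suc P * (-c) ^ Suc P = c ^ Suc P"
        by (simp only: flip: power_mult_distrib) simp
      moreover have "(-1) ^ (P - k) * (-c) ^ (Suc P - k) = - (c ^ (Suc P - k))" if "k \<le> P" for k
      proof -
        have "(-1) ^ (P - k) * (-c) ^ (Suc P - k) = - ((-1) ^ (Suc P - k) * (-c) ^ (Suc P - k))"
          using that by (simp add: Suc_diff_le)
        also have "(-1) ^ (Suc P - k) * (-c) ^ (Suc P - k) = c ^ (Suc P - k)"
          by (simp only: flip: power_mult_distrib) simp
        finally show ?thesis .
      qed
      ultimately show ?thesis
        unfolding partial_fractions_simple[OF vu, of P] by (simp add: sum_negf)
    qed
    then show ?thesis using 2 by (simp add: mult_ac)
  next
    case (3 P' Q')
    let ?A = "\<lambda>P Q. (\<Sum>i\<le>P. of_nat ((P + Q - i) choose Q) * c ^ (Suc (P + Q) - i) * u ^ Suc i)"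
    let ?B = "\<lambda>P Q. (\<Sum>k\<le>Q. (-1) ^ (Q - k) * of_nat ((P + Q - k) choose P) * c ^ (Suc (P + Q) - k) * v ^ Suc k)"
    have IH1: "u ^ Suc P' * v ^ Suc Q = (-1) ^ Suc Q * ?A P' Q + ?B P' Q"
      by (rule Suc.hyps(1)) (use Suc.hyps(2) 3 in auto)
    have IH2: "u ^ Suc P * v ^ Suc Q' = (-1) ^ Suc Q' * ?A P Q' + ?B P Q'"
      by (rule Suc.hyps(1)) (use Suc.hyps(2) 3 in auto)
    have "u ^ Suc P * v ^ Suc Q = u ^ P * v ^ Q * (u * v)" by (simp add: mult_ac)
    also have "\<dots> = c * (u ^ Suc P' * v ^ Suc Q) - c * (u ^ Suc P * v ^ Suc Q')"
      unfolding uv 3 by (simp add: algebra_simps)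
    also have "\<dots> = (-1) ^ Suc Q * (c * ?A P' Q + c * ?A P Q') + (c * ?B P' Q - c * ?B P Q')"
    proof -
      have gen: "c * (s * A1 + B1) - c * (- s * A2 + B2) = s * (c * A1 + c * A2) + (c * B1 - c * B2)"
        for s A1 A2 B1 B2 by (simp add: algebra_simps)
      have "(-1) ^ Suc Q' = - ((-1) ^ Suc Q :: 'a)" using 3 by simp
      then show ?thesis unfolding IH1 IH2 by (simp only: gen)
    qed
    also have "c * ?A P' Q + c * ?A P Q' = ?A P Q"
    proof -
      have "c * ?A P' Q = (\<Sum>i\<le>P. of_nat ((P' + Q - i) choose Q) * c ^ (Suc (P + Q) - i) * u ^ Suc i)"
      proof -
        have "c * ?A P' Q = (\<Sum>i\<le>P'. of_nat ((P' + Q - i) choose Q) * c ^ (Suc (P + Q) - i) * u ^ Suc i)"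
          unfolding sum_distrib_left 3
          by (intro sum.cong refl) (simp add: Suc_diff_le mult_ac)
        also have "\<dots> = (\<Sum>i\<le>P. of_nat ((P' + Q - i) choose Q) * c ^ (Suc (P + Q) - i) * u ^ Suc i)"
          unfolding 3 by (simp add: binomial_eq_0)
        finally show ?thesis .
      qed
      moreover have "c * ?A P Q' = (\<Sum>i\<le>P. of_nat ((P' + Q - i) choose Q') * c ^ (Suc (P + Q) - i) * u ^ Suc i)"
        unfolding sum_distrib_left 3
        by (intro sum.cong refl) (simp add: Suc_diff_le mult_ac)
      moreover have "(P + Q - i) choose Q = ((P' + Q - i) choose Q) + ((P' + Q - i) choose Q')" if "i \<le> P" for i
        using that 3 by (simp add: Suc_diff_le)
      ultimately show ?thesis
        by (simp add: sum.distrib [symmetric] distrib_right)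
    qed
    also have "c * ?B P' Q - c * ?B P Q' = ?B P Q"
    proof -
      have "c * ?B P Q' = (\<Sum>k\<le>Q. - ((-1) ^ (Q - k) * of_nat ((P + Q' - k) choose P) * c ^ (Suc (P + Q) - k) * v ^ Suc k))"
      proof -
        have "c * ?B P Q' = (\<Sum>k\<le>Q'. - ((-1) ^ (Q - k) * of_nat ((P + Q' - k) choose P) * c ^ (Suc (P + Q) - k) * v ^ Suc k))"
          unfolding sum_distrib_left 3
          by (intro sum.cong refl) (simp add: Suc_diff_le mult_ac)
        also have "\<dots> = (\<Sum>k\<le>Q. - ((-1) ^ (Q - k) * of_nat ((P + Q' - k) choose P) * c ^ (Suc (P + Q) - k) * v ^ Suc k))"
          unfolding 3 by (simp add: binomial_eq_0)
        finally show ?thesis .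
      qed
      moreover have "c * ?B P' Q = (\<Sum>k\<le>Q. (-1) ^ (Q - k) * of_nat ((P + Q' - k) choose P') * c ^ (Suc (P + Q) - k) * v ^ Suc k)"
        unfolding sum_distrib_left 3
        by (intro sum.cong refl) (simp add: Suc_diff_le mult_ac)
      moreover have "(P + Q - k) choose P = ((P + Q' - k) choose P) + ((P + Q' - k) choose P')" if "k \<le> Q" for k
        using that 3 by (simp add: Suc_diff_le)
      ultimately show ?thesis
        by (simp add: sum.distrib [symmetric] sum_negf distrib_right distrib_left add.commute)
    qed
    finally show ?thesis .
  qed
qed

text \<open>If \<open>\<alpha>\<close> is an integer, its own term drops out of the sum because \<open>1 / 0 = 0\<close>.\<close>

definition bilateral_sum :: "real \<Rightarrow> nat \<Rightarrow> real \<Rightarrow> nat \<Rightarrow> real" where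
  "bilateral_sum b k \<alpha> M = 1 / (- \<alpha>) ^ k +
     (\<Sum>j<M. b ^ Suc j * (1 / (real (Suc j) - \<alpha>) ^ k + 1 / (- real (Suc j) - \<alpha>) ^ k))"

section \<open>Symmetric bilateral sums: shifts and limits\<close>

text \<open>Moving \<alpha> by 1 moves the window -M..M by one place: the term at -(M + 1) enters,
  the term at M leaves, and b^m picks up one factor b. For k >= 1 both boundary terms vanish in the
  limit.\<close>

lemma bilateral_sum_shift:
  assumes b: "b \<in> {1, -1}"
  shows "bilateral_sum b k (\<alpha> + 1) M =
     b * (bilateral_sum b k \<alpha> M + b ^ Suc M / (- real (Suc M) - \<alpha>) ^ k - b ^ M / (real M - \<alpha>) ^ k)"
proof (induction M)
  case 0
  have "b * b = 1" using b by auto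
  then show ?case by (simp add: bilateral_sum_def algebra_simps)
next
  case (Suc M)
  have b2: "b * (b * x) = x" for x using b by auto
  have eq: "real (Suc M) - (\<alpha> + 1) = real M - \<alpha>" "- real (Suc M) - (\<alpha> + 1) = - real (Suc (Suc M)) - \<alpha>" by auto
  have step: "bilateral_sum b k \<alpha> (Suc M) = bilateral_sum b k \<alpha> M +
     b ^ Suc M * (1 / (real (Suc M) - \<alpha>) ^ k + 1 / (- real (Suc M) - \<alpha>) ^ k)" for \<alpha>
    by (simp add: bilateral_sum_def)
  show ?case
    unfolding step[of "\<alpha> + 1"] Suc.IH eq unfolding step[of \<alpha>]
    by (simp add: distrib_left right_diff_distrib b2 del: of_nat_Suc)
qed

lemma bilateral_sum_tendsto_shift:
  assumes b: "b \<in> {1, -1}" and k: "k \<ge> 1" and T: "bilateral_sum b k \<alpha> \<longlonglongrightarrow> T"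
  shows "bilateral_sum b k (\<alpha> + 1) \<longlonglongrightarrow> b * T"
proof -
  have lim: "(\<lambda>M. b ^ f M * (1 / g M) ^ k) \<longlonglongrightarrow> 0"
    if "filterlim g at_infinity sequentially" for f :: "nat \<Rightarrow> nat" and g :: "nat \<Rightarrow> real"
  proof (rule tendsto_0_le[where K = 1])
    have "(\<lambda>M. (1 / g M) ^ k) \<longlonglongrightarrow> 0 ^ k"
      by (intro tendsto_intros tendsto_divide_0[OF tendsto_const that])
    then show "(\<lambda>M. (1 / g M) ^ k) \<longlonglongrightarrow> 0" using k by (simp add: power_0_left)
    show "\<forall>\<^sub>F M in sequentially. norm (b ^ f M * (1 / g M) ^ k) \<le> norm ((1 / g M) ^ k) * 1"
    proof (intro always_eventually allI)
      fix M
      have "\<bar>b\<bar> ^ f M = 1" using b by auto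
      then show "norm (b ^ f M * (1 / g M) ^ k) \<le> norm ((1 / g M) ^ k) * 1"
        by (simp add: abs_mult power_abs)
    qed
  qed
  have "(\<lambda>M. b ^ Suc M / (- real (Suc M) - \<alpha>) ^ k) \<longlonglongrightarrow> 0"
  proof -
    have "filterlim (\<lambda>M. - real (Suc M) - \<alpha>) at_bot sequentially" by real_asymp
    from lim[OF filterlim_mono[OF this at_bot_le_at_infinity order_refl], of Suc] show ?thesis
      by (simp add: power_one_over divide_inverse power_inverse)
  qed
  moreover have "(\<lambda>M. b ^ M / (real M - \<alpha>) ^ k) \<longlonglongrightarrow> 0"
  proof -
    have "filterlim (\<lambda>M. real M - \<alpha>) at_top sequentially" by real_asymp
    from lim[OF filterlim_mono[OF this at_top_le_at_infinity order_refl], of "\<lambda>M. M"] show ?thesis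
      by (simp add: power_one_over divide_inverse power_inverse)
  qed
  ultimately have "(\<lambda>M. b * (bilateral_sum b k \<alpha> M + b ^ Suc M / (- real (Suc M) - \<alpha>) ^ k
      - b ^ M / (real M - \<alpha>) ^ k)) \<longlonglongrightarrow> b * (T + 0 - 0)"
    by (intro tendsto_intros T)
  then show ?thesis unfolding bilateral_sum_shift[OF b, symmetric] by simp
qed

lemma bilateral_sum_tendsto_shift_nat:
  assumes b: "b \<in> {1, -1}" and k: "k \<ge> 1" and T: "bilateral_sum b k \<alpha> \<longlonglongrightarrow> T"
  shows "bilateral_sum b k (real i + \<alpha>) \<longlonglongrightarrow> b ^ i * T"
proof (induction i)
  case (Suc i)
  from bilateral_sum_tendsto_shift[OF b k this] show ?case by (simp add: add_ac mult_ac)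
qed (use T in simp)

lemma bilateral_sum_0:
  assumes b: "b \<in> {1, -1}" and k: "k \<ge> 1"
  shows "(\<lambda>j. b ^ Suc j * (1 / real (Suc j) ^ k + 1 / (- real (Suc j)) ^ k)) sums ((1 + (-1) ^ k) * Li k b)"
    and "bilateral_sum b k 0 \<longlonglongrightarrow> (1 + (-1) ^ k) * Li k b"
proof -
  have eq: "b ^ Suc j * (1 / real (Suc j) ^ k + 1 / (- real (Suc j)) ^ k) = (1 + (-1) ^ k) * (b ^ Suc j / real (Suc j) ^ k)" for j
    unfolding power_minus[of "real (Suc j)"] by (cases "even k") (simp_all del: of_nat_Suc power_Suc)
  show *: "(\<lambda>j. b ^ Suc j * (1 / real (Suc j) ^ k + 1 / (- real (Suc j)) ^ k)) sums ((1 + (-1) ^ k) * Li k b)"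
  \<comment> \<open>For k = 1 the series \<open>Li 1 b\<close> may diverge, but its coefficient 1 +
    (-1)^k is 0 and so are all summands.\<close>
  proof (cases "k = 1")
    case False
    then have "summable (\<lambda>j. b ^ Suc j / real (Suc j) ^ k)"
      using k b by (intro summable_Li) auto
    then show ?thesis unfolding eq Li_def by (intro sums_mult summable_sums)
  next
    case True
    then show ?thesis unfolding eq by simp
  qed
  have "bilateral_sum b k 0 = (\<lambda>M. \<Sum>j<M. b ^ Suc j * (1 / real (Suc j) ^ k + 1 / (- real (Suc j)) ^ k))"
    using k by (auto simp: fun_eq_iff bilateral_sum_def power_0_left)
  with * show "bilateral_sum b k 0 \<longlonglongrightarrow> (1 + (-1) ^ k) * Li k b"
    unfolding sums_def by simp
qed

text \<open>Logarithmic derivative of the reflection formula Gamma(x) Gamma(1 - x) = pi / sin(pi x),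
  taken from its complex version.\<close>

lemma Digamma_reflection:
  assumes x: "0 < x" "x < (1::real)"
  shows "Digamma (1 - x) - Digamma x = pi * cot (pi * x)"
proof -
  have refl: "ln_Gamma y + ln_Gamma (1 - y) = ln pi - ln (sin (pi * y))" if y: "0 < y" "y < 1" for y :: real
  proof -
    have s: "sin (pi * y) > 0" using y by (intro sin_gt_zero) auto
    have "complex_of_real (Gamma y * Gamma (1 - y)) = complex_of_real (pi / sin (pi * y))"
    proof -
      have "Gamma (1 - complex_of_real y) = of_real (Gamma (1 - y))"
        using Gamma_complex_of_real[of "1 - y"] by simp
      moreover have "sin (of_real pi * complex_of_real y) = of_real (sin (pi * y))"
        using sin_of_real[of "pi * y", where 'a = complex] by simp
      ultimately show ?thesis
        using Gamma_reflection_complex[of "of_real y"] Gamma_complex_of_real[of y] by simp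
    qed
    then have "Gamma y * Gamma (1 - y) = pi / sin (pi * y)" by (simp only: of_real_eq_iff)
    then have "ln (Gamma y * Gamma (1 - y)) = ln (pi / sin (pi * y))" by simp
    moreover have "Gamma y > 0" "Gamma (1 - y) > 0" using y by auto
    then have "Gamma y \<noteq> 0" "Gamma (1 - y) \<noteq> 0" by linarith+
    ultimately show ?thesis using y s
      by (simp add: ln_mult ln_div ln_Gamma_real_pos)
  qed
  have s: "sin (pi * x) > 0" using x by (intro sin_gt_zero) auto
  have 1: "((\<lambda>y. ln_Gamma y + ln_Gamma (1 - y)) has_real_derivative (Digamma x - Digamma (1 - x))) (at x)"
    using x by (auto intro!: derivative_eq_intros)
  have 2: "((\<lambda>y. ln pi - ln (sin (pi * y))) has_real_derivative (- (pi * cot (pi * x)))) (at x)"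
    using s by (auto intro!: derivative_eq_intros simp: cot_def field_simps)
  have "((\<lambda>y. ln_Gamma y + ln_Gamma (1 - y)) has_real_derivative (- (pi * cot (pi * x)))) (at x)"
  proof (rule has_field_derivative_transform_within_open[OF 2])
    show "open {0<..<1::real}" "x \<in> {0<..<1}" using x by auto
  qed (use refl in auto)
  from DERIV_unique[OF 1 this] show ?thesis by simp
qed

text \<open>Pairing the two series termwise restores convergence in the exceptional case (1, 1),
  where the partial sums are differences of those defining the digamma function and the limit is the
  cotangent.\<close>

lemma lerch_theta_sums:
  assumes b: "b \<in> {1, -1}" and k: "k \<ge> 1" and s: "0 < s" "s < r"
  shows "(\<lambda>m. b ^ m * (1 / (real m + s / r) ^ k + b * (-1) ^ k / (real m + (r - s) / r) ^ k)) sums lerch_theta b k s r"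
proof (cases "b = 1 \<and> k = 1")
  case True
  define x where "x = s / r"
  have x: "0 < x" "x < 1" using s by (auto simp: x_def)
  have x': "(r - s) / r = 1 - x" using s by (simp add: x_def field_simps)
  have "(\<lambda>m. (ln (real m) - (\<Sum>n<m. inverse (1 - x + real n))) - (ln (real m) - (\<Sum>n<m. inverse (x + real n))))
      \<longlonglongrightarrow> Digamma (1 - x) - Digamma x"
    using Digamma_LIMSEQ[of "1 - x"] Digamma_LIMSEQ[of x] x by (intro tendsto_diff) auto
  then have "(\<lambda>m. \<Sum>n<m. 1 / (real n + x) - 1 / (real n + (1 - x))) \<longlonglongrightarrow> pi * cot (pi * x)"
    using Digamma_reflection[OF x] by (simp add: sum_subtractf divide_inverse add_ac)
  then show ?thesis
    using True x' by (simp add: sums_def lerch_theta_def x_def)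
next
  case False
  let ?S = "\<lambda>\<alpha>. \<Sum>m. b ^ m / (real m + \<alpha>) ^ k"
  have sm: "(\<lambda>m. b ^ m / (real m + \<alpha>) ^ k) sums ?S \<alpha>" if "\<alpha> > 0" for \<alpha>
    using summable_lerch[OF b that k] False k by (intro summable_sums) auto
  have "(\<lambda>m. b ^ m / (real m + s / r) ^ k + b * (-1) ^ k * (b ^ m / (real m + (r - s) / r) ^ k)) sums
      (?S (s / r) + b * (-1) ^ k * ?S ((r - s) / r))"
    using s by (intro sums_add sums_mult sm) auto
  moreover have "lerch_theta b k s r = ?S (s / r) + b * (-1) ^ k * ?S ((r - s) / r)"
    using False k by (auto simp: lerch_theta_def lerch_def)
  ultimately show ?thesis by (simp add: distrib_left mult_ac)
qed

text \<open>For m >= 1, m - \<alpha> = (m - 1) + s / r, while m <= 0 gives -(|m| + \<alpha>).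
  Pairing m + 1 with -m yields the \<Theta> series and leaves only the term at -M unpaired.\<close>

lemma bilateral_sum_theta:
  assumes b: "b \<in> {1, -1}" and k: "k \<ge> 1" and s: "0 < s" "s < r"
  shows "bilateral_sum b k ((r - s) / r) \<longlonglongrightarrow> b * lerch_theta b k s r"
proof -
  let ?\<alpha> = "(r - s) / r"
  have \<alpha>: "?\<alpha> > 0" "s / r = 1 - ?\<alpha>" using s by (auto simp: field_simps)
  let ?\<theta> = "\<lambda>M. \<Sum>m<M. b ^ m * (1 / (real m + s / r) ^ k + b * (-1) ^ k / (real m + ?\<alpha>) ^ k)"
  have b2: "b * (b * x) = x" for x using b by auto
  have eq: "bilateral_sum b k ?\<alpha> M = b * ?\<theta> M + b ^ M * (-1) ^ k / (real M + ?\<alpha>) ^ k" for M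
  proof (induction M)
    case 0
    show ?case by (simp add: bilateral_sum_def power_minus[of ?\<alpha>]) (cases "even k"; simp)
  next
    case (Suc M)
    have x: "1 / (- real (Suc M) - ?\<alpha>) ^ k = (-1) ^ k / (real (Suc M) + ?\<alpha>) ^ k"
    proof -
      have "- real (Suc M) - ?\<alpha> = - (real (Suc M) + ?\<alpha>)" by simp
      then show ?thesis unfolding power_minus[of "real (Suc M) + ?\<alpha>"]
        by (cases "even k") (simp_all only: power_minus[of "real (Suc M) + ?\<alpha>"], simp_all del: of_nat_Suc)
    qed
    have y: "real (Suc M) - ?\<alpha> = real M + s / r" using \<alpha>(2) by simp
    have "bilateral_sum b k ?\<alpha> (Suc M) = bilateral_sum b k ?\<alpha> M +
       b ^ Suc M * (1 / (real (Suc M) - ?\<alpha>) ^ k + 1 / (- real (Suc M) - ?\<alpha>) ^ k)"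
      by (simp add: bilateral_sum_def)
    then show ?case unfolding Suc.IH x y
      by (simp add: distrib_left b2 del: of_nat_Suc)
  qed
  have "(\<lambda>M. b ^ M * (-1) ^ k / (real M + ?\<alpha>) ^ k) \<longlonglongrightarrow> 0"
  proof (rule tendsto_0_le[where K = 1])
    have "filterlim (\<lambda>M. real M + ?\<alpha>) at_top sequentially"
      by real_asymp
    then have "(\<lambda>M. (1 / (real M + ?\<alpha>)) ^ k) \<longlonglongrightarrow> 0 ^ k"
      by (intro tendsto_intros tendsto_divide_0[OF tendsto_const] filterlim_at_top_imp_at_infinity)
    then show "(\<lambda>M. (1 / (real M + ?\<alpha>)) ^ k) \<longlonglongrightarrow> 0" using k by (simp add: power_0_left)
    show "\<forall>\<^sub>F M in sequentially. norm (b ^ M * (-1) ^ k / (real M + ?\<alpha>) ^ k) \<le> norm ((1 / (real M + ?\<alpha>)) ^ k) * 1"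
    proof (intro always_eventually allI)
      fix M
      have "\<bar>b\<bar> ^ M = 1" using b by auto
      then show "norm (b ^ M * (-1) ^ k / (real M + ?\<alpha>) ^ k) \<le> norm ((1 / (real M + ?\<alpha>)) ^ k) * 1"
        by (simp add: abs_mult power_abs power_one_over)
    qed
  qed
  with lerch_theta_sums[OF assms] have "(\<lambda>M. b * ?\<theta> M + b ^ M * (-1) ^ k / (real M + ?\<alpha>) ^ k) \<longlonglongrightarrow> b * lerch_theta b k s r + 0"
    unfolding sums_def by (intro tendsto_intros)
  then show ?thesis unfolding eq [symmetric] by simp
qed

section \<open>Evaluation of the bilateral sum with holes\<close>

text \<open>The hockey-stick identity. It evaluates one half of the decomposition at a hole of the
  bilateral sum, where all its powers of c have total exponent P + Q + 2.\<close>

lemma sum_partial_fraction_coefficients: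
  fixes c :: real
  shows "(\<Sum>i\<le>P. real ((P + Q - i) choose Q) * c ^ (Suc (P + Q) - i) * c ^ Suc i)
           = real (Suc (P + Q) choose Suc Q) * c ^ (P + Q + 2)"
proof -
  have "(\<Sum>i\<le>P. real ((P + Q - i) choose Q) * c ^ (Suc (P + Q) - i) * c ^ Suc i)
      = (\<Sum>i\<le>P. real ((P + Q - i) choose Q)) * c ^ (P + Q + 2)"
    unfolding sum_distrib_right by (intro sum.cong refl) (auto simp flip: power_add power_Suc)
  also have "(\<Sum>i\<le>P. real ((P + Q - i) choose Q)) = real (\<Sum>i\<le>P. (Q + i) choose Q)"
    unfolding of_nat_sum
    by (rule sum.reindex_bij_witness[of _ "\<lambda>i. P - i" "\<lambda>i. P - i"]) (auto simp: add.commute)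
  also have "(\<Sum>i\<le>P. (Q + i) choose Q) = Suc (P + Q) choose Suc Q"
    using choose_rising_sum(1)[of Q P] by (simp add: add_ac)
  finally show ?thesis .
qed

text \<open>Beyond the expected combination of \<open>Z\<close> and \<open>T\<close> there is one
  correction per hole: the \<open>T\<close> sums contain m = 0, which the left side omits, and the
  \<open>Z\<close> sums contain m = \<alpha> when \<alpha> is an integer; \<delta> is b^\<alpha> in
  that case and 0 otherwise.\<close>

lemma bilateral_partial_fractions:
  fixes \<alpha> \<delta> :: real
  assumes \<alpha>: "\<alpha> > 0"
    and T: "\<And>k. k \<le> Q \<Longrightarrow> bilateral_sum b (Suc k) \<alpha> \<longlonglongrightarrow> T k"
    and Z: "\<And>i. i \<le> P \<Longrightarrow> (\<lambda>j. b ^ Suc j * (1 / real (Suc j) ^ Suc i + 1 / (- real (Suc j)) ^ Suc i)) sums Z i"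
    and \<delta>: "(\<exists>N. \<alpha> = real (Suc N) \<and> \<delta> = b ^ Suc N) \<or> ((\<forall>N. \<alpha> \<noteq> real (Suc N)) \<and> \<delta> = 0)"
  shows "(\<lambda>j. b ^ Suc j * (1 / (real (Suc j) ^ Suc P * (real (Suc j) - \<alpha>) ^ Suc Q)
             + 1 / ((- real (Suc j)) ^ Suc P * (- real (Suc j) - \<alpha>) ^ Suc Q))) sums
      ((-1) ^ Suc Q * ((\<Sum>i\<le>P. real ((P + Q - i) choose Q) * (1 / \<alpha>) ^ (Suc (P + Q) - i) * Z i)
           - \<delta> * (real (Suc (P + Q) choose Suc Q) * (1 / \<alpha>) ^ (P + Q + 2))
           - real (Suc (P + Q) choose Suc P) * (1 / \<alpha>) ^ (P + Q + 2))
       + (\<Sum>k\<le>Q. (-1) ^ (Q - k) * real ((P + Q - k) choose P) * (1 / \<alpha>) ^ (Suc (P + Q) - k) * T k))"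
proof -
  define c where "c = 1 / \<alpha>"
  define A where "A i = real ((P + Q - i) choose Q) * c ^ (Suc (P + Q) - i)" for i
  define B where "B k = (-1) ^ (Q - k) * real ((P + Q - k) choose P) * c ^ (Suc (P + Q) - k)" for k
  \<comment> \<open>At m = \<alpha> the summand and the powers of 1 / (m - \<alpha>) are all 0 by
    \<open>1 / 0 = 0\<close>, but the powers of 1 / m are not; \<open>e\<close> removes them so that
    one formula serves every j.\<close>
  define e where "e j = (if \<alpha> = real (Suc j) then b ^ Suc j else 0)" for j
  have frac: "1 / (m ^ Suc P * (m - \<alpha>) ^ Suc Q) =
      (-1) ^ Suc Q * (\<Sum>i\<le>P. A i * (1 / m ^ Suc i)) + (\<Sum>k\<le>Q. B k * (1 / (m - \<alpha>) ^ Suc k))"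
    if "m \<noteq> 0" "m \<noteq> \<alpha>" for m
  proof -
    have uv: "1 / m * (1 / (m - \<alpha>)) = c * (1 / (m - \<alpha>) - 1 / m)"
      using that \<alpha> by (simp add: c_def divide_simps)
    from partial_fractions[OF uv, of P Q] show ?thesis
      unfolding A_def B_def power_one_over by (simp only: times_divide_times_eq mult_1)
  qed
  have summand: "b ^ Suc j * (1 / (real (Suc j) ^ Suc P * (real (Suc j) - \<alpha>) ^ Suc Q)
             + 1 / ((- real (Suc j)) ^ Suc P * (- real (Suc j) - \<alpha>) ^ Suc Q)) =
      (-1) ^ Suc Q * (\<Sum>i\<le>P. A i * (b ^ Suc j * (1 / real (Suc j) ^ Suc i + 1 / (- real (Suc j)) ^ Suc i) - e j * c ^ Suc i))
       + (\<Sum>k\<le>Q. B k * (b ^ Suc j * (1 / (real (Suc j) - \<alpha>) ^ Suc k + 1 / (- real (Suc j) - \<alpha>) ^ Suc k)))" for j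
  proof -
    let ?m = "real (Suc j)"
    have neg: "1 / ((- ?m) ^ Suc P * (- ?m - \<alpha>) ^ Suc Q) =
      (-1) ^ Suc Q * (\<Sum>i\<le>P. A i * (1 / (- ?m) ^ Suc i)) + (\<Sum>k\<le>Q. B k * (1 / (- ?m - \<alpha>) ^ Suc k))"
      using \<alpha> by (intro frac) auto
    have pos: "1 / (?m ^ Suc P * (?m - \<alpha>) ^ Suc Q) =
      (-1) ^ Suc Q * (\<Sum>i\<le>P. A i * (1 / ?m ^ Suc i - (if \<alpha> = ?m then 1 else 0) * c ^ Suc i))
      + (\<Sum>k\<le>Q. B k * (1 / (?m - \<alpha>) ^ Suc k))"
    proof (cases "\<alpha> = ?m")
      case True
      have "c = 1 / ?m" by (simp only: c_def True)
      then show ?thesis using True by (simp del: of_nat_Suc add: power_one_over)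
    next
      case False
      then show ?thesis using frac[of ?m] by simp
    qed
    have e: "e j = b ^ Suc j * (if \<alpha> = ?m then 1 else 0)" by (simp add: e_def)
    have "b ^ Suc j * (1 / (?m ^ Suc P * (?m - \<alpha>) ^ Suc Q) + 1 / ((- ?m) ^ Suc P * (- ?m - \<alpha>) ^ Suc Q)) =
       (-1) ^ Suc Q * (b ^ Suc j * ((\<Sum>i\<le>P. A i * (1 / ?m ^ Suc i - (if \<alpha> = ?m then 1 else 0) * c ^ Suc i))
          + (\<Sum>i\<le>P. A i * (1 / (- ?m) ^ Suc i))))
       + b ^ Suc j * ((\<Sum>k\<le>Q. B k * (1 / (?m - \<alpha>) ^ Suc k)) + (\<Sum>k\<le>Q. B k * (1 / (- ?m - \<alpha>) ^ Suc k)))"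
      unfolding pos neg by (simp only: distrib_left mult.left_commute ac_simps)
    also have "\<dots> = (-1) ^ Suc Q * (\<Sum>i\<le>P. A i * (b ^ Suc j * (1 / ?m ^ Suc i + 1 / (- ?m) ^ Suc i) - e j * c ^ Suc i))
       + (\<Sum>k\<le>Q. B k * (b ^ Suc j * (1 / (?m - \<alpha>) ^ Suc k + 1 / (- ?m - \<alpha>) ^ Suc k)))"
      unfolding e sum.distrib [symmetric] sum_distrib_left
      by (intro arg_cong2[where f = "(+)"] sum.cong refl)
         (simp_all only: distrib_left right_diff_distrib ac_simps diff_conv_add_uminus mult_minus_right)
    finally show ?thesis .
  qed
  have e: "e sums \<delta>"
    using \<delta>
  proof
    assume "\<exists>N. \<alpha> = real (Suc N) \<and> \<delta> = b ^ Suc N"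
    then obtain N where N: "\<alpha> = real (Suc N)" "\<delta> = b ^ Suc N" by blast
    have "e = (\<lambda>j. if j = N then b ^ Suc j else 0)" using N by (auto simp: e_def fun_eq_iff)
    then show ?thesis using sums_single[of N "\<lambda>j. b ^ Suc j"] N by simp
  next
    assume "(\<forall>N. \<alpha> \<noteq> real (Suc N)) \<and> \<delta> = 0"
    then show ?thesis by (auto simp: e_def[abs_def])
  qed
  have T': "(\<lambda>j. b ^ Suc j * (1 / (real (Suc j) - \<alpha>) ^ Suc k + 1 / (- real (Suc j) - \<alpha>) ^ Suc k)) sums
      (T k - 1 / (- \<alpha>) ^ Suc k)" if "k \<le> Q" for k
    using tendsto_diff[OF T[OF that] tendsto_const, of "1 / (- \<alpha>) ^ Suc k"]
    unfolding sums_def bilateral_sum_def by simp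
  have "(\<lambda>j. (-1) ^ Suc Q * (\<Sum>i\<le>P. A i * (b ^ Suc j * (1 / real (Suc j) ^ Suc i + 1 / (- real (Suc j)) ^ Suc i) - e j * c ^ Suc i))
       + (\<Sum>k\<le>Q. B k * (b ^ Suc j * (1 / (real (Suc j) - \<alpha>) ^ Suc k + 1 / (- real (Suc j) - \<alpha>) ^ Suc k)))) sums
      ((-1) ^ Suc Q * (\<Sum>i\<le>P. A i * (Z i - \<delta> * c ^ Suc i)) + (\<Sum>k\<le>Q. B k * (T k - 1 / (- \<alpha>) ^ Suc k)))"
    by (intro sums_add sums_mult sums_sum sums_diff sums_mult2 Z T' e) auto
  also have "(\<Sum>i\<le>P. A i * (Z i - \<delta> * c ^ Suc i)) = (\<Sum>i\<le>P. A i * Z i) - \<delta> * (\<Sum>i\<le>P. A i * c ^ Suc i)"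
    by (simp add: right_diff_distrib sum_subtractf sum_distrib_left mult_ac)
  also have "(\<Sum>i\<le>P. A i * c ^ Suc i) = real (Suc (P + Q) choose Suc Q) * c ^ (P + Q + 2)"
    unfolding A_def by (rule sum_partial_fraction_coefficients)
  \<comment> \<open>The subtracted 1 / (-\<alpha>)^(k+1) is the m = 0 term of the bilateral sum; its
    coefficients again add up to a single binomial.\<close>
  also have "(\<Sum>k\<le>Q. B k * (T k - 1 / (- \<alpha>) ^ Suc k)) = (\<Sum>k\<le>Q. B k * T k) -
      (-1) ^ Suc Q * (real (Suc (P + Q) choose Suc P) * c ^ (P + Q + 2))"
  proof -
    have "B k * (1 / (- \<alpha>) ^ Suc k) = (-1) ^ Suc Q * (real ((Q + P - k) choose P) * c ^ (Suc (Q + P) - k) * c ^ Suc k)"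
      if "k \<le> Q" for k
    proof -
      have "1 / (- \<alpha>) ^ Suc k = (-1) ^ Suc k * c ^ Suc k"
        unfolding power_minus[of \<alpha>] c_def by (cases "even k") (simp_all add: power_one_over)
      moreover have "(-1 :: real) ^ (Q - k) * (-1) ^ Suc k = (-1) ^ Suc Q"
        using that by (simp flip: power_add power_Suc)
      ultimately show ?thesis unfolding B_def by (simp add: add.commute mult_ac)
    qed
    then have "(\<Sum>k\<le>Q. B k * (1 / (- \<alpha>) ^ Suc k)) =
      (-1) ^ Suc Q * (\<Sum>k\<le>Q. real ((Q + P - k) choose P) * c ^ (Suc (Q + P) - k) * c ^ Suc k)"
      unfolding sum_distrib_left by (intro sum.cong) auto
    also have "\<dots> = (-1) ^ Suc Q * (real (Suc (P + Q) choose Suc P) * c ^ (P + Q + 2))"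
      unfolding sum_partial_fraction_coefficients by (simp add: add_ac)
    finally show ?thesis by (simp only: right_diff_distrib sum_subtractf)
  qed
  finally show ?thesis
    unfolding summand A_def B_def c_def by (simp add: right_diff_distrib algebra_simps)
qed

section \<open>Abel's theorem along residue classes\<close>

text \<open>Index l stands for l + 1, hence the exponent \<open>Suc l\<close>. Summability is part
  of the notion because \<open>suminf\<close> of a divergent series is an arbitrary value and would
  spoil linearity.\<close>

definition Abel_sums :: "(nat \<Rightarrow> real) \<Rightarrow> real \<Rightarrow> bool" where
  "Abel_sums f L \<longleftrightarrow> (\<forall>t\<in>{0<..<1}. summable (\<lambda>l. f l * t ^ Suc l)) \<and>
     ((\<lambda>t. \<Sum>l. f l * t ^ Suc l) \<longlongrightarrow> L) (at_left 1)"

lemma Abel_sums_cmult: "Abel_sums f L \<Longrightarrow> Abel_sums (\<lambda>l. c * f l) (c * L)"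
proof -
  assume A: "Abel_sums f L"
  have "((\<lambda>t. c * (\<Sum>l. f l * t ^ Suc l)) \<longlongrightarrow> c * L) (at_left 1)"
    using A by (intro tendsto_intros) (auto simp: Abel_sums_def)
  moreover have "eventually (\<lambda>t. c * (\<Sum>l. f l * t ^ Suc l) = (\<Sum>l. c * f l * t ^ Suc l)) (at_left 1)"
    using eventually_at_left_real[OF zero_less_one]
    by eventually_elim (use A in \<open>auto simp: Abel_sums_def suminf_mult mult.assoc\<close>)
  ultimately have "((\<lambda>t. \<Sum>l. c * f l * t ^ Suc l) \<longlongrightarrow> c * L) (at_left 1)"
    by (rule Lim_transform_eventually)
  with A show ?thesis by (auto simp: Abel_sums_def mult.assoc intro: summable_mult)
qed

lemma Abel_sums_add: "Abel_sums f L \<Longrightarrow> Abel_sums g M \<Longrightarrow> Abel_sums (\<lambda>l. f l + g l) (L + M)"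
proof -
  assume A: "Abel_sums f L" "Abel_sums g M"
  have "((\<lambda>t. (\<Sum>l. f l * t ^ Suc l) + (\<Sum>l. g l * t ^ Suc l)) \<longlongrightarrow> L + M) (at_left 1)"
    using A by (intro tendsto_intros) (auto simp: Abel_sums_def)
  moreover have "eventually (\<lambda>t. (\<Sum>l. f l * t ^ Suc l) + (\<Sum>l. g l * t ^ Suc l) = (\<Sum>l. (f l + g l) * t ^ Suc l)) (at_left 1)"
    using eventually_at_left_real[OF zero_less_one]
    by eventually_elim (use A in \<open>auto simp: Abel_sums_def suminf_add distrib_right\<close>)
  ultimately have "((\<lambda>t. \<Sum>l. (f l + g l) * t ^ Suc l) \<longlongrightarrow> L + M) (at_left 1)"
    by (rule Lim_transform_eventually)
  with A show ?thesis by (auto simp: Abel_sums_def distrib_right intro: summable_add)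
qed

lemma Abel_sums_sum:
  assumes "finite A" "\<And>i. i \<in> A \<Longrightarrow> Abel_sums (f i) (L i)"
  shows "Abel_sums (\<lambda>l. \<Sum>i\<in>A. f i l) (\<Sum>i\<in>A. L i)"
  using assms
proof (induction A rule: finite_induct)
  case empty
  then show ?case by (simp add: Abel_sums_def)
next
  case (insert i A)
  then show ?case by (simp add: Abel_sums_add)
qed

text \<open>Grouping into blocks of length n turns the power series into n series in t^n, each with
  Abel's theorem at its disposal; the prefactors t^(r+1) tend to 1.\<close>

lemma Abel_sums_residues:
  assumes n: "n \<ge> 1" and f: "\<And>r. r < n \<Longrightarrow> summable (\<lambda>i. f (i * n + r))"
  shows "Abel_sums f (\<Sum>r<n. \<Sum>i. f (i * n + r))"
proof -
  have "\<exists>B. \<forall>i. \<bar>f (i * n + r)\<bar> \<le> B" if "r < n" for r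
    using summable_imp_Bseq[OF f[OF that]] by (auto simp: Bseq_def)
  then obtain B where B: "\<And>r i. r < n \<Longrightarrow> \<bar>f (i * n + r)\<bar> \<le> B r" by metis
  have fB: "\<bar>f l\<bar> \<le> (\<Sum>r<n. \<bar>B r\<bar>)" for l
  proof -
    have r: "l mod n < n" using n by simp
    have "\<bar>f ((l div n) * n + l mod n)\<bar> \<le> B (l mod n)" by (rule B[OF r])
    also have "\<dots> \<le> \<bar>B (l mod n)\<bar>" by simp
    also have "\<dots> \<le> (\<Sum>r<n. \<bar>B r\<bar>)" using r by (intro member_le_sum) auto
    finally show ?thesis by simp
  qed
  have sm: "summable (\<lambda>l. f l * t ^ Suc l)" if "t \<in> {0<..<1}" for t
  proof (rule summable_comparison_test_ev)
    show "summable (\<lambda>l. (\<Sum>r<n. \<bar>B r\<bar>) * t * t ^ l)"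
      using that by (intro summable_mult summable_geometric) auto
    show "\<forall>\<^sub>F l in sequentially. norm (f l * t ^ Suc l) \<le> (\<Sum>r<n. \<bar>B r\<bar>) * t * t ^ l"
      using that fB by (intro always_eventually allI) (auto simp: abs_mult mult.assoc intro!: mult_right_mono)
  qed
  have eq: "(\<Sum>l. f l * t ^ Suc l) = (\<Sum>r<n. t ^ Suc r * (\<Sum>i. f (i * n + r) * (t ^ n) ^ i))" if t: "t \<in> {0<..<1}" for t
  proof -
    have tn: "\<bar>t ^ n\<bar> < 1" using t n power_Suc_less_one[of t "n - 1"] by auto
    have s: "summable (\<lambda>i. f (i * n + r) * (t ^ n) ^ i)" if "r < n" for r
      using sums_summable[OF Abel_summation(2)[OF f[OF that] tn]] .
    have "(\<lambda>i. \<Sum>l\<in>{i * n..<i * n + n}. f l * t ^ Suc l) sums (\<Sum>l. f l * t ^ Suc l)"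
      using n by (intro sums_group summable_sums sm t) auto
    then have "(\<Sum>l. f l * t ^ Suc l) = (\<Sum>i. \<Sum>l\<in>{i * n..<i * n + n}. f l * t ^ Suc l)"
      by (rule sums_unique)
    also have "(\<lambda>i. \<Sum>l\<in>{i * n..<i * n + n}. f l * t ^ Suc l) = (\<lambda>i. \<Sum>r<n. t ^ Suc r * (f (i * n + r) * (t ^ n) ^ i))"
    proof
      fix i
      have "(\<Sum>l\<in>{i * n..<i * n + n}. f l * t ^ Suc l) = (\<Sum>r<n. f (i * n + r) * t ^ Suc (i * n + r))"
        by (rule sum.reindex_bij_witness[of _ "\<lambda>r. i * n + r" "\<lambda>l. l - i * n"]) auto
      also have "\<dots> = (\<Sum>r<n. t ^ Suc r * (f (i * n + r) * (t ^ n) ^ i))"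
      proof (intro sum.cong refl)
        fix r
        have e: "Suc (i * n + r) = Suc r + n * i" by simp
        show "f (i * n + r) * t ^ Suc (i * n + r) = t ^ Suc r * (f (i * n + r) * (t ^ n) ^ i)"
          unfolding e power_add power_mult by (simp only: mult.left_commute)
      qed
      finally show "(\<Sum>l\<in>{i * n..<i * n + n}. f l * t ^ Suc l) = (\<Sum>r<n. t ^ Suc r * (f (i * n + r) * (t ^ n) ^ i))" .
    qed
    also have "suminf \<dots> = (\<Sum>r<n. \<Sum>i. t ^ Suc r * (f (i * n + r) * (t ^ n) ^ i))"
      by (rule suminf_sum) (rule summable_mult, rule s, simp)
    also have "\<dots> = (\<Sum>r<n. t ^ Suc r * (\<Sum>i. f (i * n + r) * (t ^ n) ^ i))"
      by (intro sum.cong suminf_mult s) auto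
    finally show ?thesis .
  qed
  have "((\<lambda>t. \<Sum>r<n. t ^ Suc r * (\<Sum>i. f (i * n + r) * (t ^ n) ^ i)) \<longlongrightarrow> (\<Sum>r<n. 1 ^ Suc r * (\<Sum>i. f (i * n + r)))) (at_left 1)"
    by (intro tendsto_intros filterlim_compose[OF Abel_limit[OF f] filterlim_power_at_left_1[OF n]]) auto
  moreover have "eventually (\<lambda>t. (\<Sum>r<n. t ^ Suc r * (\<Sum>i. f (i * n + r) * (t ^ n) ^ i)) = (\<Sum>l. f l * t ^ Suc l)) (at_left 1)"
    using eventually_at_left_real[OF zero_less_one] by eventually_elim (use eq in auto)
  ultimately have "((\<lambda>t. \<Sum>l. f l * t ^ Suc l) \<longlongrightarrow> (\<Sum>r<n. 1 ^ Suc r * (\<Sum>i. f (i * n + r)))) (at_left 1)"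
    by (rule Lim_transform_eventually)
  with sm show ?thesis by (simp add: Abel_sums_def)
qed

lemma Abel_sums_polylog:
  assumes a: "a \<in> {1, -1}" and s: "s \<ge> 1" "a = 1 \<Longrightarrow> s \<ge> 2"
  shows "Abel_sums (\<lambda>l. a ^ Suc l * (\<nu> / real (Suc l)) ^ s) (\<nu> ^ s * Li s a)"
proof -
  have "summable (\<lambda>l. a ^ Suc l / real (Suc l) ^ s)"
    using a s by (intro summable_Li) auto
  then have "Abel_sums (\<lambda>l. a ^ Suc l / real (Suc l) ^ s) (Li s a)"
    using Abel_sums_residues[of 1 "\<lambda>l. a ^ Suc l / real (Suc l) ^ s"] by (simp add: Li_def)
  from Abel_sums_cmult[OF this, of "\<nu> ^ s"] show ?thesis
    by (simp add: power_divide mult_ac del: of_nat_Suc power_Suc)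
qed

text \<open>Only the residue r = n - 1, that is l + 1 = n (i + 1), contributes. These are the
  corrections for an integral \<alpha>.\<close>

lemma Abel_sums_multiples:
  assumes a: "a \<in> {1, -1}" and b: "b \<in> {1, -1}" and n: "n \<ge> 1" and s: "s \<ge> 1" "a ^ n * b = 1 \<Longrightarrow> s \<ge> 2"
  shows "Abel_sums (\<lambda>l. a ^ Suc l * ((if n dvd Suc l then b ^ (Suc l div n) else 0) * (real n / real (Suc l)) ^ s))
           (Li s (a ^ n * b))"
proof -
  define f where "f l = a ^ Suc l * ((if n dvd Suc l then b ^ (Suc l div n) else 0) * (real n / real (Suc l)) ^ s)" for l
  have c: "a ^ n * b \<in> {1, -1}"
    using a b by (auto simp: minus_one_power_iff split: if_splits)
  have sm: "summable (\<lambda>i. (a ^ n * b) ^ Suc i / real (Suc i) ^ s)"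
    using c s by (intro summable_Li) auto
  have f1: "f (i * n + r) = 0" if "r < n - 1" for i r
  proof -
    have "\<not> n dvd Suc (i * n + r)"
    proof
      assume "n dvd Suc (i * n + r)"
      then have "n dvd i * n + Suc r" by simp
      then have "n dvd Suc r" by (metis dvd_add_right_iff dvd_triv_right)
      then show False using that by (auto dest: dvd_imp_le)
    qed
    then show ?thesis by (simp add: f_def)
  qed
  have f2: "f (i * n + (n - 1)) = (a ^ n * b) ^ Suc i / real (Suc i) ^ s" for i
  proof -
    have eq: "Suc (i * n + (n - 1)) = n * Suc i" using n by simp
    have "real n / real (n * Suc i) = 1 / real (Suc i)" using n by (simp add: of_nat_mult del: of_nat_Suc mult_Suc_right)
    then show ?thesis using n
      unfolding f_def eq by (simp add: power_mult power_mult_distrib power_one_over del: mult_Suc_right power_Suc of_nat_Suc)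
  qed
  have "Abel_sums f (\<Sum>r<n. \<Sum>i. f (i * n + r))"
  proof (rule Abel_sums_residues[OF n])
    fix r assume "r < n"
    then consider "r < n - 1" | "r = n - 1" by linarith
    then show "summable (\<lambda>i. f (i * n + r))"
    proof cases
      case 2
      then show ?thesis using sm unfolding f2 by (simp only: f2)
    qed (simp add: f1)
  qed
  also have "(\<Sum>r<n. \<Sum>i. f (i * n + r)) = (\<Sum>r<Suc (n - 1). \<Sum>i. f (i * n + r))" using n by simp
  also have "\<dots> = Li s (a ^ n * b)"
    unfolding sum.lessThan_Suc f2 by (simp add: f1 Li_def)
  finally show ?thesis unfolding f_def .
qed

text \<open>Writing l + 1 = n (i + (r + 1) / n) makes each residue class a Lerch series in i: a^l
  and b^(l div n) together supply the sign (a^n b)^i.\<close>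

lemma Abel_sums_lerch:
  assumes a: "a \<in> {1, -1}" and b: "b \<in> {1, -1}" and n: "n \<ge> 1" and s: "s \<ge> 1" "a ^ n * b = 1 \<Longrightarrow> s \<ge> 2"
  shows "Abel_sums (\<lambda>l. a ^ Suc l * ((real n / real (Suc l)) ^ s * (b ^ (l div n) * \<tau> (l mod n))))
           (\<Sum>r<n. a ^ Suc r * \<tau> r * lerch (a ^ n * b) s (real (Suc r) / real n))"
proof -
  define f where "f l = a ^ Suc l * ((real n / real (Suc l)) ^ s * (b ^ (l div n) * \<tau> (l mod n)))" for l
  have c: "a ^ n * b \<in> {1, -1}"
    using a b by (auto simp: minus_one_power_iff split: if_splits)
  have f: "f (i * n + r) = (a ^ Suc r * \<tau> r) * ((a ^ n * b) ^ i / (real i + real (Suc r) / real n) ^ s)" if "r < n" for i r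
  proof -
    have d: "(i * n + r) div n = i" "(i * n + r) mod n = r" using that by auto
    have "real n / real (Suc (i * n + r)) = 1 / (real i + real (Suc r) / real n)"
      using n by (simp add: field_simps)
    moreover have "a ^ Suc (i * n + r) = a ^ Suc r * (a ^ n) ^ i"
    proof -
      have e: "Suc (i * n + r) = Suc r + n * i" by simp
      show ?thesis unfolding e power_add power_mult ..
    qed
    ultimately show ?thesis
      unfolding f_def d by (simp add: power_one_over power_mult_distrib del: of_nat_Suc power_Suc)
  qed
  have sm: "summable (\<lambda>i. (a ^ n * b) ^ i / (real i + real (Suc r) / real n) ^ s)" for r
    using c n s by (intro summable_lerch) auto
  have "Abel_sums f (\<Sum>r<n. \<Sum>i. f (i * n + r))"
    by (intro Abel_sums_residues n) (simp only: f summable_mult[OF sm])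
  also have "(\<Sum>r<n. \<Sum>i. f (i * n + r)) = (\<Sum>r<n. a ^ Suc r * \<tau> r * lerch (a ^ n * b) s (real (Suc r) / real n))"
    using s by (intro sum.cong refl) (simp only: f suminf_mult[OF sm] lessThan_iff, simp add: lerch_def)
  finally show ?thesis unfolding f_def .
qed

section \<open>Summing the evaluated rows\<close>

text \<open>The limit of the bilateral sum at \<alpha> = (r + 1) / n. For r + 1 = n this is the
  integer shift 1, where \<Theta> would have s = 0; the value comes from shift 0, and the extra b
  from moving it by 1.\<close>

definition residue_theta :: "real \<Rightarrow> nat \<Rightarrow> nat \<Rightarrow> nat \<Rightarrow> real" where
  "residue_theta b n k r = (if Suc r < n then b * lerch_theta b k (real n - real (Suc r)) (real n)
     else b * ((1 + (-1) ^ k) * Li k b))"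

lemma bilateral_sum_residue:
  assumes b: "b \<in> {1, -1}" and n: "n \<ge> 1" and k: "k \<ge> 1"
  shows "bilateral_sum b k (real (Suc l) / real n) \<longlonglongrightarrow> b ^ (l div n) * residue_theta b n k (l mod n)"
proof -
  define i r where "i = l div n" and "r = l mod n"
  have r: "r < n" using n by (simp add: r_def)
  have "l = i * n + r" by (simp add: i_def r_def)
  then have \<alpha>: "real (Suc l) / real n = real i + real (Suc r) / real n"
    using n by (simp add: field_simps)
  show ?thesis
  proof (cases "Suc r < n")
    case True
    have "bilateral_sum b k ((real n - (real n - real (Suc r))) / real n) \<longlonglongrightarrow>
      b * lerch_theta b k (real n - real (Suc r)) (real n)"
      using True by (intro bilateral_sum_theta b k) auto
    then have "bilateral_sum b k (real (Suc r) / real n) \<longlonglongrightarrow> residue_theta b n k r"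
      using True by (simp add: residue_theta_def)
    from bilateral_sum_tendsto_shift_nat[OF b k this, of i] show ?thesis
      by (simp only: \<alpha> i_def r_def)
  next
    case False
    then have "Suc r = n" using r by simp
    then have "real (Suc l) / real n = real (Suc i) + 0" using \<alpha> n by simp
    with bilateral_sum_tendsto_shift_nat[OF b k bilateral_sum_0(2)[OF b k], of "Suc i"] False show ?thesis
      by (simp add: residue_theta_def mult_ac flip: i_def r_def)
  qed
qed

text \<open>The bilateral evaluation at \<alpha> = (l + 1) / n, so that \<open>c l\<close> = 1 /
  \<alpha>. The limits depend on l through its residue and the sign b^(l div n), which is what lets
  the rows be summed by residue classes.\<close>

lemma double_series_row:
  fixes n P Q :: nat and b :: real
  assumes b: "b \<in> {1, -1}" and n: "n \<ge> 1"
  defines "c \<equiv> \<lambda>l. real n / real (Suc l)"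
  shows "(\<Sum>m. b ^ Suc m * ((-1) ^ Suc P / (real (Suc m) ^ Suc P * real (Suc l + n * Suc m) ^ Suc Q)
              + 1 / (real (Suc m) ^ Suc P * (real (Suc l) - real (n * Suc m)) ^ Suc Q)))
     = 1 / real n ^ Suc Q * (
        (\<Sum>i\<le>P. real ((P + Q - i) choose Q) * ((1 + (-1) ^ Suc i) * Li (Suc i) b) * c l ^ (Suc (P + Q) - i))
        + (\<Sum>k\<le>Q. (-1) ^ Suc k * real ((P + Q - k) choose P) *
             (c l ^ (Suc (P + Q) - k) * (b ^ (l div n) * residue_theta b n (Suc k) (l mod n))))
        + (- real (Suc (P + Q) choose Suc Q)) * ((if n dvd Suc l then b ^ (Suc l div n) else 0) * c l ^ (P + Q + 2))
        + (- real (Suc (P + Q) choose Suc P)) * c l ^ (P + Q + 2))"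
proof -
  define \<alpha> where "\<alpha> = real (Suc l) / real n"
  define \<delta> where "\<delta> = (if n dvd Suc l then b ^ (Suc l div n) else 0)"
  have \<alpha>: "\<alpha> > 0" "1 / \<alpha> = c l" using n by (simp_all add: \<alpha>_def c_def)
  have \<delta>: "(\<exists>N. \<alpha> = real (Suc N) \<and> \<delta> = b ^ Suc N) \<or> ((\<forall>N. \<alpha> \<noteq> real (Suc N)) \<and> \<delta> = 0)"
  proof (cases "n dvd Suc l")
    case True
    then obtain k where k: "Suc l = n * k" by blast
    then obtain N where "k = Suc N" by (cases k) auto
    then have "\<alpha> = real (Suc N)" "\<delta> = b ^ Suc N"
      using True k n by (simp_all add: \<alpha>_def \<delta>_def del: of_nat_Suc power_Suc mult_Suc_right)
    then show ?thesis by blast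
  next
    case False
    have "\<alpha> \<noteq> real (Suc N)" for N
    proof
      assume "\<alpha> = real (Suc N)"
      then have "real (Suc l) = real (n * Suc N)"
        using n by (simp add: \<alpha>_def divide_eq_eq mult.commute del: of_nat_Suc mult_Suc_right)
      then have "Suc l = n * Suc N" by (simp only: of_nat_eq_iff)
      then show False using False by simp
    qed
    then show ?thesis using False by (simp add: \<delta>_def)
  qed
  let ?e = "\<lambda>m. b ^ Suc m * ((-1) ^ Suc P / (real (Suc m) ^ Suc P * real (Suc l + n * Suc m) ^ Suc Q)
              + 1 / (real (Suc m) ^ Suc P * (real (Suc l) - real (n * Suc m)) ^ Suc Q))"
  \<comment> \<open>Since m - \<alpha> = -(l + 1 - n m) / n for every integer m, both summands
    acquire the common factor (-n)^(Q+1).\<close>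
  have e: "b ^ Suc m * (1 / (real (Suc m) ^ Suc P * (real (Suc m) - \<alpha>) ^ Suc Q)
             + 1 / ((- real (Suc m)) ^ Suc P * (- real (Suc m) - \<alpha>) ^ Suc Q)) =
      (-1) ^ Suc Q * real n ^ Suc Q * ?e m" for m
  proof -
    have 1: "real (Suc m) - \<alpha> = - ((real (Suc l) - real (n * Suc m)) / real n)"
      using n by (simp add: \<alpha>_def field_simps)
    have 2: "- real (Suc m) - \<alpha> = - (real (Suc l + n * Suc m) / real n)"
      using n by (simp add: \<alpha>_def field_simps)
    have neg: "1 / ((- x) ^ k * y) = (-1) ^ k / (x ^ k * y)" for x y :: real and k
      unfolding power_minus[of x] by (cases "even k") auto
    have "1 / (real (Suc m) ^ Suc P * (real (Suc m) - \<alpha>) ^ Suc Q) =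
      (-1) ^ Suc Q * real n ^ Suc Q * (1 / (real (Suc m) ^ Suc P * (real (Suc l) - real (n * Suc m)) ^ Suc Q))"
      unfolding 1 mult.commute[of "real (Suc m) ^ Suc P"] neg power_divide by simp
    moreover have "1 / ((- real (Suc m)) ^ Suc P * (- real (Suc m) - \<alpha>) ^ Suc Q) =
      (-1) ^ Suc Q * real n ^ Suc Q * ((-1) ^ Suc P / (real (Suc m) ^ Suc P * real (Suc l + n * Suc m) ^ Suc Q))"
    proof -
      have "1 / ((- real (Suc m)) ^ Suc P * (- real (Suc m) - \<alpha>) ^ Suc Q) =
        (-1) ^ Suc P * (1 / ((- real (Suc m) - \<alpha>) ^ Suc Q * real (Suc m) ^ Suc P))"
        unfolding neg by (simp add: mult.commute)
      also have "\<dots> = (-1) ^ Suc P * ((-1) ^ Suc Q / ((real (Suc l + n * Suc m) / real n) ^ Suc Q * real (Suc m) ^ Suc P))"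
        unfolding 2 neg ..
      also have "\<dots> = (-1) ^ Suc Q * real n ^ Suc Q * ((-1) ^ Suc P / (real (Suc m) ^ Suc P * real (Suc l + n * Suc m) ^ Suc Q))"
        unfolding power_divide by (simp add: mult_ac del: power_Suc of_nat_Suc of_nat_add of_nat_mult mult_Suc_right)
      finally show ?thesis .
    qed
    ultimately show ?thesis
      by (simp only:) (simp only: distrib_left ac_simps)
  qed
  define S where "S = (-1) ^ Suc Q * ((\<Sum>i\<le>P. real ((P + Q - i) choose Q) * (1 / \<alpha>) ^ (Suc (P + Q) - i) * ((1 + (-1) ^ Suc i) * Li (Suc i) b))
           - \<delta> * (real (Suc (P + Q) choose Suc Q) * (1 / \<alpha>) ^ (P + Q + 2))
           - real (Suc (P + Q) choose Suc P) * (1 / \<alpha>) ^ (P + Q + 2))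
       + (\<Sum>k\<le>Q. (-1) ^ (Q - k) * real ((P + Q - k) choose P) * (1 / \<alpha>) ^ (Suc (P + Q) - k) *
            (b ^ (l div n) * residue_theta b n (Suc k) (l mod n)))"
  have "(\<lambda>m. (-1) ^ Suc Q * real n ^ Suc Q * ?e m) sums S"
    unfolding e [symmetric] S_def
  proof (rule bilateral_partial_fractions[OF \<alpha>(1) _ _ \<delta>])
    show "bilateral_sum b (Suc k) \<alpha> \<longlonglongrightarrow> b ^ (l div n) * residue_theta b n (Suc k) (l mod n)" for k
      unfolding \<alpha>_def by (rule bilateral_sum_residue[OF b n]) simp
    show "(\<lambda>j. b ^ Suc j * (1 / real (Suc j) ^ Suc i + 1 / (- real (Suc j)) ^ Suc i)) sums
        ((1 + (-1) ^ Suc i) * Li (Suc i) b)" for i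
      by (rule bilateral_sum_0(1)[OF b]) simp
  qed
  note e_sums = this
  have "?e sums ((-1) ^ Suc Q / real n ^ Suc Q * S)"
  proof -
    have "(-1) ^ Suc Q / real n ^ Suc Q * ((-1) ^ Suc Q * real n ^ Suc Q * x) = x" for x :: real
    proof -
      have "(-1 :: real) ^ Suc Q * (-1) ^ Suc Q = 1" by (simp flip: power_mult_distrib)
      moreover have "real n ^ Suc Q \<noteq> 0" using n by simp
      ultimately show ?thesis by (simp add: field_simps del: power_Suc)
    qed
    then show ?thesis using sums_mult[OF e_sums, of "(-1) ^ Suc Q / real n ^ Suc Q"]
      by (simp only:)
  qed
  then have "suminf ?e = 1 / real n ^ Suc Q * ((-1) ^ Suc Q * S)"
    using sums_unique[of ?e] by (simp add: mult.commute)
  also have "(-1) ^ Suc Q * S = (\<Sum>i\<le>P. real ((P + Q - i) choose Q) * ((1 + (-1) ^ Suc i) * Li (Suc i) b) * c l ^ (Suc (P + Q) - i))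
        + (\<Sum>k\<le>Q. (-1) ^ Suc k * real ((P + Q - k) choose P) *
             (c l ^ (Suc (P + Q) - k) * (b ^ (l div n) * residue_theta b n (Suc k) (l mod n))))
        + (- real (Suc (P + Q) choose Suc Q)) * (\<delta> * c l ^ (P + Q + 2))
        + (- real (Suc (P + Q) choose Suc P)) * c l ^ (P + Q + 2)"
  proof -
    have sgn: "(-1 :: real) ^ Suc Q * ((-1) ^ Suc Q * x) = x" for x
      by (cases "even Q") auto
    have sgn2: "(-1 :: real) ^ Suc Q * ((-1) ^ (Q - k) * y * z * w) = (-1) ^ Suc k * y * (z * w)" if "k \<le> Q" for k y z w
    proof -
      have "(-1 :: real) ^ Suc Q * (-1) ^ (Q - k) = (-1) ^ Suc k"
        using that by (cases "even Q"; cases "even k") auto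
      then show ?thesis by (simp add: mult.assoc [symmetric])
    qed
    have "(-1) ^ Suc Q * (\<Sum>k\<le>Q. (-1) ^ (Q - k) * real ((P + Q - k) choose P) * (1 / \<alpha>) ^ (Suc (P + Q) - k) *
            (b ^ (l div n) * residue_theta b n (Suc k) (l mod n))) =
        (\<Sum>k\<le>Q. (-1) ^ Suc k * real ((P + Q - k) choose P) *
             (c l ^ (Suc (P + Q) - k) * (b ^ (l div n) * residue_theta b n (Suc k) (l mod n))))"
      unfolding sum_distrib_left \<alpha>(2) by (intro sum.cong refl sgn2) auto
    moreover have "(\<Sum>i\<le>P. real ((P + Q - i) choose Q) * (1 / \<alpha>) ^ (Suc (P + Q) - i) * ((1 + (-1) ^ Suc i) * Li (Suc i) b))
       = (\<Sum>i\<le>P. real ((P + Q - i) choose Q) * ((1 + (-1) ^ Suc i) * Li (Suc i) b) * c l ^ (Suc (P + Q) - i))"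
      unfolding \<alpha>(2) by (intro sum.cong refl) (simp only: mult_ac)
    ultimately show ?thesis
      unfolding S_def distrib_left sgn by (simp only: \<alpha>(2)) (simp add: algebra_simps del: power_Suc)
  qed
  finally show ?thesis unfolding \<delta>_def .
qed

text \<open>The Abel sum of the rows over l. The last two lines are the hole corrections, from m =
  \<alpha> and from m = 0 in this order.\<close>

definition parity_limit :: "real \<Rightarrow> real \<Rightarrow> nat \<Rightarrow> nat \<Rightarrow> nat \<Rightarrow> real" where
  "parity_limit a b n P Q = 1 / real n ^ Suc Q * (
      (\<Sum>i\<le>P. real ((P + Q - i) choose Q) * ((1 + (-1) ^ Suc i) * Li (Suc i) b) *
          (real n ^ (Suc (P + Q) - i) * Li (Suc (P + Q) - i) a))
      + (\<Sum>k\<le>Q. (-1) ^ Suc k * real ((P + Q - k) choose P) *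
           (\<Sum>r<n. a ^ Suc r * residue_theta b n (Suc k) r * lerch (a ^ n * b) (Suc (P + Q) - k) (real (Suc r) / real n)))
      + (- real (Suc (P + Q) choose Suc Q)) * Li (P + Q + 2) (a ^ n * b)
      + (- real (Suc (P + Q) choose Suc P)) * (real n ^ (P + Q + 2) * Li (P + Q + 2) a))"

lemma Abel_sums_double_series:
  fixes n P Q :: nat and a b :: real
  assumes a: "a \<in> {1, -1}" and b: "b \<in> {1, -1}" and n: "n \<ge> 1"
    and a1: "a = 1 \<Longrightarrow> Suc Q \<ge> 2" and ab: "a ^ n * b = 1 \<Longrightarrow> Suc P \<ge> 2" and PQ: "odd (P + Q)"
  shows "Abel_sums (\<lambda>l. a ^ Suc l * (\<Sum>m. b ^ Suc m * ((-1) ^ Suc P / (real (Suc m) ^ Suc P * real (Suc l + n * Suc m) ^ Suc Q)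
              + 1 / (real (Suc m) ^ Suc P * (real (Suc l) - real (n * Suc m)) ^ Suc Q))))
     (parity_limit a b n P Q)"
proof -
  let ?c = "\<lambda>l. real n / real (Suc l)"
  have N: "P + Q \<ge> 1" using PQ by (cases "P + Q") auto
  have row: "a ^ Suc l * (\<Sum>m. b ^ Suc m * ((-1) ^ Suc P / (real (Suc m) ^ Suc P * real (Suc l + n * Suc m) ^ Suc Q)
              + 1 / (real (Suc m) ^ Suc P * (real (Suc l) - real (n * Suc m)) ^ Suc Q))) =
     1 / real n ^ Suc Q * (
        (\<Sum>i\<le>P. real ((P + Q - i) choose Q) * ((1 + (-1) ^ Suc i) * Li (Suc i) b) * (a ^ Suc l * ?c l ^ (Suc (P + Q) - i)))
        + (\<Sum>k\<le>Q. (-1) ^ Suc k * real ((P + Q - k) choose P) *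
             (a ^ Suc l * (?c l ^ (Suc (P + Q) - k) * (b ^ (l div n) * residue_theta b n (Suc k) (l mod n)))))
        + (- real (Suc (P + Q) choose Suc Q)) * (a ^ Suc l * ((if n dvd Suc l then b ^ (Suc l div n) else 0) * ?c l ^ (P + Q + 2)))
        + (- real (Suc (P + Q) choose Suc P)) * (a ^ Suc l * ?c l ^ (P + Q + 2)))" for l
    unfolding double_series_row[OF b n]
    by (simp only: distrib_left sum_distrib_left mult.left_commute)
  show ?thesis
    unfolding row parity_limit_def using N a1 ab
    by (intro Abel_sums_cmult Abel_sums_add Abel_sums_sum Abel_sums_polylog Abel_sums_lerch Abel_sums_multiples a b n)
       auto
qed

text \<open>One limit computed twice: by dominated convergence it is linear in I, by Abel's theorem
  it is \<open>parity_limit\<close>; the equation is solved for I.\<close>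

lemma polylog_integral_parity:
  fixes n P Q :: nat and a b :: real
  assumes a: "a \<in> {1, -1}" and b: "b \<in> {1, -1}" and n: "n \<ge> 1"
    and a1: "a = 1 \<Longrightarrow> Suc Q \<ge> 2" and ab: "a ^ n * b = 1 \<Longrightarrow> Suc P \<ge> 2" and PQ: "odd (P + Q)"
  shows "((\<lambda>x. log_kernel (Suc Q) x * (Li (Suc P) (b * x ^ n) * (a / (1 - a * x)))) has_integral
     1 / 2 * (-1) ^ Suc Q * ((1 + (-1) ^ Suc Q) * Li (Suc P) (a ^ n * b) * Li (Suc Q) a
       - (-1) ^ Suc Q * Li (P + Q + 2) b / real n ^ Suc Q - parity_limit a b n P Q)) {0..1}"
proof -
  define L where "L = parity_limit a b n P Q"
  \<comment> \<open>Any sequence tending to 1 from below would do; this one starts at 1/2, the bound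
    that the limit of the difference quotient asks for.\<close>
  define t where "t k = 1 - 1 / (real k + 2)" for k
  have t: "1 / 2 \<le> t k" "t k < 1" for k by (auto simp: t_def field_simps)
  have tl: "t \<longlonglongrightarrow> 1" unfolding t_def by real_asymp
  have t_left: "filterlim t (at_left 1) sequentially"
    using t(2) tl by (auto simp: filterlim_at less_imp_neq)
  define I where "I = integral {0..1} (\<lambda>x. log_kernel (Suc Q) x * (Li (Suc P) (b * x ^ n) * (a / (1 - a * x))))"
  define X where "X = Li (Suc P) (a ^ n * b) * Li (Suc Q) a"
  define Y where "Y = Li (P + Q + 2) b / real n ^ Suc Q"
  let ?E = "\<lambda>l. \<Sum>m. b ^ Suc m * ((-1) ^ Suc P / (real (Suc m) ^ Suc P * real (Suc l + n * Suc m) ^ Suc Q)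
              + 1 / (real (Suc m) ^ Suc P * (real (Suc l) - real (n * Suc m)) ^ Suc Q))"
  have p1: "Suc P \<ge> 1" and q1: "Suc Q \<ge> 1" by auto
  have pq: "Suc P + Suc Q = P + Q + 2" by simp
  note D = double_series_limit[OF n p1 q1 a b a1 ab t tl, folded I_def, unfolded pq, folded X_def Y_def]
  have "(\<lambda>k. \<Sum>l. (a * t k) ^ Suc l * ?E l) \<longlonglongrightarrow> (-1) ^ Suc P * I + (X + (-1) ^ Suc Q * (X - I - Y))"
    using D(1) by blast
  moreover have "((\<lambda>t. \<Sum>l. a ^ Suc l * ?E l * t ^ Suc l) \<longlongrightarrow> L) (at_left 1)"
    using Abel_sums_double_series[OF a b n a1 ab PQ] unfolding L_def Abel_sums_def by blast
  from filterlim_compose[OF this t_left]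
  have "(\<lambda>k. \<Sum>l. (a * t k) ^ Suc l * ?E l) \<longlonglongrightarrow> L"
    by (simp only: power_mult_distrib mult_ac)
  ultimately have eq: "(-1) ^ Suc P * I + (X + (-1) ^ Suc Q * (X - I - Y)) = L"
    by (rule LIMSEQ_unique)
  \<comment> \<open>The parity condition enters here: P + Q odd makes both occurrences of I carry
    the same sign, giving 2 I. With P + Q even they would cancel.\<close>
  have sgn: "(-1 :: real) ^ Suc P = - ((-1) ^ Suc Q)" and sgn2: "(-1 :: real) ^ Suc Q * (-1) ^ Suc Q = 1"
    using PQ by (cases "even P"; cases "even Q"; auto)+
  define \<sigma> where "\<sigma> = (-1 :: real) ^ Suc Q"
  have "\<sigma> * \<sigma> = 1" using sgn2 by (simp only: \<sigma>_def)
  have "- \<sigma> * I + (X + \<sigma> * (X - I - Y)) = L"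
    using eq unfolding sgn \<sigma>_def [symmetric] by simp
  then have "2 * (\<sigma> * I) = (1 + \<sigma>) * X - \<sigma> * Y - L"
    by (simp add: algebra_simps)
  then have "\<sigma> * (2 * (\<sigma> * I)) = \<sigma> * ((1 + \<sigma>) * X - \<sigma> * Y - L)" by (simp only:)
  moreover have "\<sigma> * (2 * (\<sigma> * I)) = 2 * I"
    using \<open>\<sigma> * \<sigma> = 1\<close> by (simp add: mult.assoc [symmetric] mult.commute[of \<sigma> 2])
  ultimately have "I = 1 / 2 * \<sigma> * ((1 + \<sigma>) * X - \<sigma> * Y - L)" by simp
  moreover have "((\<lambda>x. log_kernel (Suc Q) x * (Li (Suc P) (b * x ^ n) * (a / (1 - a * x)))) has_integral I) {0..1}"
    using double_series_limit(2)[OF n p1 q1 a b a1 ab t tl] unfolding I_def by blast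
  ultimately show ?thesis
    by (simp only: X_def Y_def L_def \<sigma>_def mult.assoc times_divide_eq_right)
qed

section \<open>The parity identity in closed form\<close>

lemma sum_even_indices:
  fixes h :: "nat \<Rightarrow> real"
  shows "(\<Sum>i\<le>P. (1 + (-1) ^ Suc i) * h (Suc i)) = 2 * (\<Sum>k = 1..Suc P div 2. h (2 * k))"
proof (induction P)
  case (Suc P)
  show ?case
  proof (cases "even P")
    case True
    then have "Suc (Suc P) div 2 = Suc (Suc P div 2)" "2 * Suc (Suc P div 2) = Suc (Suc P)" by (auto elim!: evenE)
    then show ?thesis using Suc.IH True by simp
  next
    case False
    then have "Suc (Suc P) div 2 = Suc P div 2" by (auto elim!: oddE)
    then show ?thesis using Suc.IH False by simp
  qed
qed simp

text \<open>The factor 1 + (-1)^(i+1) keeps only even orders of \<open>Li\<close>, and the m = 0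
  correction becomes the k = 0 term of the sum.\<close>

lemma polylog_sum_closed_form:
  fixes P Q n :: nat and a b :: real
  assumes a: "a \<in> {1, -1}" and b: "b \<in> {1, -1}" and n: "n \<ge> 1" and a1: "a = 1 \<Longrightarrow> Suc Q \<ge> 2"
  shows "(\<Sum>i\<le>P. real ((P + Q - i) choose Q) * ((1 + (-1) ^ Suc i) * Li (Suc i) b) *
            (real n ^ (Suc (P + Q) - i) * Li (Suc (P + Q) - i) a))
        + (- real (Suc (P + Q) choose Suc P)) * (real n ^ (P + Q + 2) * Li (P + Q + 2) a)
      = 2 * a * b * real n ^ (P + Q + 2) * (\<Sum>k = 0..Suc P div 2. real ((P + Q + 1 - 2 * k) choose Q) *
           real n powi (- 2 * int k) * lerch b (2 * k) 1 * lerch a (P + Q + 2 - 2 * k) 1)"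
proof -
  define g where "g k = real ((P + Q + 1 - 2 * k) choose Q) *
           real n powi (- 2 * int k) * lerch b (2 * k) 1 * lerch a (P + Q + 2 - 2 * k) 1" for k
  define h where "h j = real ((P + Q + 1 - j) choose Q) * Li j b * (real n ^ (P + Q + 2 - j) * Li (P + Q + 2 - j) a)" for j
  have "(\<Sum>i\<le>P. real ((P + Q - i) choose Q) * ((1 + (-1) ^ Suc i) * Li (Suc i) b) *
            (real n ^ (Suc (P + Q) - i) * Li (Suc (P + Q) - i) a)) = (\<Sum>i\<le>P. (1 + (-1) ^ Suc i) * h (Suc i))"
    unfolding h_def by (intro sum.cong refl) (simp only: diff_Suc_Suc add_Suc_right add_2_eq_Suc' Suc_eq_plus1 [symmetric] mult_ac)
  also have "\<dots> = 2 * (\<Sum>k = 1..Suc P div 2. h (2 * k))" by (rule sum_even_indices)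
  also have "(\<Sum>k = 1..Suc P div 2. h (2 * k)) = (\<Sum>k = 1..Suc P div 2. a * b * real n ^ (P + Q + 2) * g k)"
  proof (intro sum.cong refl)
    fix k assume k: "k \<in> {1..Suc P div 2}"
    then have k2: "2 * k \<ge> 2" "2 * k \<le> Suc P" by auto
    have "real n ^ (P + Q + 2 - 2 * k) = real n ^ (P + Q + 2) * real n powi (- 2 * int k)"
    proof -
      have "real n ^ (P + Q + 2) = real n ^ (P + Q + 2 - 2 * k) * real n ^ (2 * k)"
        using k2 by (simp flip: power_add)
      moreover have "real n powi (- 2 * int k) = inverse (real n ^ (2 * k))"
        by (simp add: power_int_def nat_mult_distrib power_inverse)
      ultimately show ?thesis using n by (simp add: field_simps)
    qed
    moreover have "Li (2 * k) b = b * lerch b (2 * k) 1"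
      using k2 b by (intro Li_eq_lerch) auto
    moreover have "Li (P + Q + 2 - 2 * k) a = a * lerch a (P + Q + 2 - 2 * k) 1"
      using k2 a a1 by (intro Li_eq_lerch) auto
    ultimately show "h (2 * k) = a * b * real n ^ (P + Q + 2) * g k"
      unfolding h_def g_def by (simp only: mult_ac)
  qed
  also have "(\<Sum>k = 1..Suc P div 2. a * b * real n ^ (P + Q + 2) * g k) = a * b * real n ^ (P + Q + 2) * (\<Sum>k = 1..Suc P div 2. g k)"
    by (simp add: sum_distrib_left)
  finally have 1: "(\<Sum>i\<le>P. real ((P + Q - i) choose Q) * ((1 + (-1) ^ Suc i) * Li (Suc i) b) *
            (real n ^ (Suc (P + Q) - i) * Li (Suc (P + Q) - i) a)) =
     2 * (a * b * real n ^ (P + Q + 2) * (\<Sum>k = 1..Suc P div 2. g k))" .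
  have 2: "(\<Sum>k = 0..Suc P div 2. g k) = g 0 + (\<Sum>k = 1..Suc P div 2. g k)"
    by (simp add: sum.atLeast_Suc_atMost)
  have "Li (P + Q + 2) a = a * lerch a (P + Q + 2) 1"
    using a by (intro Li_eq_lerch) auto
  moreover have "Suc (P + Q) choose Suc P = (P + Q + 1) choose Q"
    using binomial_symmetric[of "Suc P" "Suc (P + Q)"] by simp
  \<comment> \<open>\<open>lerch b 0 1\<close> is -1/2 for b = 1 and 1/2 for b = -1, hence -b/2.
    This is where the continued values fit the correction exactly.\<close>
  moreover have "g 0 = - (b / 2) * real ((P + Q + 1) choose Q) * lerch a (P + Q + 2) 1"
    using b by (auto simp: g_def lerch_def)
  moreover have "b * b = 1" using b by auto
  ultimately have 3: "(- real (Suc (P + Q) choose Suc P)) * (real n ^ (P + Q + 2) * Li (P + Q + 2) a)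
     = 2 * a * b * real n ^ (P + Q + 2) * g 0"
    by simp
  show ?thesis unfolding 1 3 g_def [symmetric] 2 by (simp add: algebra_simps)
qed

text \<open>The residue r = n - 1 yields the even zeta values and, with the m = \<alpha> correction
  as its j = 0 term, the first sum; the other residues yield the \<Theta> values.\<close>

lemma residue_sum_closed_form:
  fixes P Q n :: nat and a b :: real
  assumes a: "a \<in> {1, -1}" and b: "b \<in> {1, -1}" and n: "n \<ge> 1" and ab: "a ^ n * b = 1 \<Longrightarrow> Suc P \<ge> 2"
  shows "(\<Sum>k\<le>Q. (-1) ^ Suc k * real ((P + Q - k) choose P) *
             (\<Sum>r<n. a ^ Suc r * residue_theta b n (Suc k) r * lerch (a ^ n * b) (Suc (P + Q) - k) (real (Suc r) / real n)))
        + (- real (Suc (P + Q) choose Suc Q)) * Li (P + Q + 2) (a ^ n * b)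
     = 2 * a ^ n * (\<Sum>j = 0..Suc Q div 2. real ((P + Q + 1 - 2 * j) choose P) *
          lerch b (2 * j) 1 * lerch (a ^ n * b) (P + Q + 2 - 2 * j) 1)
       + a ^ Suc n * b * (\<Sum>j = 2..n. \<Sum>k = 1..Suc Q. real ((P + Q + 1 - k) choose P) *
                a ^ j * (-1) ^ k * lerch_theta b k (real j - 1) (real n) *
                lerch (a ^ n * b) (P + Q + 2 - k) ((real n - real j + 1) / real n))"
proof -
  define c where "c = a ^ n * b"
  have c: "c \<in> {1, -1}"
    using a b by (auto simp: c_def minus_one_power_iff split: if_splits)
  obtain n' where n': "n = Suc n'" using n by (cases n) auto
  define w where "w k r = (-1) ^ Suc k * real ((P + Q - k) choose P) *
       (a ^ Suc r * residue_theta b n (Suc k) r * lerch c (Suc (P + Q) - k) (real (Suc r) / real n))" for k r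
  have split: "(\<Sum>k\<le>Q. (-1) ^ Suc k * real ((P + Q - k) choose P) *
             (\<Sum>r<n. a ^ Suc r * residue_theta b n (Suc k) r * lerch c (Suc (P + Q) - k) (real (Suc r) / real n)))
      = (\<Sum>k\<le>Q. \<Sum>r<n'. w k r) + (\<Sum>k\<le>Q. w k n')"
    unfolding sum_distrib_left w_def [symmetric] by (simp add: n' sum.distrib)
  define g where "g j = real ((P + Q + 1 - 2 * j) choose P) * lerch b (2 * j) 1 * lerch c (P + Q + 2 - 2 * j) 1" for j
  define h where "h j = a ^ n * (real ((P + Q + 1 - j) choose P) * (b * Li j b) * lerch c (P + Q + 2 - j) 1)" for j
  have bb: "b * (b * x) = x" for x using b by auto
  have "(\<Sum>k\<le>Q. w k n') = (\<Sum>k\<le>Q. (1 + (-1) ^ Suc k) * h (Suc k))"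
  proof (intro sum.cong refl)
    fix k
    have "residue_theta b n (Suc k) n' = b * ((1 + (-1) ^ Suc k) * Li (Suc k) b)"
      by (simp only: residue_theta_def n' less_irrefl if_False)
    moreover have "(-1) ^ Suc k * (1 + (-1 :: real) ^ Suc k) = 1 + (-1) ^ Suc k"
      by (cases "even k") auto
    moreover have "real (Suc n') / real n = 1" using n n' by simp
    moreover have "a ^ Suc n' = a ^ n" by (simp only: n')
    moreover have "w k n' = ((-1) ^ Suc k * (1 + (-1) ^ Suc k)) * (a ^ n * (real ((P + Q - k) choose P) * (b * Li (Suc k) b) * lerch c (Suc (P + Q) - k) 1))"
      unfolding w_def calculation(1,3,4) by (simp only: mult_ac)
    ultimately show "w k n' = (1 + (-1) ^ Suc k) * h (Suc k)"
      unfolding h_def by (simp only: diff_Suc_Suc add_Suc_right add_2_eq_Suc' Suc_eq_plus1 [symmetric])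
  qed
  also have "\<dots> = 2 * (\<Sum>j = 1..Suc Q div 2. h (2 * j))" by (rule sum_even_indices)
  also have "(\<Sum>j = 1..Suc Q div 2. h (2 * j)) = (\<Sum>j = 1..Suc Q div 2. a ^ n * g j)"
  proof (intro sum.cong refl)
    fix k assume k: "k \<in> {1..Suc Q div 2}"
    then have "b * Li (2 * k) b = lerch b (2 * k) 1"
      using b by (subst Li_eq_lerch) (auto simp: bb)
    then show "h (2 * k) = a ^ n * g k" unfolding h_def g_def by (simp only:)
  qed
  also have "\<dots> = a ^ n * (\<Sum>j = 1..Suc Q div 2. g j)" by (simp add: sum_distrib_left)
  finally have 1: "(\<Sum>k\<le>Q. w k n') = 2 * (a ^ n * (\<Sum>j = 1..Suc Q div 2. g j))" .
  have 2: "(\<Sum>k = 0..Suc Q div 2. g k) = g 0 + (\<Sum>k = 1..Suc Q div 2. g k)"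
    by (simp add: sum.atLeast_Suc_atMost)
  have 3: "(- real (Suc (P + Q) choose Suc Q)) * Li (P + Q + 2) c = 2 * (a ^ n * g 0)"
  proof -
    have "Li (P + Q + 2) c = c * lerch c (P + Q + 2) 1"
      using c by (intro Li_eq_lerch) auto
    moreover have "Suc (P + Q) choose Suc Q = (P + Q + 1) choose P"
      using binomial_symmetric[of "Suc Q" "Suc (P + Q)"] by simp
    moreover have "g 0 = - (b / 2) * real ((P + Q + 1) choose P) * lerch c (P + Q + 2) 1"
      using b by (auto simp: g_def lerch_def)
    ultimately show ?thesis by (simp add: c_def)
  qed
  have "(\<Sum>k\<le>Q. \<Sum>r<n'. w k r) = (\<Sum>r<n'. \<Sum>k\<le>Q. w k r)" by (rule sum.swap)
  \<comment> \<open>With r = n - j, r + 1 = n - j + 1 is the numerator of the Lerch argument and n -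
    (r + 1) = j - 1 the parameter s of \<Theta>.\<close>
  also have "\<dots> = (\<Sum>j = 2..n. \<Sum>k\<le>Q. w k (n - j))"
    by (rule sum.reindex_bij_witness[of _ "\<lambda>j. n - j" "\<lambda>r. n - r"]) (auto simp: n')
  also have "\<dots> = (\<Sum>j = 2..n. \<Sum>k = 1..Suc Q. a ^ Suc n * b * (real ((P + Q + 1 - k) choose P) *
                a ^ j * (-1) ^ k * lerch_theta b k (real j - 1) (real n) *
                lerch c (P + Q + 2 - k) ((real n - real j + 1) / real n)))"
  proof (rule sum.cong[OF refl])
    fix j assume j: "j \<in> {2..n}"
    have r: "real (Suc (n - j)) = real n - real j + 1" "real n - real (Suc (n - j)) = real j - 1" "Suc (n - j) < n"
      using j by (auto simp: of_nat_diff)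
    have aa: "a ^ Suc (n - j) = a ^ Suc n * a ^ j"
    proof -
      have "a ^ Suc n = a ^ Suc (n - j) * a ^ j" using j by (simp flip: power_add)
      moreover have "a ^ j * a ^ j = 1" using a by (auto simp flip: power_mult_distrib)
      ultimately show ?thesis by (simp only: mult.assoc mult_1_right)
    qed
    have "(\<Sum>k\<le>Q. w k (n - j)) = (\<Sum>k = 0..Q. w k (n - j))" by (simp add: atMost_atLeast0)
    also have "\<dots> = (\<Sum>k = Suc 0..Suc Q. w (k - 1) (n - j))"
      by (subst sum.shift_bounds_cl_Suc_ivl) simp
    also have "\<dots> = (\<Sum>k = 1..Suc Q. a ^ Suc n * b * (real ((P + Q + 1 - k) choose P) *
                a ^ j * (-1) ^ k * lerch_theta b k (real j - 1) (real n) *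
                lerch c (P + Q + 2 - k) ((real n - real j + 1) / real n)))"
    proof (intro sum.cong)
      fix k assume "k \<in> {1..Suc Q}"
      then obtain k' where k': "k = Suc k'" by (cases k) auto
      show "w (k - 1) (n - j) = a ^ Suc n * b * (real ((P + Q + 1 - k) choose P) *
                a ^ j * (-1) ^ k * lerch_theta b k (real j - 1) (real n) *
                lerch c (P + Q + 2 - k) ((real n - real j + 1) / real n))"
        unfolding w_def k' diff_Suc_1 residue_theta_def aa r(2)
        using r(3) by (simp only: if_True diff_Suc_1 diff_Suc_Suc add_Suc_right add_2_eq_Suc' Suc_eq_plus1 [symmetric] mult_ac r(1))
    qed simp
    finally show "(\<Sum>k\<le>Q. w k (n - j)) = (\<Sum>k = 1..Suc Q. a ^ Suc n * b * (real ((P + Q + 1 - k) choose P) *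
                a ^ j * (-1) ^ k * lerch_theta b k (real j - 1) (real n) *
                lerch c (P + Q + 2 - k) ((real n - real j + 1) / real n)))" .
  qed
  finally have 4: "(\<Sum>k\<le>Q. \<Sum>r<n'. w k r) = a ^ Suc n * b * (\<Sum>j = 2..n. \<Sum>k = 1..Suc Q. real ((P + Q + 1 - k) choose P) *
                a ^ j * (-1) ^ k * lerch_theta b k (real j - 1) (real n) *
                lerch c (P + Q + 2 - k) ((real n - real j + 1) / real n))"
    by (simp only: sum_distrib_left)
  show ?thesis
    unfolding c_def [symmetric] split 1 3 4 g_def [symmetric] 2 by (simp add: algebra_simps)
qed

lemma abs_power_less_one:
  assumes "b \<in> {1, -1::real}" "n \<ge> 1" "0 < x" "x < 1" shows "\<bar>b * x ^ n\<bar> < 1"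
  using assms power_Suc_less_one[of x "n - 1"] by (auto simp: abs_mult)

lemma polylog_log_integral:
  fixes p q n :: nat and a b :: real
  assumes p: "p \<ge> 1" and q: "q \<ge> 1" and n: "n \<ge> 1" and pq: "odd (p + q)"
    and a: "a \<in> {1, -1}" and b: "b \<in> {1, -1}"
    and ab: "a ^ n * b \<noteq> 1 \<or> p \<noteq> 1" and a1: "a \<noteq> 1 \<or> q \<noteq> 1"
  shows "((\<lambda>x. ln x ^ (q - 1) * polylog p (b * x ^ n) / (1 - a * x)) has_integral
        (1 / 2 * a * b * (-1) ^ q * fact (q - 1) * real n powi (- int q) * lerch b (p + q) 1
         - 1 / 2 * a ^ n * b * (1 + (-1) ^ q) * fact (q - 1) * lerch a q 1 * lerch (a ^ n * b) p 1
         + a ^ (n - 1) * real n powi (- int q) * fact (q - 1) *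
             (\<Sum>j = 0..q div 2. real ((p + q - 2 * j - 1) choose (p - 1)) *
                lerch b (2 * j) 1 * lerch (a ^ n * b) (p + q - 2 * j) 1)
         + b * real n ^ p * fact (q - 1) *
             (\<Sum>k = 0..p div 2. real ((p + q - 2 * k - 1) choose (q - 1)) *
                real n powi (- 2 * int k) * lerch b (2 * k) 1 * lerch a (p + q - 2 * k) 1)
         + 1 / 2 * a ^ n * b * real n powi (- int q) * fact (q - 1) *
             (\<Sum>j = 2..n. \<Sum>k = 1..q. real ((p + q - k - 1) choose (p - 1)) *
                a ^ j * (-1) ^ k * lerch_theta b k (real j - 1) (real n) *
                lerch (a ^ n * b) (p + q - k) ((real n - real j + 1) / real n)))) {0..1}"
proof -
  obtain P where P: "p = Suc P" using p by (cases p) auto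
  obtain Q where Q: "q = Suc Q" using q by (cases q) auto
  define c where "c = a ^ n * b"
  have c: "c \<in> {1, -1}"
    using a b by (auto simp: c_def minus_one_power_iff split: if_splits)
  have PQ: "odd (P + Q)" using pq by (simp add: P Q)
  have ab': "a ^ n * b = 1 \<Longrightarrow> Suc P \<ge> 2" and a1': "a = 1 \<Longrightarrow> Suc Q \<ge> 2"
    using ab a1 P Q by auto
  define S3 where "S3 = (\<Sum>j = 0..Suc Q div 2. real ((P + Q + 1 - 2 * j) choose P) *
          lerch b (2 * j) 1 * lerch c (P + Q + 2 - 2 * j) 1)"
  define S4 where "S4 = (\<Sum>k = 0..Suc P div 2. real ((P + Q + 1 - 2 * k) choose Q) *
           real n powi (- 2 * int k) * lerch b (2 * k) 1 * lerch a (P + Q + 2 - 2 * k) 1)"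
  define S5 where "S5 = (\<Sum>j = 2..n. \<Sum>k = 1..Suc Q. real ((P + Q + 1 - k) choose P) *
                a ^ j * (-1) ^ k * lerch_theta b k (real j - 1) (real n) *
                lerch c (P + Q + 2 - k) ((real n - real j + 1) / real n))"
  let ?A = "\<Sum>i\<le>P. real ((P + Q - i) choose Q) * ((1 + (-1) ^ Suc i) * Li (Suc i) b) *
            (real n ^ (Suc (P + Q) - i) * Li (Suc (P + Q) - i) a)"
  let ?B = "\<Sum>k\<le>Q. (-1) ^ Suc k * real ((P + Q - k) choose P) *
             (\<Sum>r<n. a ^ Suc r * residue_theta b n (Suc k) r * lerch (a ^ n * b) (Suc (P + Q) - k) (real (Suc r) / real n))"
  let ?C = "(- real (Suc (P + Q) choose Suc Q)) * Li (P + Q + 2) (a ^ n * b)"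
  let ?D = "(- real (Suc (P + Q) choose Suc P)) * (real n ^ (P + Q + 2) * Li (P + Q + 2) a)"
  define L where "L = parity_limit a b n P Q"
  have "?A + ?D = 2 * a * b * real n ^ (P + Q + 2) * S4"
    unfolding S4_def by (rule polylog_sum_closed_form[OF a b n a1'])
  moreover have "?B + ?C = 2 * a ^ n * S3 + a ^ Suc n * b * S5"
    unfolding S3_def S5_def c_def by (rule residue_sum_closed_form[OF a b n ab'])
  moreover have "?A + ?B + ?C + ?D = (?A + ?D) + (?B + ?C)" by (simp only: ac_simps)
  ultimately have L: "L = 1 / real n ^ Suc Q * (2 * a * b * real n ^ (P + Q + 2) * S4 + (2 * a ^ n * S3 + a ^ Suc n * b * S5))"
    unfolding L_def parity_limit_def by (simp only:)
  have S: "(\<Sum>j = 0..q div 2. real ((p + q - 2 * j - 1) choose (p - 1)) *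
                lerch b (2 * j) 1 * lerch (a ^ n * b) (p + q - 2 * j) 1) = S3"
     "(\<Sum>k = 0..p div 2. real ((p + q - 2 * k - 1) choose (q - 1)) *
                real n powi (- 2 * int k) * lerch b (2 * k) 1 * lerch a (p + q - 2 * k) 1) = S4"
     "(\<Sum>j = 2..n. \<Sum>k = 1..q. real ((p + q - k - 1) choose (p - 1)) *
                a ^ j * (-1) ^ k * lerch_theta b k (real j - 1) (real n) *
                lerch (a ^ n * b) (p + q - k) ((real n - real j + 1) / real n)) = S5"
    unfolding S3_def S4_def S5_def c_def P Q
    by (intro sum.cong refl; simp add: diff_right_commute)+
  define \<sigma> where "\<sigma> = (-1 :: real) ^ Suc Q"
  have \<sigma>: "\<sigma> * \<sigma> = 1" "(-1) ^ Q = - \<sigma>" by (cases "even Q"; simp add: \<sigma>_def)+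
  let ?g = "\<lambda>x. log_kernel (Suc Q) x * (Li (Suc P) (b * x ^ n) * (a / (1 - a * x)))"
  have "(?g has_integral 1 / 2 * \<sigma> * ((1 + \<sigma>) * Li (Suc P) c * Li (Suc Q) a
       - \<sigma> * Li (P + Q + 2) b / real n ^ Suc Q - L)) {0..1}"
    unfolding \<sigma>_def c_def L_def by (rule polylog_integral_parity[OF a b n a1' ab' PQ])
  \<comment> \<open>-\<sigma> is (-1)^(q-1), so with the factorial it turns the kernel back into the
    power of ln; the factor a cancels the one in a / (1 - a x).\<close>
  from has_integral_mult_right[OF this, of "- \<sigma> * fact Q * a"]
  have A: "((\<lambda>x. - \<sigma> * fact Q * a * ?g x) has_integral - \<sigma> * fact Q * a * (1 / 2 * \<sigma> * ((1 + \<sigma>) * Li (Suc P) c * Li (Suc Q) a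
       - \<sigma> * Li (P + Q + 2) b / real n ^ Suc Q - L))) {0..1}" .
  have B: "ln x ^ (q - 1) * polylog p (b * x ^ n) / (1 - a * x) = - \<sigma> * fact Q * a * ?g x" if x: "x \<in> {0..1} - {0, 1}" for x
  proof -
    have "polylog p (b * x ^ n) = Li (Suc P) (b * x ^ n)"
      unfolding P using x abs_power_less_one[OF b n, of x] by (intro polylog_eq_series) auto
    moreover have "ln x ^ (q - 1) = - \<sigma> * fact Q * log_kernel (Suc Q) x"
      using power_mult_distrib[of "-1" "- ln x" Q] by (simp add: Q log_kernel_def \<sigma>(2) flip: \<sigma>(2))
    moreover have "a * (a * y) = y" for y using a by auto
    ultimately show ?thesis by (simp add: mult_ac)
  qed
  define V where "V = 1 / 2 * a * b * \<sigma> * fact Q * (1 / real n ^ Suc Q) * lerch b (P + Q + 2) 1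
       - 1 / 2 * c * (1 + \<sigma>) * fact Q * lerch a (Suc Q) 1 * lerch c (Suc P) 1
       + a ^ (n - 1) * (1 / real n ^ Suc Q) * fact Q * S3
       + b * real n ^ Suc P * fact Q * S4
       + 1 / 2 * c * (1 / real n ^ Suc Q) * fact Q * S5"
  have "- \<sigma> * fact Q * a * (1 / 2 * \<sigma> * ((1 + \<sigma>) * Li (Suc P) c * Li (Suc Q) a
       - \<sigma> * Li (P + Q + 2) b / real n ^ Suc Q - L)) =
     V"
  proof -
    have 1: "Li (P + Q + 2) b = b * lerch b (P + Q + 2) 1"
      using b by (intro Li_eq_lerch) auto
    have 2: "Li (Suc P) c = c * lerch c (Suc P) 1"
      using c ab' by (intro Li_eq_lerch) (auto simp: c_def)
    have 3: "Li (Suc Q) a = a * lerch a (Suc Q) 1"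
      using a a1' by (intro Li_eq_lerch) auto
    have an: "a ^ n = a * a ^ (n - 1)" using n by (cases n) auto
    have asuc: "a ^ Suc n = a * a ^ n" by simp
    have nn: "real n ^ (P + Q + 2) = real n ^ Suc P * real n ^ Suc Q" by (simp flip: power_add power_Suc)
    \<comment> \<open>Pure algebra with a^2 = \<sigma>^2 = 1, stated for opaque letters: M stands
      for n^p, N for n^q and A for a^(n-1).\<close>
    have gen: "- \<sigma> * f * a * (1 / 2 * \<sigma> * ((1 + \<sigma>) * (c * lp) * (a * lq) - \<sigma> * (b * lb) / N
        - 1 / N * (2 * a * b * (M * N) * s4 + (2 * (a * A) * s3 + a * (a * A) * b * s5)))) =
       1 / 2 * a * b * \<sigma> * f * (1 / N) * lb - 1 / 2 * c * (1 + \<sigma>) * f * lq * lp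
         + A * (1 / N) * f * s3 + b * M * f * s4 + 1 / 2 * c * (1 / N) * f * s5"
      if N: "N \<noteq> 0" "c = a * A * b" for c f lp lq lb N M A s3 s4 s5 :: real
    proof -
      have aa: "a * (a * y) = y" for y using a by auto
      have ss: "\<sigma> * (\<sigma> * y) = y" for y using \<sigma>(1) by (metis mult.assoc mult_1)
      show ?thesis using N by (simp add: field_simps aa ss)
    qed
    show ?thesis unfolding V_def L 1 2 3 asuc nn an by (rule gen) (use n in \<open>auto simp: c_def an\<close>)
  qed
  with A have A': "((\<lambda>x. - \<sigma> * fact Q * a * ?g x) has_integral V) {0..1}" by (simp only:)
  have pw: "real n powi (- int q) = 1 / real n ^ Suc Q"
    by (simp add: Q power_int_minus divide_inverse del: power_Suc of_nat_Suc)
  have "((\<lambda>x. ln x ^ (q - 1) * polylog p (b * x ^ n) / (1 - a * x)) has_integral V) {0..1}"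
    by (rule has_integral_spike_finite[OF _ B A']) (rule finite.intros | assumption)+
  then show ?thesis
    unfolding S pw by (simp only: V_def P Q \<sigma>_def c_def diff_Suc_1 add_Suc_right add_Suc add_2_eq_Suc' mult.assoc)
qed

section \<open>Inversion of the polylogarithm\<close>

lemma has_integral_scale:
  fixes f :: "real \<Rightarrow> real"
  assumes f: "(f has_integral I) {s..e}" and Y: "Y > 0"
  shows "((\<lambda>y. f (y / Y) / Y) has_integral I) {Y * s..Y * e}"
proof -
  have "((\<lambda>y. f (1 / Y * y)) has_integral (1 / \<bar>1 / Y\<bar>) *\<^sub>R I) ((\<lambda>x. x / (1 / Y)) ` {s..e})"
    using f Y by (intro has_integral_stretch_real) auto
  also have "(\<lambda>x. x / (1 / Y)) ` {s..e} = {Y * s..Y * e}"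
    using Y by (simp add: mult.commute[of _ Y])
  finally have "((\<lambda>y. f (y / Y)) has_integral Y * I) {Y * s..Y * e}" using Y by simp
  from has_integral_mult_right[OF this, of "1 / Y"] show ?thesis using Y by simp
qed

lemma has_integral_neg_ln_power_geometric:
  assumes b: "b \<in> {1, -1}" and j: "j \<ge> 1"
  shows "((\<lambda>w. (- ln w) ^ j * (b / (1 - b * w))) has_integral fact j * Li (Suc j) b) {0..1}"
proof -
  have "((\<lambda>w. log_kernel (Suc j) w * (b / (1 - b * w))) has_integral Li (Suc j) b) {0..1}"
    using b j by (intro has_integral_log_kernel_geometric) auto
  from has_integral_mult_right[OF this, of "fact j"] show ?thesis
    by (simp add: log_kernel_def)
qed

context
  fixes Y b L :: real and N :: nat
  assumes Y: "0 < Y" "Y < 1" and b: "b \<in> {1, -1}"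
  defines "L \<equiv> - ln Y"
begin

text \<open>Below the pole at \<open>Y\<close> substitute \<open>w = y / Y\<close>, above it \<open>w = Y / y\<close>. Both parts of the principal
  value then live on subintervals of \<open>[0, 1]\<close>, and the singularities at \<open>w = 1\<close> cancel.\<close>

definition inner_part :: "real \<Rightarrow> real" where
  "inner_part w = (ln w + L) ^ N * (b / (1 - b * w))"

text \<open>The substitution w = Y / y sends the kernel to -(b / (1 - b w) + 1 / w), by b^2 = 1;
  this is the second summand, which is integrated in closed form.\<close>

definition outer_part :: "real \<Rightarrow> real" where
  "outer_part w = (ln w + L) ^ N / w"

text \<open>The binomial expansion of ((L - ln w)^N - (L + ln w)^N) b / (1 - b w), the excess of the
  part below the pole over its mirror image. Even j cancel, and the factor vanishes at w = 1. The
  expanded form is ready for termwise integration.\<close>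

definition folded_part :: "real \<Rightarrow> real" where
  "folded_part w = (\<Sum>j\<le>N. real (N choose j) * L ^ (N - j) * (1 - (-1) ^ j) * ((- ln w) ^ j * (b / (1 - b * w))))"

definition split_integrand :: "real \<Rightarrow> real" where
  "split_integrand y = (- ln y) ^ N * (b / (Y - b * y))"

lemma folded_part_eq: "folded_part w = ((L - ln w) ^ N - (L + ln w) ^ N) * (b / (1 - b * w))"
proof -
  have e: "(- ln w + L) ^ N = (\<Sum>j\<le>N. real (N choose j) * (- ln w) ^ j * L ^ (N - j))"
    "(ln w + L) ^ N = (\<Sum>j\<le>N. real (N choose j) * ln w ^ j * L ^ (N - j))"
    by (rule binomial_ring)+
  have m: "ln w ^ j = (-1) ^ j * (- ln w) ^ j" for j
    using power_mult_distrib[of "-1" "- ln w" j] by simp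
  have "(L - ln w) ^ N - (L + ln w) ^ N = (- ln w + L) ^ N - (ln w + L) ^ N" by (simp add: add.commute)
  also have "\<dots> = (\<Sum>j\<le>N. real (N choose j) * L ^ (N - j) * (1 - (-1) ^ j) * (- ln w) ^ j)"
    unfolding e sum_subtractf [symmetric] by (intro sum.cong refl) (simp add: m algebra_simps)
  finally show ?thesis
    by (simp only: folded_part_def sum_distrib_right mult.assoc)
qed

lemma has_integral_folded_part:
  "(folded_part has_integral fact N * (2 * (\<Sum>k = 1..Suc N div 2. b * lerch b (2 * k) 1 * L ^ (Suc N - 2 * k) / fact (Suc N - 2 * k)))) {0..1}"
proof -
  define h where "h i = L ^ (Suc N - i) / fact (Suc N - i) * Li i b" for i
  have "(folded_part has_integral (\<Sum>j\<le>N. fact N * ((1 + (-1) ^ Suc j) * h (Suc j)))) {0..1}"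
    unfolding folded_part_def [abs_def]
  proof (intro has_integral_sum)
    fix j assume j: "j \<in> {..N}"
    show "((\<lambda>w. real (N choose j) * L ^ (N - j) * (1 - (-1) ^ j) * ((- ln w) ^ j * (b / (1 - b * w)))) has_integral
        fact N * ((1 + (-1) ^ Suc j) * h (Suc j))) {0..1}"
    \<comment> \<open>For b = 1 the integral with j = 0 diverges, but its coefficient is 0. Only odd
      j count, so the orders j + 1 are even.\<close>
    proof (cases "j = 0")
      case False
      have "((\<lambda>w. real (N choose j) * L ^ (N - j) * (1 - (-1) ^ j) * ((- ln w) ^ j * (b / (1 - b * w)))) has_integral
        real (N choose j) * L ^ (N - j) * (1 - (-1) ^ j) * (fact j * Li (Suc j) b)) {0..1}"
        using False b by (intro has_integral_mult_right has_integral_neg_ln_power_geometric) auto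
      moreover have "real (N choose j) * fact j = fact N / fact (N - j)"
        using j by (simp add: binomial_fact)
      moreover have "real (N choose j) * L ^ (N - j) * (1 - (-1) ^ j) * (fact j * Li (Suc j) b) =
          (real (N choose j) * fact j) * (L ^ (N - j) * (1 - (-1) ^ j) * Li (Suc j) b)"
        by (simp only: mult_ac)
      ultimately show ?thesis by (simp add: h_def mult_ac)
    qed simp
  qed simp
  also have "(\<Sum>j\<le>N. fact N * ((1 + (-1) ^ Suc j) * h (Suc j))) = fact N * (\<Sum>j\<le>N. (1 + (-1) ^ Suc j) * h (Suc j))"
    by (simp only: sum_distrib_left)
  also have "(\<Sum>j\<le>N. (1 + (-1) ^ Suc j) * h (Suc j)) = 2 * (\<Sum>k = 1..Suc N div 2. h (2 * k))"
    by (rule sum_even_indices)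
  also have "(\<Sum>k = 1..Suc N div 2. h (2 * k)) = (\<Sum>k = 1..Suc N div 2. b * lerch b (2 * k) 1 * L ^ (Suc N - 2 * k) / fact (Suc N - 2 * k))"
  proof (rule sum.cong[OF refl])
    fix k assume "k \<in> {1..Suc N div 2}"
    then have "Li (2 * k) b = b * lerch b (2 * k) 1"
      using b by (intro Li_eq_lerch) auto
    then show "h (2 * k) = b * lerch b (2 * k) 1 * L ^ (Suc N - 2 * k) / fact (Suc N - 2 * k)"
      by (simp add: h_def)
  qed
  finally show ?thesis .
qed

text \<open>Putting w = Y x turns ln w + L into ln x and b / (1 - b w) dw into the geometric kernel
  of b Y. This is the source of Li_p(b Y).\<close>

lemma has_integral_inner_part:
  "(inner_part has_integral (-1) ^ N * fact N * Li (Suc N) (b * Y)) {0..Y}"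
proof -
  have bY: "\<bar>b * Y\<bar> < 1" using b Y by (auto simp: abs_mult)
  have "((\<lambda>x. log_kernel (Suc N) x * (b * Y / (1 - b * Y * x))) has_integral Li (Suc N) (b * Y)) {0..1}"
    using bY by (intro has_integral_log_kernel_geometric) auto
  from has_integral_scale[OF has_integral_mult_right[OF this, of "(-1) ^ N * fact N"] Y(1)]
  have A: "((\<lambda>y. (-1) ^ N * fact N * (log_kernel (Suc N) (y / Y) * (b * Y / (1 - b * Y * (y / Y)))) / Y) has_integral
      (-1) ^ N * fact N * Li (Suc N) (b * Y)) {0..Y}"
    by simp
  have "inner_part y = (-1) ^ N * fact N * (log_kernel (Suc N) (y / Y) * (b * Y / (1 - b * Y * (y / Y)))) / Y"
    if "y \<in> {0..Y} - {0}" for y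
  proof -
    have "(-1) ^ N * (- ln (y / Y)) ^ N = (ln y + L) ^ N"
      using power_mult_distrib[of "-1" "- ln (y / Y)" N] that Y by (simp add: ln_div L_def)
    then show ?thesis using that Y
      by (simp add: inner_part_def log_kernel_def)
  qed
  from has_integral_spike_finite[OF finite.insertI[OF finite.emptyI] this A] show ?thesis .
qed

lemma has_integral_outer_part:
  assumes "Y \<le> d" shows "(outer_part has_integral (ln d + L) ^ Suc N / real (Suc N)) {Y..d}"
proof -
  have "(outer_part has_integral ((ln d + L) ^ Suc N / real (Suc N) - (ln Y + L) ^ Suc N / real (Suc N))) {Y..d}"
  proof (rule fundamental_theorem_of_calculus[OF assms])
    fix x assume "x \<in> {Y..d}"
    then have x: "x > 0" using Y by auto
    have "((\<lambda>x. ln x + L) has_real_derivative 1 / x) (at x within {Y..d})"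
      using x by (auto intro!: derivative_eq_intros)
    from DERIV_cdivide[OF DERIV_power_Suc[OF this, of N], of "real (Suc N)"]
    have "((\<lambda>x. (ln x + L) ^ Suc N / real (Suc N)) has_real_derivative outer_part x) (at x within {Y..d})"
    proof (rule DERIV_cong)
      have "1 + real N \<noteq> 0" by linarith
      then show "(1 + real N) * (1 / x * (ln x + L) ^ N) / real (Suc N) = outer_part x"
        by (simp add: outer_part_def)
    qed
    then show "((\<lambda>x. (ln x + L) ^ Suc N / real (Suc N)) has_vector_derivative outer_part x) (at x within {Y..d})"
      by (simp add: has_real_derivative_iff_has_vector_derivative)
  qed
  then show ?thesis by (simp add: L_def)
qed

lemma denominator_nonzero: "0 \<le> w \<Longrightarrow> w < 1 \<or> (w \<le> 1 \<and> b = -1) \<Longrightarrow> 1 - b * w \<noteq> 0"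
  using b by auto

lemma continuous_on_parts:
  assumes "Y \<le> s" and "e < 1 \<or> (e \<le> 1 \<and> b = -1)"
  shows "continuous_on {s..e} inner_part" and "continuous_on {s..e} outer_part"
proof -
  have "1 - b * w \<noteq> 0" if "w \<in> {s..e}" for w
    using that assms Y by (intro denominator_nonzero) auto
  then show "continuous_on {s..e} inner_part"
    unfolding inner_part_def [abs_def] using Y assms by (intro continuous_intros) auto
  show "continuous_on {s..e} outer_part"
    unfolding outer_part_def [abs_def] using Y assms by (intro continuous_intros) auto
qed

text \<open>Under y = Y w the integrand is \<open>folded_part\<close> plus
  \<open>inner_part\<close>. The cut d stays below 1 when b = 1; for b = -1 there is no pole and d =
  1 is allowed.\<close>

lemma split_integrand_below:
  assumes d: "Y \<le> d" "d < 1 \<or> (d \<le> 1 \<and> b = -1)"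
  shows "(split_integrand has_integral (integral {0..d} folded_part
      + (-1) ^ N * fact N * Li (Suc N) (b * Y) + integral {Y..d} inner_part)) {0..Y * d}"
proof -
  have d1: "d \<le> 1" using d by auto
  have "(inner_part has_integral (-1) ^ N * fact N * Li (Suc N) (b * Y) + integral {Y..d} inner_part) {0..d}"
    using Y d by (intro has_integral_combine[OF _ _ has_integral_inner_part] integrable_integral
        integrable_continuous_real continuous_on_parts) auto
  moreover have "(folded_part has_integral integral {0..d} folded_part) {0..d}"
  proof (intro integrable_integral)
    have "folded_part integrable_on {0..1}"
      using has_integral_folded_part by (rule has_integral_integrable)
    then show "folded_part integrable_on {0..d}"
      by (rule integrable_subinterval_real) (use d1 in simp)
  qed
  ultimately have "((\<lambda>w. folded_part w + inner_part w) has_integral (integral {0..d} folded_part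
      + ((-1) ^ N * fact N * Li (Suc N) (b * Y) + integral {Y..d} inner_part))) {0..d}"
    by (intro has_integral_add)
  from has_integral_scale[OF this Y(1)]
  have A: "((\<lambda>y. (folded_part (y / Y) + inner_part (y / Y)) / Y) has_integral (integral {0..d} folded_part
      + (-1) ^ N * fact N * Li (Suc N) (b * Y) + integral {Y..d} inner_part)) {0..Y * d}"
    by (simp add: add.assoc)
  have "split_integrand y = (folded_part (y / Y) + inner_part (y / Y)) / Y" if "y \<in> {0..Y * d} - {0}" for y
  proof -
    have "folded_part (y / Y) + inner_part (y / Y) = (L - ln (y / Y)) ^ N * (b / (1 - b * (y / Y)))"
      unfolding folded_part_eq inner_part_def by (simp add: left_diff_distrib diff_divide_distrib add.commute)
    also have "L - ln (y / Y) = - ln y" using that Y by (simp add: L_def ln_div)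
    also have "b / (1 - b * (y / Y)) = Y * (b / (Y - b * y))" using Y by (simp add: field_simps)
    finally show ?thesis using Y by (simp add: split_integrand_def)
  qed
  from has_integral_spike_finite[OF finite.insertI[OF finite.emptyI] this A] show ?thesis .
qed

text \<open>Orientation is reversed by w = Y / y, so \<open>inner_part\<close> appears with the
  opposite sign and cancels against the part below the pole.\<close>

lemma split_integrand_above:
  assumes d: "Y \<le> d" "d < 1 \<or> (d \<le> 1 \<and> b = -1)"
  shows "(split_integrand has_integral (- integral {Y..d} inner_part - (ln d + L) ^ Suc N / real (Suc N))) {Y / d..1}"
proof -
  have d0: "d > 0" using d Y by simp
  have yd: "Y / d > 0" "Y / d \<le> 1" using d d0 Y by simp_all
  have "((\<lambda>y. (- Y / y ^ 2) *\<^sub>R (inner_part (Y / y) + outer_part (Y / y))) has_integral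
     (integral {Y / (Y / d)..Y / 1} (\<lambda>w. inner_part w + outer_part w)
      - integral {Y / 1..Y / (Y / d)} (\<lambda>w. inner_part w + outer_part w))) {Y / d..1}"
  proof (rule has_integral_substitution_general[where s = "{}" and c = Y and d = d])
    show "(\<lambda>y. Y / y) ` {Y / d..1} \<subseteq> {Y..d}"
    proof clarify
      fix y assume y: "y \<in> {Y / d..1}"
      then have "y > 0" using yd by auto
      then show "Y / y \<in> {Y..d}" using y Y d0 by (auto simp: field_simps)
    qed
    show "continuous_on {Y..d} (\<lambda>w. inner_part w + outer_part w)"
      using d by (intro continuous_intros continuous_on_parts) auto
    show "continuous_on {Y / d..1} (\<lambda>y. Y / y)"
      using yd by (intro continuous_intros) auto
    show "((\<lambda>y. Y / y) has_real_derivative - Y / y ^ 2) (at y within {Y / d..1})" if "y \<in> {Y / d..1} - {}" for y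
      using that yd by (auto intro!: derivative_eq_intros simp: power2_eq_square)
  qed (use yd in auto)
  moreover have "Y / (Y / d) = d" using Y by simp
  \<comment> \<open>The substitution rule also subtracts the integral over the reversed interval,
    which is empty or a single point.\<close>
  moreover have "integral {d..Y} (\<lambda>w. inner_part w + outer_part w) = 0"
    using d by (cases "d = Y") auto
  moreover have "((\<lambda>w. inner_part w + outer_part w) has_integral integral {Y..d} inner_part + (ln d + L) ^ Suc N / real (Suc N)) {Y..d}"
    using d by (intro has_integral_add has_integral_outer_part integrable_integral integrable_continuous_real continuous_on_parts) auto
  then have "integral {Y..d} (\<lambda>w. inner_part w + outer_part w) = integral {Y..d} inner_part + (ln d + L) ^ Suc N / real (Suc N)"
    by (rule integral_unique)
  ultimately have A: "((\<lambda>y. (- Y / y ^ 2) * (inner_part (Y / y) + outer_part (Y / y))) has_integral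
     (- integral {Y..d} inner_part - (ln d + L) ^ Suc N / real (Suc N))) {Y / d..1}"
    by (simp del: of_nat_Suc power_Suc)
  have B: "(- Y / y ^ 2) * (inner_part (Y / y) + outer_part (Y / y)) = split_integrand y" if y: "y \<in> {Y / d..1}" for y
  proof -
    have y0: "y > 0" using y yd by auto
    have l: "ln (Y / y) + L = - ln y" using y0 Y by (simp add: L_def ln_div)
    have "Y / y \<le> d" using y y0 d0 by (simp add: field_simps)
    then have "Y / y < 1 \<or> (Y / y \<le> 1 \<and> b = -1)"
      using d(2) by (metis order_le_less_trans order_trans)
    moreover have "0 \<le> Y / y" using Y y0 by simp
    ultimately have nz: "1 - b * (Y / y) \<noteq> 0" by (intro denominator_nonzero)
    have "(- Y / y ^ 2) * (b / (1 - b * (Y / y)) + 1 / (Y / y)) = b / (Y - b * y)"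
    proof -
      have "y - b * Y \<noteq> 0" using nz y0 by (auto simp: field_simps)
      moreover have "b * b = 1" using b by auto
      moreover have "Y - b * y = - b * (y - b * Y)" using \<open>b * b = 1\<close> by (simp add: algebra_simps flip: mult.assoc)
      moreover have "b / (- b * (y - b * Y)) = - 1 / (y - b * Y)" using b by auto
      moreover have "b / (1 - b * (Y / y)) = b * y / (y - b * Y)" using y0 nz by (simp add: field_simps)
      moreover have "(- Y / y ^ 2) * (b * y / (y - b * Y) + 1 / (Y / y)) = - 1 / (y - b * Y)"
        using \<open>y - b * Y \<noteq> 0\<close> y0 Y by (simp add: divide_simps power2_eq_square) (simp add: algebra_simps)
      ultimately show ?thesis by simp
    qed
    moreover have "(- Y / y ^ 2) * (inner_part (Y / y) + outer_part (Y / y)) =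
       (- ln y) ^ N * ((- Y / y ^ 2) * (b / (1 - b * (Y / y)) + 1 / (Y / y)))"
      unfolding inner_part_def outer_part_def l by (simp add: algebra_simps)
    ultimately show ?thesis by (simp only: split_integrand_def)
  qed
  show ?thesis
    by (rule has_integral_eq[OF B A])
qed

section \<open>Principal value and the inversion formula\<close>

definition split_value :: real where
  "split_value = integral {0..1} folded_part + (-1) ^ N * fact N * Li (Suc N) (b * Y) - L ^ Suc N / real (Suc N)"

lemma split_integrand_principal_value:
  assumes b1: "b = 1"
  shows "((\<lambda>\<epsilon>. integral {0..Y - \<epsilon>} split_integrand + integral {Y + \<epsilon>..1} split_integrand) \<longlongrightarrow> split_value) (at_right 0)"
proof -
  \<comment> \<open>The cuts Y - \<epsilon> and Y + \<epsilon>, symmetric in y, correspond to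
    slightly different cuts in w: d1 below the pole and d2 above it. \<open>R\<close> is the part of
    \<open>inner_part\<close> left over between them.\<close>
  define d1 where "d1 \<epsilon> = (Y - \<epsilon>) / Y" for \<epsilon>
  define d2 where "d2 \<epsilon> = Y / (Y + \<epsilon>)" for \<epsilon>
  define I where "I x = integral {0..x} folded_part" for x
  define R where "R \<epsilon> = integral {d1 \<epsilon>..d2 \<epsilon>} inner_part" for \<epsilon>
  \<comment> \<open>d1 >= Y holds exactly for \<epsilon> <= Y (1 - Y), and this bound also keeps Y +
    \<epsilon> below 1.\<close>
  have e0: "0 < Y * (1 - Y)" using Y by simp
  have ev: "eventually (\<lambda>\<epsilon>. \<epsilon> \<in> {0<..<Y * (1 - Y)}) (at_right 0)"
    by (rule eventually_at_right_real[OF e0])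
  have d: "Y \<le> d1 \<epsilon>" "d1 \<epsilon> < 1" "Y \<le> d2 \<epsilon>" "d2 \<epsilon> < 1" "d1 \<epsilon> \<le> d2 \<epsilon>" "Y * d1 \<epsilon> = Y - \<epsilon>" "Y / d2 \<epsilon> = Y + \<epsilon>"
    if \<epsilon>: "\<epsilon> \<in> {0<..<Y * (1 - Y)}" for \<epsilon>
  proof -
    have "Y * (1 - Y) \<le> 1 - Y" using Y by (intro mult_left_le_one_le) auto
    with \<epsilon> have "\<epsilon> < 1 - Y" by simp
    then show "Y \<le> d2 \<epsilon>" using \<epsilon> Y by (simp add: d2_def pos_le_divide_eq mult_left_le)
    show "Y \<le> d1 \<epsilon>" using \<epsilon> Y by (simp add: d1_def pos_le_divide_eq algebra_simps)
    show "d1 \<epsilon> < 1" "d2 \<epsilon> < 1" "Y * d1 \<epsilon> = Y - \<epsilon>" "Y / d2 \<epsilon> = Y + \<epsilon>" using \<epsilon> Y by (simp_all add: d1_def d2_def)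
    have "(Y - \<epsilon>) * (Y + \<epsilon>) \<le> Y * Y" using \<epsilon> by (simp add: algebra_simps)
    then show "d1 \<epsilon> \<le> d2 \<epsilon>" using \<epsilon> Y by (simp add: d1_def d2_def divide_simps)
  qed
  have eq: "I (d1 \<epsilon>) + (-1) ^ N * fact N * Li (Suc N) (b * Y) - R \<epsilon> - (ln (d2 \<epsilon>) + L) ^ Suc N / real (Suc N)
      = integral {0..Y - \<epsilon>} split_integrand + integral {Y + \<epsilon>..1} split_integrand"
    if \<epsilon>: "\<epsilon> \<in> {0<..<Y * (1 - Y)}" for \<epsilon>
  proof -
    note D = d[OF \<epsilon>]
    have "integral {0..Y - \<epsilon>} split_integrand = I (d1 \<epsilon>) + (-1) ^ N * fact N * Li (Suc N) (b * Y) + integral {Y..d1 \<epsilon>} inner_part"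
      using split_integrand_below[of "d1 \<epsilon>"] D unfolding I_def by (auto intro!: integral_unique)
    moreover have "integral {Y + \<epsilon>..1} split_integrand = - integral {Y..d2 \<epsilon>} inner_part - (ln (d2 \<epsilon>) + L) ^ Suc N / real (Suc N)"
      using split_integrand_above[of "d2 \<epsilon>"] D by (auto intro!: integral_unique)
    moreover have "integral {Y..d1 \<epsilon>} inner_part + R \<epsilon> = integral {Y..d2 \<epsilon>} inner_part"
      unfolding R_def using D
      by (intro Henstock_Kurzweil_Integration.integral_combine integrable_continuous_real continuous_on_parts) auto
    ultimately show ?thesis by simp
  qed
  have R: "(R \<longlongrightarrow> 0) (at_right 0)"
  proof (rule Lim_null_comparison)
    show "eventually (\<lambda>\<epsilon>. norm (R \<epsilon>) \<le> L ^ N / Y * \<epsilon>) (at_right 0)"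
      using ev
    proof eventually_elim
      case (elim \<epsilon>)
      note D = d[OF elim]
      \<comment> \<open>The gap d2 - d1 is of order \<epsilon>^2 and the integrand of order 1 /
        \<epsilon>, so the mismatch is O(\<epsilon>).\<close>
      have "norm (R \<epsilon>) \<le> L ^ N / (1 - d2 \<epsilon>) * (d2 \<epsilon> - d1 \<epsilon>)"
        unfolding R_def
      proof (rule integral_bound)
        show "d1 \<epsilon> \<le> d2 \<epsilon>" "continuous_on {d1 \<epsilon>..d2 \<epsilon>} inner_part" using D by (auto intro!: continuous_on_parts)
        show "norm (inner_part w) \<le> L ^ N / (1 - d2 \<epsilon>)" if w: "w \<in> {d1 \<epsilon>..d2 \<epsilon>}" for w
        proof -
          have "w \<ge> Y" "w < 1" using w D by auto
          then have "0 \<le> ln w + L" "ln w + L \<le> L" using Y by (auto simp: L_def)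
          then have "(ln w + L) ^ N \<le> L ^ N" "0 \<le> (ln w + L) ^ N" by (auto intro: power_mono)
          moreover have "1 / (1 - w) \<le> 1 / (1 - d2 \<epsilon>)" using w D by (intro divide_left_mono) auto
          ultimately have "(ln w + L) ^ N * (1 / (1 - w)) \<le> L ^ N * (1 / (1 - d2 \<epsilon>))"
            using \<open>w < 1\<close> by (intro mult_mono) auto
          then show ?thesis
            unfolding inner_part_def using \<open>w < 1\<close> \<open>0 \<le> (ln w + L) ^ N\<close> b1 by (simp add: abs_mult)
        qed
      qed
      also have "\<dots> = L ^ N / Y * \<epsilon>"
      proof -
        have e1: "1 - d2 \<epsilon> = \<epsilon> / (Y + \<epsilon>)" using elim Y by (simp add: d2_def field_simps)
        have e2: "d2 \<epsilon> - d1 \<epsilon> = \<epsilon> * \<epsilon> / (Y * (Y + \<epsilon>))"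
          using elim Y by (simp add: d1_def d2_def divide_simps) (simp add: algebra_simps)
        have "Y + \<epsilon> \<noteq> 0" "\<epsilon> \<noteq> 0" using elim Y by auto
        then show ?thesis unfolding e1 e2 using Y by (simp add: divide_simps)
      qed
      finally show ?case .
    qed
    show "((\<lambda>\<epsilon>. L ^ N / Y * \<epsilon>) \<longlongrightarrow> 0) (at_right 0)"
      using tendsto_mult[OF tendsto_const tendsto_ident_at, of "L ^ N / Y" 0] by simp
  qed
  have I: "((\<lambda>\<epsilon>. I (d1 \<epsilon>)) \<longlongrightarrow> I 1) (at_right 0)"
  proof -
    have "continuous_on {0..1} I"
      unfolding I_def [abs_def]
      by (rule indefinite_integral_continuous_1[OF has_integral_integrable[OF has_integral_folded_part]])
    moreover have "(d1 \<longlongrightarrow> 1) (at_right 0)"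
      unfolding d1_def [abs_def] using Y by (auto intro!: tendsto_eq_intros)
    moreover have "eventually (\<lambda>\<epsilon>. d1 \<epsilon> \<in> {0..1}) (at_right 0)"
      using ev
    proof eventually_elim
      case (elim \<epsilon>)
      show ?case using d(1)[OF elim] d(2)[OF elim] Y by auto
    qed
    ultimately show ?thesis by (intro continuous_on_tendsto_compose[of "{0..1}" I]) auto
  qed
  have "(d2 \<longlongrightarrow> 1) (at_right 0)"
    unfolding d2_def [abs_def] using Y by (auto intro!: tendsto_eq_intros)
  then have "((\<lambda>\<epsilon>. ln (d2 \<epsilon>) + L) \<longlongrightarrow> ln 1 + L) (at_right 0)"
    by (intro tendsto_add tendsto_ln tendsto_const) auto
  then have E: "((\<lambda>\<epsilon>. (ln (d2 \<epsilon>) + L) ^ Suc N / real (Suc N)) \<longlongrightarrow> (ln 1 + L) ^ Suc N / real (Suc N)) (at_right 0)"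
    by (intro tendsto_divide tendsto_power tendsto_const) auto
  have "((\<lambda>\<epsilon>. I (d1 \<epsilon>) + (-1) ^ N * fact N * Li (Suc N) (b * Y) - R \<epsilon> - (ln (d2 \<epsilon>) + L) ^ Suc N / real (Suc N))
      \<longlongrightarrow> I 1 + (-1) ^ N * fact N * Li (Suc N) (b * Y) - 0 - (ln 1 + L) ^ Suc N / real (Suc N)) (at_right 0)"
    by (rule tendsto_diff[OF tendsto_diff[OF tendsto_add[OF I tendsto_const] R] E])
  moreover have "eventually (\<lambda>\<epsilon>. I (d1 \<epsilon>) + (-1) ^ N * fact N * Li (Suc N) (b * Y) - R \<epsilon> - (ln (d2 \<epsilon>) + L) ^ Suc N / real (Suc N)
      = integral {0..Y - \<epsilon>} split_integrand + integral {Y + \<epsilon>..1} split_integrand) (at_right 0)"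
    using ev by eventually_elim (rule eq)
  ultimately show ?thesis
    using Lim_transform_eventually by (fastforce simp: split_value_def I_def)
qed

lemma polylog_eq_split_value: "polylog (Suc N) (b / Y) = split_value / fact N"
proof -
  have f: "polylog_integrand (Suc N) (b / Y) = (\<lambda>y. (-1) ^ N * split_integrand y)"
  proof
    fix y :: real
    have "ln y ^ N = (-1) ^ N * (- ln y) ^ N"
      using power_mult_distrib[of "-1" "- ln y" N] by simp
    moreover have "b / Y / (1 - b / Y * y) = b / (Y - b * y)"
    proof -
      have "Y * (1 - b / Y * y) = Y - b * y" using Y by (simp add: field_simps)
      then show ?thesis by (simp only: divide_divide_eq_left)
    qed
    moreover have "polylog_integrand (Suc N) (b / Y) y = (b / Y / (1 - b / Y * y)) * ln y ^ N"
      by (simp add: polylog_integrand_def)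
    ultimately show "polylog_integrand (Suc N) (b / Y) y = (-1) ^ N * split_integrand y"
      unfolding split_integrand_def by (simp only: mult_ac)
  qed
  have sgn: "(-1 :: real) ^ N * ((-1) ^ N * x) = x" for x by (cases "even N") auto
  show ?thesis
  proof (cases "b = 1")
    case True
    have "1 / Y > 1" using Y by simp
    have "((\<lambda>\<epsilon>. (-1) ^ N * (integral {0..Y - \<epsilon>} split_integrand + integral {Y + \<epsilon>..1} split_integrand)) \<longlongrightarrow> (-1) ^ N * split_value) (at_right 0)"
      by (intro tendsto_intros split_integrand_principal_value True)
    then have "Lim (at_right 0) (\<lambda>\<epsilon>. (-1) ^ N * (integral {0..Y - \<epsilon>} split_integrand + integral {Y + \<epsilon>..1} split_integrand)) = (-1) ^ N * split_value"
      by (intro tendsto_Lim) auto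
    then have "pv_integral 0 Y 1 (polylog_integrand (Suc N) (b / Y)) = (-1) ^ N * split_value"
      unfolding f pv_integral_def by (simp only: integral_mult_right distrib_left)
    then show ?thesis using True \<open>1 / Y > 1\<close> sgn[of split_value] by (simp add: polylog_def)
  next
    case False
    then have b': "b = -1" using b by auto
    moreover have "1 / Y > 0" using Y by simp
    moreover have "b / Y = - (1 / Y)" using b' by simp
    ultimately have "b / Y \<le> 1" by linarith
    have "(split_integrand has_integral (integral {0..1} folded_part
      + (-1) ^ N * fact N * Li (Suc N) (b * Y) + integral {Y..1} inner_part) +
        (- integral {Y..1} inner_part - (ln 1 + L) ^ Suc N / real (Suc N))) {0..1}"
      \<comment> \<open>Without a pole both halves can be taken with d = 1, and the integrals of
        \<open>inner_part\<close> cancel exactly.\<close>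
      using split_integrand_below[of 1] split_integrand_above[of 1] Y b'
      by (intro has_integral_combine[of 0 Y 1]) auto
    then have "integral {0..1} split_integrand = split_value"
      by (intro integral_unique) (simp add: split_value_def algebra_simps)
    then have "integral {0..1} (polylog_integrand (Suc N) (b / Y)) = (-1) ^ N * split_value"
      unfolding f by (simp only: integral_mult_right)
    then show ?thesis using \<open>b / Y \<le> 1\<close> sgn[of split_value] by (simp add: polylog_def)
  qed
qed

text \<open>The isolated power -L^(N+1) / (N + 1)! is the k = 0 term of the sum, again because
  \<open>lerch b 0 1\<close> is -b/2.\<close>

lemma polylog_inversion_aux:
  "polylog (Suc N) (b / Y) = (-1) ^ N * Li (Suc N) (b * Y)
     + 2 * b * (\<Sum>k = 0..Suc N div 2. lerch b (2 * k) 1 * L ^ (Suc N - 2 * k) / fact (Suc N - 2 * k))"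
proof -
  define g where "g k = lerch b (2 * k) 1 * L ^ (Suc N - 2 * k) / fact (Suc N - 2 * k)" for k
  have "2 * b * g 0 = - (L ^ Suc N / real (Suc N)) / fact N"
    using b by (auto simp: g_def lerch_def field_simps)
  moreover have "integral {0..1} folded_part = fact N * (2 * (\<Sum>k = 1..Suc N div 2. b * g k))"
    using integral_unique[OF has_integral_folded_part] by (simp add: g_def mult.assoc)
  then have "integral {0..1} folded_part = fact N * (2 * b * (\<Sum>k = 1..Suc N div 2. g k))"
    by (simp add: sum_distrib_left mult_ac)
  moreover have "(\<Sum>k = 0..Suc N div 2. g k) = g 0 + (\<Sum>k = 1..Suc N div 2. g k)"
    by (simp add: sum.atLeast_Suc_atMost)
  ultimately show ?thesis
    unfolding polylog_eq_split_value split_value_def g_def [symmetric]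
    by (simp add: add_divide_distrib diff_divide_distrib distrib_left del: of_nat_Suc power_Suc)
qed

end

lemma polylog_inversion:
  assumes Y: "0 < Y" "Y < 1" and b: "b \<in> {1, -1}" and p: "p \<ge> 1"
  shows "polylog p (b / Y) = (-1) ^ (p - 1) * polylog p (b * Y)
     + 2 * b * (\<Sum>k = 0..p div 2. lerch b (2 * k) 1 * (- ln Y) ^ (p - 2 * k) / fact (p - 2 * k))"
proof -
  have "\<bar>b * Y\<bar> < 1" using b Y by (auto simp: abs_mult)
  then show ?thesis
    using polylog_inversion_aux[OF Y b, of "p - 1"] p by (simp add: polylog_eq_series)
qed

lemma has_integral_ln_powers_geometric:
  assumes a: "a \<in> {1, -1}" and s: "s \<ge> 1" "a = 1 \<Longrightarrow> s \<ge> 2"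
  shows "((\<lambda>x. (- ln x) ^ (s - 1) / (1 - a * x)) has_integral fact (s - 1) * lerch a s 1) {0..1}"
proof -
  have "((\<lambda>x. log_kernel s x * (a / (1 - a * x))) has_integral Li s a) {0..1}"
    using a s by (intro has_integral_log_kernel_geometric) auto
  from has_integral_mult_right[OF this, of "fact (s - 1) * a"]
  have "((\<lambda>x. fact (s - 1) * a * (log_kernel s x * (a / (1 - a * x)))) has_integral fact (s - 1) * a * Li s a) {0..1}" .
  also have "fact (s - 1) * a * Li s a = fact (s - 1) * lerch a s 1"
    using a Li_eq_lerch[OF a s] by auto
  also have "(\<lambda>x. fact (s - 1) * a * (log_kernel s x * (a / (1 - a * x)))) = (\<lambda>x. (- ln x) ^ (s - 1) / (1 - a * x))"
    using a by (auto simp: log_kernel_def fun_eq_iff)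
  finally show ?thesis .
qed

text \<open>The powers of ln from the inversion merge with the power in the integral, giving order p
  + q - 2 k; the quotient of factorials is (q - 1)! times a binomial. If 2 k = p, the order is q,
  and \<open>a1\<close> excludes the divergent case.\<close>

lemma has_integral_inversion_remainder:
  fixes p q n :: nat and a b :: real
  assumes p: "p \<ge> 1" and q: "q \<ge> 1" and n: "n \<ge> 1" and pq: "odd (p + q)"
    and a: "a \<in> {1, -1}" and a1: "a \<noteq> 1 \<or> q \<noteq> 1"
  shows "((\<lambda>x. \<Sum>k = 0..p div 2. 2 * b * (lerch b (2 * k) 1 * real n ^ (p - 2 * k) / fact (p - 2 * k)) *
            ((-1) ^ (q - 1) * ((- ln x) ^ (p + q - 2 * k - 1) / (1 - a * x)))) has_integral
     2 * b * (- real n) ^ p * fact (q - 1) * (\<Sum>k = 0..p div 2. real ((p + q - 2 * k - 1) choose (q - 1)) *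
                real n powi (- 2 * int k) * lerch b (2 * k) 1 * lerch a (p + q - 2 * k) 1)) {0..1}"
proof -
  have sgn: "(-1 :: real) ^ (q - 1) = (-1) ^ p"
    using pq q by (cases "even p"; cases q) auto
  have "((\<lambda>x. \<Sum>k = 0..p div 2. 2 * b * (lerch b (2 * k) 1 * real n ^ (p - 2 * k) / fact (p - 2 * k)) *
            ((-1) ^ (q - 1) * ((- ln x) ^ (p + q - 2 * k - 1) / (1 - a * x)))) has_integral
     (\<Sum>k = 0..p div 2. 2 * b * (lerch b (2 * k) 1 * real n ^ (p - 2 * k) / fact (p - 2 * k)) *
            ((-1) ^ (q - 1) * (fact (p + q - 2 * k - 1) * lerch a (p + q - 2 * k) 1)))) {0..1}"
  proof (intro has_integral_sum has_integral_mult_right has_integral_ln_powers_geometric a)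
    fix k assume "k \<in> {0..p div 2}"
    then have k: "2 * k \<le> p" by auto
    show "1 \<le> p + q - 2 * k" using k q by linarith
    show "2 \<le> p + q - 2 * k" if "a = 1" using k q a1 that by auto
  qed simp
  also have "(\<Sum>k = 0..p div 2. 2 * b * (lerch b (2 * k) 1 * real n ^ (p - 2 * k) / fact (p - 2 * k)) *
            ((-1) ^ (q - 1) * (fact (p + q - 2 * k - 1) * lerch a (p + q - 2 * k) 1))) =
     2 * b * (- real n) ^ p * fact (q - 1) * (\<Sum>k = 0..p div 2. real ((p + q - 2 * k - 1) choose (q - 1)) *
                real n powi (- 2 * int k) * lerch b (2 * k) 1 * lerch a (p + q - 2 * k) 1)"
    unfolding sum_distrib_left
  proof (rule sum.cong[OF refl])
    fix k assume "k \<in> {0..p div 2}"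
    then have k: "2 * k \<le> p" by auto
    have c: "fact (p + q - 2 * k - 1) / fact (p - 2 * k) = fact (q - 1) * real ((p + q - 2 * k - 1) choose (q - 1))"
    proof -
      have "p + q - 2 * k - 1 - (q - 1) = p - 2 * k" using k q by linarith
      moreover have "q - 1 \<le> p + q - 2 * k - 1" using k by linarith
      ultimately show ?thesis by (simp add: binomial_fact)
    qed
    have e: "real n ^ (p - 2 * k) = real n ^ p * real n powi (- 2 * int k)"
    proof -
      have "real n ^ p = real n ^ (p - 2 * k) * real n ^ (2 * k)"
        using k by (simp flip: power_add)
      moreover have "real n powi (- 2 * int k) = inverse (real n ^ (2 * k))"
        by (simp add: power_int_def nat_mult_distrib power_inverse)
      ultimately show ?thesis using n by (simp add: field_simps)
    qed
    have m: "(- real n) ^ p = (-1) ^ p * real n ^ p" by (rule power_minus)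
    have "2 * b * (lerch b (2 * k) 1 * real n ^ (p - 2 * k) / fact (p - 2 * k)) *
            ((-1) ^ (q - 1) * (fact (p + q - 2 * k - 1) * lerch a (p + q - 2 * k) 1)) =
       2 * b * (lerch b (2 * k) 1 * (real n ^ p * real n powi (- 2 * int k))) *
            ((-1) ^ p * (fact (p + q - 2 * k - 1) / fact (p - 2 * k) * lerch a (p + q - 2 * k) 1))"
      unfolding sgn e by simp
    also have "\<dots> = 2 * b * (- real n) ^ p * fact (q - 1) * (real ((p + q - 2 * k - 1) choose (q - 1)) *
                real n powi (- 2 * int k) * lerch b (2 * k) 1 * lerch a (p + q - 2 * k) 1)"
      unfolding c m by (simp only: mult_ac)
    finally show "2 * b * (lerch b (2 * k) 1 * real n ^ (p - 2 * k) / fact (p - 2 * k)) *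
            ((-1) ^ (q - 1) * (fact (p + q - 2 * k - 1) * lerch a (p + q - 2 * k) 1)) =
       2 * b * (- real n) ^ p * fact (q - 1) * (real ((p + q - 2 * k - 1) choose (q - 1)) *
                real n powi (- 2 * int k) * lerch b (2 * k) 1 * lerch a (p + q - 2 * k) 1)" .
  qed
  finally show ?thesis .
qed

theorem theorem3:
  fixes p q n :: nat and a b :: real
  assumes "p \<ge> 1" and "q \<ge> 1" and "n \<ge> 1"
    and "odd (p + q)"
    and "a \<in> {1, -1}" and "b \<in> {1, -1}"
    and "a ^ n * b = 1 \<Longrightarrow> p \<noteq> 1"
    and "a = 1 \<Longrightarrow> q \<noteq> 1"
  shows
    "((\<lambda>x. ln x ^ (q - 1) * polylog p (b * x ^ n) / (1 - a * x)) has_integral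
        (1 / 2 * a * b * (-1) ^ q * fact (q - 1) * real n powi (- int q) * lerch b (p + q) 1
         - 1 / 2 * a ^ n * b * (1 + (-1) ^ q) * fact (q - 1) * lerch a q 1 * lerch (a ^ n * b) p 1
         + a ^ (n - 1) * real n powi (- int q) * fact (q - 1) *
             (\<Sum>j = 0..q div 2. real ((p + q - 2 * j - 1) choose (p - 1)) *
                lerch b (2 * j) 1 * lerch (a ^ n * b) (p + q - 2 * j) 1)
         + b * real n ^ p * fact (q - 1) *
             (\<Sum>k = 0..p div 2. real ((p + q - 2 * k - 1) choose (q - 1)) *
                real n powi (- 2 * int k) * lerch b (2 * k) 1 * lerch a (p + q - 2 * k) 1)
         + 1 / 2 * a ^ n * b * real n powi (- int q) * fact (q - 1) *
             (\<Sum>j = 2..n. \<Sum>k = 1..q. real ((p + q - k - 1) choose (p - 1)) *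
                a ^ j * (-1) ^ k * lerch_theta b k (real j - 1) (real n) *
                lerch (a ^ n * b) (p + q - k) ((real n - real j + 1) / real n)))) {0..1} \<and>
     ((\<lambda>x. ln x ^ (q - 1) * polylog p (b * x powi (- int n)) / (1 - a * x)) has_integral
        (1 / 2 * a * b * fact (q - 1) * real n powi (- int q) * lerch b (p + q) 1
         - 1 / 2 * a ^ n * b * (1 + (-1) ^ q) * fact (q - 1) * lerch (a ^ n * b) p 1 * lerch a q 1
         + a ^ (n - 1) * (- real n) powi (- int q) * fact (q - 1) *
             (\<Sum>j = 0..q div 2. real ((p + q - 2 * j - 1) choose (p - 1)) *
                lerch b (2 * j) 1 * lerch (a ^ n * b) (p + q - 2 * j) 1)
         + b * (- real n) ^ p * fact (q - 1) *
             (\<Sum>k = 0..p div 2. real ((p + q - 2 * k - 1) choose (q - 1)) *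
                real n powi (- 2 * int k) * lerch b (2 * k) 1 * lerch a (p + q - 2 * k) 1)
         + 1 / 2 * a ^ n * b * (- real n) powi (- int q) * fact (q - 1) *
             (\<Sum>j = 2..n. \<Sum>k = 1..q. real ((p + q - k - 1) choose (p - 1)) *
                a ^ j * (-1) ^ k * lerch_theta b k (real j - 1) (real n) *
                lerch (a ^ n * b) (p + q - k) ((real n - real j + 1) / real n)))) {0..1}"
proof -
  have ab: "a ^ n * b \<noteq> 1 \<or> p \<noteq> 1" and a1: "a \<noteq> 1 \<or> q \<noteq> 1"
    using assms by blast+
  note p = assms(1) and q = assms(2) and n = assms(3) and pq = assms(4) and a = assms(5) and b = assms(6)
  note I = polylog_log_integral[OF p q n pq a b ab a1]
  let ?f = "\<lambda>x. ln x ^ (q - 1) * polylog p (b * x ^ n) / (1 - a * x)"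
  let ?r = "\<lambda>x. \<Sum>k = 0..p div 2. 2 * b * (lerch b (2 * k) 1 * real n ^ (p - 2 * k) / fact (p - 2 * k)) *
            ((-1) ^ (q - 1) * ((- ln x) ^ (p + q - 2 * k - 1) / (1 - a * x)))"
  define \<sigma> where "\<sigma> = (-1 :: real) ^ q"
  have \<sigma>: "\<sigma> * \<sigma> = 1" "(-1) ^ (p - 1) = \<sigma>" "(-1) ^ p = - \<sigma>"
    using pq p unfolding \<sigma>_def by (cases "even p"; cases p; auto)+
  \<comment> \<open>Inversion multiplies Li_p(b x^n) by (-1)^(p-1), which is (-1)^q as p + q is odd.
    So (ii) is (-1)^q times (i) plus the remainder.\<close>
  note A = has_integral_add[OF has_integral_mult_right[OF I, of \<sigma>]
      has_integral_inversion_remainder[OF p q n pq a a1, of b]]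
  have B: "ln x ^ (q - 1) * polylog p (b * x powi (- int n)) / (1 - a * x) = \<sigma> * ?f x + ?r x"
    if "x \<in> {0..1} - {0, 1}" for x
  proof -
    have x: "0 < x" "x < 1" using that by auto
    have Y: "0 < x ^ n" "x ^ n < 1" using x n power_Suc_less_one[of x "n - 1"] by auto
    have "b * x powi (- int n) = b / x ^ n" by (simp add: power_int_minus divide_inverse)
    moreover have "- ln (x ^ n) = real n * (- ln x)" using x by (simp add: ln_realpow)
    ultimately have "polylog p (b * x powi (- int n)) = \<sigma> * polylog p (b * x ^ n) +
        2 * b * (\<Sum>k = 0..p div 2. lerch b (2 * k) 1 * (real n * (- ln x)) ^ (p - 2 * k) / fact (p - 2 * k))"
      using polylog_inversion[OF Y b p] by (simp only: \<sigma>(2))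
    also have "2 * b * (\<Sum>k = 0..p div 2. lerch b (2 * k) 1 * (real n * (- ln x)) ^ (p - 2 * k) / fact (p - 2 * k)) =
        (\<Sum>k = 0..p div 2. 2 * b * (lerch b (2 * k) 1 * real n ^ (p - 2 * k) / fact (p - 2 * k)) * (- ln x) ^ (p - 2 * k))"
      unfolding sum_distrib_left power_mult_distrib by (intro sum.cong refl) simp
    finally have "polylog p (b * x powi (- int n)) = \<sigma> * polylog p (b * x ^ n) +
        (\<Sum>k = 0..p div 2. 2 * b * (lerch b (2 * k) 1 * real n ^ (p - 2 * k) / fact (p - 2 * k)) * (- ln x) ^ (p - 2 * k))"
      .
    then have "ln x ^ (q - 1) * polylog p (b * x powi (- int n)) / (1 - a * x) = \<sigma> * ?f x +
       (\<Sum>k = 0..p div 2. 2 * b * (lerch b (2 * k) 1 * real n ^ (p - 2 * k) / fact (p - 2 * k)) * (- ln x) ^ (p - 2 * k))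
         * (ln x ^ (q - 1) / (1 - a * x))"
      by (simp add: distrib_left add_divide_distrib mult_ac)
    also have "(\<Sum>k = 0..p div 2. 2 * b * (lerch b (2 * k) 1 * real n ^ (p - 2 * k) / fact (p - 2 * k)) * (- ln x) ^ (p - 2 * k))
         * (ln x ^ (q - 1) / (1 - a * x)) = ?r x"
      unfolding sum_distrib_right
    proof (rule sum.cong[OF refl])
      fix k assume "k \<in> {0..p div 2}"
      then have k: "2 * k \<le> p" by auto
      have l: "ln x ^ (q - 1) = (-1) ^ (q - 1) * (- ln x) ^ (q - 1)"
        using power_mult_distrib[of "-1" "- ln x" "q - 1"] by simp
      have "(- ln x) ^ (p + q - 2 * k - 1) = (- ln x) ^ (p - 2 * k) * (- ln x) ^ (q - 1)"
      proof -
        have "p + q - 2 * k - 1 = (p - 2 * k) + (q - 1)" using k q by linarith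
        then show ?thesis by (simp only: power_add)
      qed
      then show "2 * b * (lerch b (2 * k) 1 * real n ^ (p - 2 * k) / fact (p - 2 * k)) * (- ln x) ^ (p - 2 * k)
         * (ln x ^ (q - 1) / (1 - a * x)) =
        2 * b * (lerch b (2 * k) 1 * real n ^ (p - 2 * k) / fact (p - 2 * k)) *
            ((-1) ^ (q - 1) * ((- ln x) ^ (p + q - 2 * k - 1) / (1 - a * x)))"
        unfolding l by simp
    qed
    finally show ?thesis .
  qed
  have pw: "(- real n) powi (- int q) = \<sigma> * real n powi (- int q)"
  proof -
    have "(- real n) powi (- int q) = 1 / ((-1) ^ q * real n ^ q)"
      by (simp add: power_int_minus divide_inverse power_minus[of "real n"])
    then show ?thesis unfolding \<sigma>_def by (cases "even q") (simp_all add: power_int_minus divide_inverse)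
  qed
  have pw': "(- real n) ^ p = - \<sigma> * real n ^ p"
    using power_minus[of "real n" p] \<sigma>(3) by simp
  \<comment> \<open>The remainder is twice the fourth summand of (ii). Since (-n)^p = -\<sigma> n^p,
    it turns \<sigma> b n^p from (i) into b (-n)^p; all other summands only change by
    \<sigma>.\<close>
  have alg: "\<sigma> * (1 / 2 * a * b * \<sigma> * F * W * l1 - 1 / 2 * a ^ n * b * (1 + \<sigma>) * F * l2 * l3 + A * W * F * s3
       + b * M * F * s4 + 1 / 2 * a ^ n * b * W * F * s5) + 2 * b * (- \<sigma> * M) * F * s4 =
     1 / 2 * a * b * F * W * l1 - 1 / 2 * a ^ n * b * (1 + \<sigma>) * F * l3 * l2 + A * (\<sigma> * W) * F * s3
       + b * (- \<sigma> * M) * F * s4 + 1 / 2 * a ^ n * b * (\<sigma> * W) * F * s5" for F W l1 l2 l3 A M s3 s4 s5 :: real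
  proof -
    have ss: "\<sigma> * (\<sigma> * y) = y" for y using \<sigma>(1) by (metis mult.assoc mult_1)
    show ?thesis by (simp add: algebra_simps ss)
  qed
  show ?thesis
  proof (rule conjI[OF I], goal_cases)
    case 1
    show ?case
      unfolding pw pw' \<sigma>_def [symmetric] alg [symmetric]
      by (rule has_integral_spike_finite[OF _ B A[unfolded pw' \<sigma>_def [symmetric]]]) (rule finite.intros | assumption)+
  qed
qed

end
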